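(* Let $\alpha$ be a completely isometric automorphism of an exact operator space $X$. Suppose that $\mathrm{hc}(\alpha)>0$. Then $\mathrm{hcc}(\alpha)>0$.
   Context: CA entropy: For a bounded linear map $\gamma:X\to Y$ of (complex) Banach spaces, a finite set $\Omega\subseteq X$ and $\delta>0$, let $\mathrm{CA}(\gamma,\Omega,\delta)$ be the collection of triples $(\phi,\psi,d)$ where $d$ is a positive integer and $\phi:X\to\ell_\infty^d$, $\psi:\ell_\infty^d\to Y$ are contractive (norm $\le1$) linear maps with $\|\psi\circ\phi(x)-\gamma(x)\|<\delta$ for all $x\in\Omega$. A CA embedding of $X$ is an isometric linear map $\iota$ from $X$ into a Banach space $Y$ such that $\mathrm{CA}(\iota,\Omega,\delta)\neq\emptyset$ for all finite $\Omega\subseteq X$ and $\delta>0$; every Banach space has one (e.g. the evaluation map $X\to C(B_1(X^* ))$, where $B_1(X^* )$ is the weak$^*$ compact unit ball of the dual). Set $\mathrm{rc}(\Omega,\delta)=\inf\{d:(\phi,\psi,d)\in\mathrm{CA}(\iota,\Omega,\delta)\}$, which does not depend on the CA embedding $\iota$. For an isometric (surjective linear) automorphism $\alpha$ of $X$ put $\mathrm{hc}(\alpha,\Omega,\delta)=\limsup_{n\to\infty}\frac1n\log\mathrm{rc}(\Omega\cup\alpha\Omega\cup\cdots\cup\alpha^{n-1}\Omega,\delta)$, $\mathrm{hc}(\alpha,\Omega)=\sup_{\delta>0}\mathrm{hc}(\alpha,\Omega,\delta)$, and $\mathrm{hc}(\alpha)=\sup_\Omega\mathrm{hc}(\alpha,\Omega)$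 over finite $\Omega\subseteq X$. CCA entropy: For a bounded linear map $\gamma:X\to Y$ of operator spaces, finite $\Omega\subseteq X$ and $\delta>0$, let $\mathrm{CCA}(\gamma,\Omega,\delta)$ be the collection of triples $(\phi,\psi,B)$ where $B$ is a finite-dimensional $C^*$-algebra and $\phi:X\to B$, $\psi:B\to Y$ are completely contractive linear maps with $\|\psi\circ\phi(x)-\gamma(x)\|<\delta$ for all $x\in\Omega$. A nuclear embedding of $X$ is a completely isometric linear map $\iota$ from $X$ to an operator space $Y$ such that $\mathrm{CCA}(\iota,\Omega,\delta)\ne\emptyset$ for all finite $\Omega\subseteq X$ and $\delta>0$. An operator space is exact if and only if it admits a nuclear embedding. For $X$ exact with nuclear embedding $\iota$, set $\mathrm{rcc}(\Omega,\delta)=\inf\{\mathrm{rank}\,B:(\phi,\psi,B)\in\mathrm{CCA}(\iota,\Omega,\delta)\}$, where $\mathrm{rank}\,B$ is the dimension of a maximal abelian $^*$-subalgebra of $B$; this is independent of $\iota$. For a completely isometric automorphism $\alpha$ of $X$ set $\mathrm{hcc}(\alpha)=\sup_\Omega\sup_{\delta>0}\limsup_{n\to\infty}\frac1n\log\mathrm{rcc}(\Omega\cup\alpha\Omega\cup\cdots\cup\alpha^{n-1}\Omega,\delta)$, the supremum being over finite $\Omega\subseteq X$. *)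

theory Defs
  imports "HOL-Analysis.Analysis" "HOL-Library.Function_Algebras"
begin

section \<open>Complex Banach spaces\<close>

class scaleC =
  fixes scaleC :: "complex \<Rightarrow> 'a \<Rightarrow> 'a"  (infixr "*\<^sub>C" 75)

class complex_vector = scaleC + ab_group_add +
  assumes scaleC_add_right: "a *\<^sub>C (x + y) = a *\<^sub>C x + a *\<^sub>C y"
    and scaleC_add_left: "(a + b) *\<^sub>C x = a *\<^sub>C x + b *\<^sub>C x"
    and scaleC_scaleC: "a *\<^sub>C (b *\<^sub>C x) = (a * b) *\<^sub>C x"
    and scaleC_one: "1 *\<^sub>C x = x"

global_interpretation complex_vector: vector_space "scaleC :: complex \<Rightarrow> 'a \<Rightarrow> 'a::complex_vector"
  by unfold_locales (simp_all add: scaleC_add_right scaleC_add_left scaleC_scaleC scaleC_one)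

class complex_banach = complex_vector + banach +
  assumes scaleC_of_real: "complex_of_real r *\<^sub>C x = r *\<^sub>R x"
    and norm_scaleC: "norm (a *\<^sub>C x) = cmod a * norm x"

instantiation complex :: complex_vector
begin
definition scaleC_complex :: "complex \<Rightarrow> complex \<Rightarrow> complex" where "scaleC_complex a x = a * x"
instance by standard (simp_all add: scaleC_complex_def algebra_simps)
end

instantiation "fun" :: (type, complex_vector) complex_vector
begin
definition scaleC_fun :: "complex \<Rightarrow> ('a \<Rightarrow> 'b) \<Rightarrow> 'a \<Rightarrow> 'b" where "scaleC_fun a f = (\<lambda>x. a *\<^sub>C f x)"
instance
  by standard (simp_all add: scaleC_fun_def fun_eq_iff scaleC_add_right scaleC_add_left scaleC_scaleC scaleC_one)
end

definition clinear_on :: "'a::complex_vector set \<Rightarrow> ('a \<Rightarrow> 'b::complex_vector) \<Rightarrow> bool" where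
  "clinear_on V f \<longleftrightarrow> (\<forall>x\<in>V. \<forall>y\<in>V. f (x + y) = f x + f y) \<and> (\<forall>c. \<forall>x\<in>V. f (c *\<^sub>C x) = c *\<^sub>C f x)"

definition contractive_linear_on ::
    "'a::complex_vector set \<Rightarrow> ('a \<Rightarrow> real) \<Rightarrow> 'b::complex_vector set \<Rightarrow> ('b \<Rightarrow> real) \<Rightarrow> ('a \<Rightarrow> 'b) \<Rightarrow> bool" where
  "contractive_linear_on V p W q f \<longleftrightarrow>
     f \<in> V \<rightarrow> W \<and> clinear_on V f \<and> (\<forall>x\<in>V. q (f x) \<le> p x)"


section \<open>Operator spaces\<close>

text \<open>An n-by-n matrix is a function of two indices (counted from 0) that vanishes outside the
  index square; addition and scaling are the pointwise operations on functions.\<close>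

definition (in zero) mats :: "nat \<Rightarrow> 'a set \<Rightarrow> (nat \<Rightarrow> nat \<Rightarrow> 'a) set" where
  "mats n V = {a. (\<forall>i<n. \<forall>j<n. a i j \<in> V) \<and> (\<forall>i j. n \<le> i \<or> n \<le> j \<longrightarrow> a i j = 0)}"

definition (in zero) mat1 :: "'a \<Rightarrow> nat \<Rightarrow> nat \<Rightarrow> 'a" where
  "mat1 x = (\<lambda>i j. if i = 0 \<and> j = 0 then x else 0)"

definition map_mat :: "('a \<Rightarrow> 'b) \<Rightarrow> (nat \<Rightarrow> nat \<Rightarrow> 'a) \<Rightarrow> nat \<Rightarrow> nat \<Rightarrow> 'b" where
  "map_mat f a = (\<lambda>i j. f (a i j))"

definition (in zero) direct_sum_mat :: "nat \<Rightarrow> (nat \<Rightarrow> nat \<Rightarrow> 'a) \<Rightarrow> (nat \<Rightarrow> nat \<Rightarrow> 'a) \<Rightarrow> nat \<Rightarrow> nat \<Rightarrow> 'a" where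
  "direct_sum_mat m a b = (\<lambda>i j. if i < m \<and> j < m then a i j
                                 else if m \<le> i \<and> m \<le> j then b (i - m) (j - m) else 0)"

text \<open>Operator norm of a scalar n-by-m matrix between Euclidean spaces.\<close>

definition scalar_mat_norm :: "nat \<Rightarrow> nat \<Rightarrow> (nat \<Rightarrow> nat \<Rightarrow> complex) \<Rightarrow> real" where
  "scalar_mat_norm n m s =
     (SUP v\<in>{v :: nat \<Rightarrow> complex. L2_set (\<lambda>j. cmod (v j)) {..<m} \<le> 1}.
        L2_set (\<lambda>i. cmod (\<Sum>j<m. s i j * v j)) {..<n})"

text \<open>The product \<open>s a t\<close> with \<open>s\<close> scalar n-by-m, \<open>a\<close> an m-by-m matrix of vectors and \<open>t\<close> scalar
  m-by-n.\<close>

definition (in complex_vector) sandwich_mat ::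
    "nat \<Rightarrow> nat \<Rightarrow> (nat \<Rightarrow> nat \<Rightarrow> complex) \<Rightarrow> (nat \<Rightarrow> nat \<Rightarrow> 'a) \<Rightarrow> (nat \<Rightarrow> nat \<Rightarrow> complex)
      \<Rightarrow> nat \<Rightarrow> nat \<Rightarrow> 'a" where
  "sandwich_mat n m s a t = (\<lambda>i j. if i < n \<and> j < n
       then (\<Sum>k<m. \<Sum>l<m. (s i k * t l j) *\<^sub>C a k l) else 0)"

text \<open>Abstract (complete) operator spaces, axiomatised by Ruan's conditions on the matrix norms;
  \<open>mnorm n\<close> is only meaningful on \<open>mats n UNIV\<close> with \<open>n \<ge> 1\<close>.\<close>

class mnorm =
  fixes mnorm :: "nat \<Rightarrow> (nat \<Rightarrow> nat \<Rightarrow> 'a) \<Rightarrow> real"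

class operator_space = mnorm + complex_banach +
  assumes mnorm_mat1: "mnorm 1 (mat1 x) = norm x"
    and mnorm_triangle:
      "\<lbrakk>1 \<le> n; a \<in> mats n UNIV; b \<in> mats n UNIV\<rbrakk> \<Longrightarrow> mnorm n (\<lambda>i j. a i j + b i j) \<le> mnorm n a + mnorm n b"
    and mnorm_scaleC:
      "\<lbrakk>1 \<le> n; a \<in> mats n UNIV\<rbrakk> \<Longrightarrow> mnorm n (\<lambda>i j. c *\<^sub>C a i j) = cmod c * mnorm n a"
    and mnorm_eq_0: "\<lbrakk>1 \<le> n; a \<in> mats n UNIV; mnorm n a = 0\<rbrakk> \<Longrightarrow> a = (\<lambda>i j. 0)"
    and mnorm_direct_sum:
      "\<lbrakk>1 \<le> m; 1 \<le> n; a \<in> mats m UNIV; b \<in> mats n UNIV\<rbrakk>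
        \<Longrightarrow> mnorm (m + n) (direct_sum_mat m a b) = max (mnorm m a) (mnorm n b)"
    and mnorm_sandwich:
      "\<lbrakk>1 \<le> m; 1 \<le> n; a \<in> mats m UNIV\<rbrakk>
        \<Longrightarrow> mnorm n (sandwich_mat n m s a t) \<le> scalar_mat_norm n m s * mnorm m a * scalar_mat_norm m n t"

definition completely_isometric :: "('a::operator_space \<Rightarrow> 'b::operator_space) \<Rightarrow> bool" where
  "completely_isometric f \<longleftrightarrow>
     clinear_on UNIV f \<and> (\<forall>n\<ge>1. \<forall>a\<in>mats n UNIV. mnorm n (map_mat f a) = mnorm n a)"

definition completely_isometric_automorphism :: "('a::operator_space \<Rightarrow> 'a) \<Rightarrow> bool" where
  "completely_isometric_automorphism f \<longleftrightarrow> bij f \<and> completely_isometric f"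


section \<open>Finite-dimensional C*-algebras\<close>

definition cstar_algebra ::
    "'a::complex_vector set \<Rightarrow> ('a \<Rightarrow> 'a \<Rightarrow> 'a) \<Rightarrow> ('a \<Rightarrow> 'a) \<Rightarrow> ('a \<Rightarrow> real) \<Rightarrow> bool" where
  "cstar_algebra V mul str nrm \<longleftrightarrow>
     complex_vector.subspace V \<and>
     (\<forall>x\<in>V. \<forall>y\<in>V. mul x y \<in> V) \<and>
     (\<forall>x\<in>V. clinear_on V (mul x)) \<and>
     (\<forall>y\<in>V. clinear_on V (\<lambda>x. mul x y)) \<and>
     (\<forall>x\<in>V. \<forall>y\<in>V. \<forall>z\<in>V. mul (mul x y) z = mul x (mul y z)) \<and>
     (\<forall>x\<in>V. str x \<in> V) \<and>
     (\<forall>x\<in>V. \<forall>y\<in>V. str (x + y) = str x + str y) \<and>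
     (\<forall>c. \<forall>x\<in>V. str (c *\<^sub>C x) = cnj c *\<^sub>C str x) \<and>
     (\<forall>x\<in>V. str (str x) = x) \<and>
     (\<forall>x\<in>V. \<forall>y\<in>V. str (mul x y) = mul (str y) (str x)) \<and>
     (\<forall>x\<in>V. \<forall>y\<in>V. nrm (x + y) \<le> nrm x + nrm y) \<and>
     (\<forall>c. \<forall>x\<in>V. nrm (c *\<^sub>C x) = cmod c * nrm x) \<and>
     (\<forall>x\<in>V. nrm x = 0 \<longrightarrow> x = 0) \<and>
     (\<forall>x\<in>V. \<forall>y\<in>V. nrm (mul x y) \<le> nrm x * nrm y) \<and>
     (\<forall>x\<in>V. nrm (mul (str x) x) = (nrm x)\<^sup>2) \<and>
     (\<forall>s :: nat \<Rightarrow> 'a. range s \<subseteq> V \<and> (\<forall>e>0. \<exists>N. \<forall>m\<ge>N. \<forall>n\<ge>N. nrm (s m - s n) < e)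
        \<longrightarrow> (\<exists>l\<in>V. (\<lambda>n. nrm (s n - l)) \<longlonglongrightarrow> 0))"

definition mat_mul :: "('a \<Rightarrow> 'a \<Rightarrow> 'a::complex_vector) \<Rightarrow> nat \<Rightarrow>
    (nat \<Rightarrow> nat \<Rightarrow> 'a) \<Rightarrow> (nat \<Rightarrow> nat \<Rightarrow> 'a) \<Rightarrow> nat \<Rightarrow> nat \<Rightarrow> 'a" where
  "mat_mul mul n a b = (\<lambda>i j. \<Sum>k<n. mul (a i k) (b k j))"

definition mat_star :: "('a \<Rightarrow> 'a) \<Rightarrow> (nat \<Rightarrow> nat \<Rightarrow> 'a) \<Rightarrow> nat \<Rightarrow> nat \<Rightarrow> 'a" where
  "mat_star str a = (\<lambda>i j. str (a j i))"

text \<open>The underlying vector space is realised as a finite-dimensional subspace of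
  \<open>nat \<Rightarrow> complex\<close>, which is no restriction; product, involution and norm are arbitrary.
  The canonical operator space structure is carried along as \<open>B_mnorm\<close>. It is not
  additional data: \<open>B_mnorm B n\<close> is required to be a C*-norm on the n-by-n matrices over \<open>B\<close>
  (the usual *-algebra), and every C*-algebra has exactly one such norm for each n.
  The norm of \<open>B\<close> itself is the case n = 1.\<close>

record star_algebra =
  B_carrier :: "(nat \<Rightarrow> complex) set"
  B_mul :: "(nat \<Rightarrow> complex) \<Rightarrow> (nat \<Rightarrow> complex) \<Rightarrow> nat \<Rightarrow> complex"
  B_star :: "(nat \<Rightarrow> complex) \<Rightarrow> nat \<Rightarrow> complex"
  B_mnorm :: "nat \<Rightarrow> (nat \<Rightarrow> nat \<Rightarrow> nat \<Rightarrow> complex) \<Rightarrow> real"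

definition fd_cstar_algebra :: "star_algebra \<Rightarrow> bool" where
  "fd_cstar_algebra B \<longleftrightarrow>
     (\<exists>S. finite S \<and> B_carrier B = complex_vector.span S) \<and>
     cstar_algebra (B_carrier B) (B_mul B) (B_star B) (\<lambda>b. B_mnorm B 1 (mat1 b)) \<and>
     (\<forall>n\<ge>1. cstar_algebra (mats n (B_carrier B)) (mat_mul (B_mul B) n) (mat_star (B_star B)) (B_mnorm B n))"

definition abelian_star_subalgebra :: "star_algebra \<Rightarrow> (nat \<Rightarrow> complex) set \<Rightarrow> bool" where
  "abelian_star_subalgebra B A \<longleftrightarrow>
     A \<subseteq> B_carrier B \<and> complex_vector.subspace A \<and>
     (\<forall>x\<in>A. \<forall>y\<in>A. B_mul B x y \<in> A) \<and> (\<forall>x\<in>A. B_star B x \<in> A) \<and>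
     (\<forall>x\<in>A. \<forall>y\<in>A. B_mul B x y = B_mul B y x)"

definition maximal_abelian_star_subalgebra :: "star_algebra \<Rightarrow> (nat \<Rightarrow> complex) set \<Rightarrow> bool" where
  "maximal_abelian_star_subalgebra B A \<longleftrightarrow>
     abelian_star_subalgebra B A \<and> (\<forall>A'. abelian_star_subalgebra B A' \<and> A \<subseteq> A' \<longrightarrow> A' = A)"

text \<open>All maximal abelian *-subalgebras of a finite-dimensional C*-algebra have the same dimension.\<close>

definition B_rank :: "star_algebra \<Rightarrow> nat" where
  "B_rank B = complex_vector.dim (SOME A. maximal_abelian_star_subalgebra B A)"


section \<open>CA entropy\<close>

definition linf :: "nat \<Rightarrow> (nat \<Rightarrow> complex) set" where
  "linf d = {v. \<forall>i\<ge>d. v i = 0}"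

definition linf_norm :: "nat \<Rightarrow> (nat \<Rightarrow> complex) \<Rightarrow> real" where
  "linf_norm d v = Max ((\<lambda>i. cmod (v i)) ` {..<d})"

definition CA :: "('x::complex_banach \<Rightarrow> 'y::complex_banach) \<Rightarrow> 'x set \<Rightarrow> real
    \<Rightarrow> (('x \<Rightarrow> nat \<Rightarrow> complex) \<times> ((nat \<Rightarrow> complex) \<Rightarrow> 'y) \<times> nat) set" where
  "CA \<gamma> \<Omega> \<delta> = {(\<phi>, \<psi>, d). 1 \<le> d \<and>
     contractive_linear_on UNIV norm (linf d) (linf_norm d) \<phi> \<and>
     contractive_linear_on (linf d) (linf_norm d) UNIV norm \<psi> \<and>
     (\<forall>x\<in>\<Omega>. norm (\<psi> (\<phi> x) - \<gamma> x) < \<delta>)}"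

definition CA_embedding :: "('x::complex_banach \<Rightarrow> 'y::complex_banach) \<Rightarrow> bool" where
  "CA_embedding \<iota> \<longleftrightarrow> clinear_on UNIV \<iota> \<and> (\<forall>x. norm (\<iota> x) = norm x) \<and>
     (\<forall>\<Omega> \<delta>. finite \<Omega> \<and> 0 < \<delta> \<longrightarrow> CA \<iota> \<Omega> \<delta> \<noteq> {})"

definition rc :: "('x::complex_banach \<Rightarrow> 'y::complex_banach) \<Rightarrow> 'x set \<Rightarrow> real \<Rightarrow> nat" where
  "rc \<iota> \<Omega> \<delta> = Inf {d. \<exists>\<phi> \<psi>. (\<phi>, \<psi>, d) \<in> CA \<iota> \<Omega> \<delta>}"

definition orbit :: "('x \<Rightarrow> 'x) \<Rightarrow> 'x set \<Rightarrow> nat \<Rightarrow> 'x set" where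
  "orbit \<alpha> \<Omega> n = (\<Union>i<n. (\<alpha> ^^ i) ` \<Omega>)"

text \<open>The CA embedding \<open>\<iota>\<close> used to compute the entropy is an explicit argument; the value does not
  depend on it.\<close>

definition hc :: "('x::complex_banach \<Rightarrow> 'y::complex_banach) \<Rightarrow> ('x \<Rightarrow> 'x) \<Rightarrow> ereal" where
  "hc \<iota> \<alpha> = (SUP \<Omega>\<in>{\<Omega>. finite \<Omega>}. SUP \<delta>\<in>{0<..}.
     limsup (\<lambda>n. ereal (1 / real n * ln (real (rc \<iota> (orbit \<alpha> \<Omega> n) \<delta>)))))"


section \<open>CCA entropy\<close>

definition CCA :: "('x::operator_space \<Rightarrow> 'y::operator_space) \<Rightarrow> 'x set \<Rightarrow> real
    \<Rightarrow> (('x \<Rightarrow> nat \<Rightarrow> complex) \<times> ((nat \<Rightarrow> complex) \<Rightarrow> 'y) \<times> star_algebra) set" where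
  "CCA \<gamma> \<Omega> \<delta> = {(\<phi>, \<psi>, B). fd_cstar_algebra B \<and>
     \<phi> \<in> UNIV \<rightarrow> B_carrier B \<and> clinear_on UNIV \<phi> \<and>
     (\<forall>n\<ge>1. \<forall>a\<in>mats n UNIV. B_mnorm B n (map_mat \<phi> a) \<le> mnorm n a) \<and>
     clinear_on (B_carrier B) \<psi> \<and>
     (\<forall>n\<ge>1. \<forall>b\<in>mats n (B_carrier B). mnorm n (map_mat \<psi> b) \<le> B_mnorm B n b) \<and>
     (\<forall>x\<in>\<Omega>. norm (\<psi> (\<phi> x) - \<gamma> x) < \<delta>)}"

text \<open>An operator space is exact iff it admits a nuclear embedding; since the target may be of any type,
  exactness is expressed by fixing such an embedding.\<close>

definition nuclear_embedding :: "('x::operator_space \<Rightarrow> 'y::operator_space) \<Rightarrow> bool" where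
  "nuclear_embedding \<kappa> \<longleftrightarrow> completely_isometric \<kappa> \<and>
     (\<forall>\<Omega> \<delta>. finite \<Omega> \<and> 0 < \<delta> \<longrightarrow> CCA \<kappa> \<Omega> \<delta> \<noteq> {})"

definition rcc :: "('x::operator_space \<Rightarrow> 'y::operator_space) \<Rightarrow> 'x set \<Rightarrow> real \<Rightarrow> nat" where
  "rcc \<kappa> \<Omega> \<delta> = Inf {r. \<exists>\<phi> \<psi> B. (\<phi>, \<psi>, B) \<in> CCA \<kappa> \<Omega> \<delta> \<and> r = B_rank B}"

text \<open>The zero algebra is admitted in \<open>CCA\<close>, so \<open>rcc\<close> can be 0; then \<open>ln 0 = 0\<close> in HOL. By isometry of
  the automorphism this happens for one positive n iff it happens for all, and it therefore never affects
  whether the entropy is positive.\<close>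

definition hcc :: "('x::operator_space \<Rightarrow> 'y::operator_space) \<Rightarrow> ('x \<Rightarrow> 'x) \<Rightarrow> ereal" where
  "hcc \<kappa> \<alpha> = (SUP \<Omega>\<in>{\<Omega>. finite \<Omega>}. SUP \<delta>\<in>{0<..}.
     limsup (\<lambda>n. ereal (1 / real n * ln (real (rcc \<kappa> (orbit \<alpha> \<Omega> n) \<delta>)))))"

end

theory Submission
  imports Defs "HOL-Computational_Algebra.Fundamental_Theorem_Algebra"
begin

text \<open>
  The argument is by contraposition and compares both ranks with a covering number. Suppose that
  \<open>hcc\<close> vanishes, let \<open>\<Omega>\<close> be one of the finite sets \<open>orbit \<alpha> \<Omega>\<^sub>0 n\<close>, and put \<open>N = card \<Omega>\<close>, which is
  at most linear in \<open>n\<close>.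

  First, a \<open>\<delta>\<close>-net \<open>Z\<close> of the absolutely convex hull of \<open>\<Omega>\<close> in the norm of \<open>X\<close> gives
  \<open>rc \<Omega> (3\<delta>) \<le> card Z\<close> (\<open>rc_le_card_net\<close>). Indeed, choose for every \<open>z \<in> Z\<close> a functional of norm at
  most 1 that almost norms \<open>z\<close>. The maximum of these functionals determines the norm on the absolutely
  convex hull of \<open>\<Omega>\<close> up to an additive error. By Hahn--Banach duality this says that every contractive
  functional agrees on \<open>\<Omega>\<close>, up to that error, with an element of the absolutely convex hull of the
  chosen ones. Hence a CA approximation of arbitrary dimension can be factored through
  \<open>\<ell>\<^sub>\<infinity>\<close> of dimension \<open>card Z\<close>.

  Second, a CCA approximation \<open>\<phi> : X \<rightarrow> B\<close>, \<open>\<psi> : B \<rightarrow> Y\<close> that is accurate on \<open>\<Omega>\<close> makes \<open>\<phi>\<close> almost isometric on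
  the absolutely convex hull of \<open>\<Omega>\<close>, so the net may be found in \<open>B\<close>, where only \<open>log (rank B)\<close> matters.
  For elements \<open>x\<^sub>1, \<dots>, x\<^sub>k\<close> of \<open>B\<close> of norm at most \<open>R\<close> there are signs with
  \<open>\<parallel>\<Sum> \<epsilon>\<^sub>l x\<^sub>l\<parallel> \<le> C R sqrt (q k)\<close>, where \<open>q\<close> is of the order \<open>1 + log (rank B)\<close> (\<open>signs_exist\<close>; a
  C*-algebra of rank \<open>d\<close> has type 2 with constant of order \<open>sqrt (1 + log d)\<close>). The proof is a moment computation:
  by the C*-identity a high power of the norm of \<open>S = \<Sum> \<epsilon>\<^sub>l x\<^sub>l\<close> is the norm of a power of \<open>S\<^sup>*S\<close>; that norm
  is bounded by a sum of \<open>d\<^sup>2\<close> contractive functionals (\<open>coordinate_functionals\<close>); and the second moments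
  of these functionals are dominated by scalar moments of \<open>\<Sum> \<epsilon>\<^sub>l\<close>.

  Third, such signs allow to replace an average of \<open>2k\<close> vectors by the average of \<open>k\<close> among them. Iterating,
  every absolutely convex combination of \<open>\<Omega>\<close> is \<open>\<delta>\<close>-close to an average of only \<open>k = q L\<close> vectors from a set of
  at most \<open>4N + 1\<close> elements, where \<open>L\<close> depends only on \<open>\<delta>\<close> and \<open>\<Omega>\<^sub>0\<close>. An average depends only on the
  multiplicities, so there are at most \<open>(k + 4N) choose k\<close> of them. (The naive count \<open>(4N + 1)\<^sup>k\<close> would lose a
  factor \<open>log n\<close> in the exponent.) If \<open>log (rank B) = o(n)\<close> then \<open>k = o(n)\<close>, while \<open>N = O(n)\<close>,
  and this binomial coefficient is subexponential. Therefore \<open>hc\<close> vanishes as well.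
\<close>

section \<open>Sublinear functionals and Hahn--Banach duality in finite dimension\<close>

text \<open>Homogeneity is only required as an inequality; the converse inequality follows by scaling with
  \<open>1 / t\<close>, and infima of sublinear functionals are easier to recognise this way.\<close>
definition sublinear :: "('a::complex_vector \<Rightarrow> real) \<Rightarrow> bool" where
  "sublinear p \<longleftrightarrow> (\<forall>x y. p (x + y) \<le> p x + p y) \<and>
     (\<forall>t x. 0 \<le> t \<longrightarrow> p (complex_of_real t *\<^sub>C x) \<le> t * p x)"

lemma sublinear_0: "sublinear p \<Longrightarrow> p 0 = 0"
proof -
  assume p: "sublinear p"
  have "p (complex_of_real 0 *\<^sub>C 0) \<le> 0 * p 0" using p unfolding sublinear_def by blast
  moreover have "p (0 + 0) \<le> p 0 + p 0" using p unfolding sublinear_def by blast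
  ultimately show ?thesis by simp
qed

lemma sublinear_add: "sublinear p \<Longrightarrow> p (x + y) \<le> p x + p y"
  by (simp add: sublinear_def)

lemma sublinear_scale_le: "sublinear p \<Longrightarrow> 0 \<le> t \<Longrightarrow> p (complex_of_real t *\<^sub>C x) \<le> t * p x"
  by (simp add: sublinear_def)

lemma sublinear_scale:
  assumes p: "sublinear p" and t: "0 \<le> t"
  shows "p (complex_of_real t *\<^sub>C x) = t * p x"
proof (cases "t = 0")
  case True
  then show ?thesis using sublinear_0[OF p] by simp
next
  case False
  have "p (complex_of_real (1/t) *\<^sub>C (complex_of_real t *\<^sub>C x)) \<le> (1/t) * p (complex_of_real t *\<^sub>C x)"
    using t by (intro sublinear_scale_le[OF p]) simp
  moreover have "complex_of_real (1/t) *\<^sub>C (complex_of_real t *\<^sub>C x) = x"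
    using False by (simp add: scaleC_scaleC scaleC_one flip: of_real_mult)
  ultimately have "p x * t \<le> p (complex_of_real t *\<^sub>C x)" using False t by (simp add: field_simps)
  then show ?thesis using sublinear_scale_le[OF p t, of x] by (simp add: mult.commute)
qed

lemma sublinear_minus: "sublinear p \<Longrightarrow> - p (- x) \<le> p x"
  using sublinear_add[of p x "-x"] sublinear_0[of p] by simp

text \<open>A sublinear functional can be lowered so as to satisfy a convex cone of linear constraints
  \<open>p' (- w) \<le> r\<close>, provided that it is compatible with them: take the infimum of \<open>p (x + w) + r\<close>. This one
  construction serves both to impose the constraints of a duality problem and, with a cone
  generated by a single vector, to make a functional linear in one direction.\<close>
lemma sublinear_inf_cone:
  fixes S :: "('a::complex_vector \<times> real) set"
  assumes p: "sublinear p" and zero: "(0, 0) \<in> S"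
    and add: "\<And>w r w' r'. (w, r) \<in> S \<Longrightarrow> (w', r') \<in> S \<Longrightarrow> (w + w', r + r') \<in> S"
    and scale: "\<And>t w r. (w, r) \<in> S \<Longrightarrow> 0 \<le> t \<Longrightarrow> (complex_of_real t *\<^sub>C w, t * r) \<in> S"
    and nonneg: "\<And>w r. (w, r) \<in> S \<Longrightarrow> 0 \<le> p w + r"
  obtains p' where "sublinear p'" "\<And>x. p' x \<le> p x" "\<And>w r. (w, r) \<in> S \<Longrightarrow> p' (- w) \<le> r"
proof -
  define p' where "p' x = (INF s\<in>S. p (x + fst s) + snd s)" for x
  have bdd: "bdd_below ((\<lambda>s. p (x + fst s) + snd s) ` S)" for x
  proof (rule bdd_belowI2)
    fix s assume "s \<in> S"
    then have "0 \<le> p (fst s) + snd s" using nonneg[of "fst s" "snd s"] by simp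
    moreover have "p (fst s) \<le> p (x + fst s) + p (- x)"
      using sublinear_add[OF p, of "x + fst s" "- x"] by simp
    ultimately show "- p (- x) \<le> p (x + fst s) + snd s" by simp
  qed
  have le: "p' x \<le> p (x + w) + r" if "(w, r) \<in> S" for x w r
    unfolding p'_def using cINF_lower[OF bdd that, of x] by simp
  have ge: "c \<le> p' x" if "\<And>w r. (w, r) \<in> S \<Longrightarrow> c \<le> p (x + w) + r" for c x
    unfolding p'_def using zero that by (intro cINF_greatest) auto
  have "p' (x + y) \<le> p' x + p' y" for x y
  proof -
    have "p' (x + y) - (p (x + w) + r) \<le> p' y" if 1: "(w, r) \<in> S" for w r
    proof (rule ge)
      fix w' r' assume 2: "(w', r') \<in> S"
      have "p' (x + y) \<le> p (x + y + (w + w')) + (r + r')" by (rule le[OF add[OF 1 2]])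
      also have "p (x + y + (w + w')) \<le> p (x + w) + p (y + w')"
        using sublinear_add[OF p, of "x + w" "y + w'"] by (simp add: algebra_simps)
      finally show "p' (x + y) - (p (x + w) + r) \<le> p (y + w') + r'" by simp
    qed
    then have "p' (x + y) - p' y \<le> p' x" by (intro ge) (fastforce simp: algebra_simps)
    then show ?thesis by simp
  qed
  moreover have "p' (complex_of_real t *\<^sub>C x) \<le> t * p' x" if t: "0 \<le> t" for t x
  proof (cases "t = 0")
    case True
    then show ?thesis using le[OF zero, of 0] sublinear_0[OF p] by simp
  next
    case False
    have "p' (complex_of_real t *\<^sub>C x) / t \<le> p' x"
    proof (rule ge)
      fix w r assume "(w, r) \<in> S"
      then have "p' (complex_of_real t *\<^sub>C x) \<le> p (complex_of_real t *\<^sub>C x + complex_of_real t *\<^sub>C w) + t * r"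
        using t by (intro le scale)
      also have "\<dots> = t * (p (x + w) + r)"
        using sublinear_scale[OF p t, of "x + w"] by (simp add: scaleC_add_right distrib_left)
      finally show "p' (complex_of_real t *\<^sub>C x) / t \<le> p (x + w) + r"
        using False t by (simp add: field_simps)
    qed
    then show ?thesis using False t by (simp add: field_simps)
  qed
  ultimately have "sublinear p'" by (simp add: sublinear_def)
  moreover have "p' x \<le> p x" for x using le[OF zero, of x] by simp
  moreover have "p' (- w) \<le> r" if "(w, r) \<in> S" for w r
    using le[OF that, of "- w"] sublinear_0[OF p] by simp
  ultimately show thesis by (rule that)
qed

text \<open>Once \<open>p (- v) \<le> - p v\<close> holds it persists for all smaller sublinear functionals, so
  finitely many directions can be treated one after the other.\<close>
lemma sublinear_antisymmetrize:
  assumes "sublinear p"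
  shows "\<exists>p'. sublinear p' \<and> (\<forall>x. p' x \<le> p x) \<and> (\<forall>v\<in>set vs. p' (- v) \<le> - p' v)"
proof (induction vs)
  case Nil
  then show ?case using assms by auto
next
  case (Cons v vs)
  then obtain p1 where p1: "sublinear p1" "\<And>x. p1 x \<le> p x" "\<And>u. u \<in> set vs \<Longrightarrow> p1 (- u) \<le> - p1 u"
    by blast
  define S where "S = {(complex_of_real t *\<^sub>C v, - t * p1 v) | t. 0 \<le> t}"
  obtain p2 where p2: "sublinear p2" "\<And>x. p2 x \<le> p1 x" "\<And>w r. (w, r) \<in> S \<Longrightarrow> p2 (- w) \<le> r"
  proof (rule sublinear_inf_cone[OF p1(1), of S])
    show "(0, 0) \<in> S" unfolding S_def by (intro CollectI exI[of _ 0]) simp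
    show "(w + w', r + r') \<in> S" if "(w, r) \<in> S" "(w', r') \<in> S" for w r w' r'
    proof -
      from that obtain t t' where "0 \<le> t" "0 \<le> t'" "w = complex_of_real t *\<^sub>C v" "r = - t * p1 v"
        "w' = complex_of_real t' *\<^sub>C v" "r' = - t' * p1 v" unfolding S_def by blast
      then show ?thesis unfolding S_def
        by (intro CollectI exI[of _ "t + t'"]) (simp add: scaleC_add_left algebra_simps)
    qed
    show "(complex_of_real s *\<^sub>C w, s * r) \<in> S" if "(w, r) \<in> S" "0 \<le> s" for s w r
    proof -
      from that obtain t where "0 \<le> t" "w = complex_of_real t *\<^sub>C v" "r = - t * p1 v"
        unfolding S_def by blast
      then show ?thesis unfolding S_def using that
        by (intro CollectI exI[of _ "s * t"]) (simp add: scaleC_scaleC algebra_simps)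
    qed
    show "0 \<le> p1 w + r" if "(w, r) \<in> S" for w r
      using that sublinear_scale[OF p1(1)] unfolding S_def by auto
  qed (rule that)
  have "(v, - p1 v) \<in> S" unfolding S_def by (intro CollectI exI[of _ 1]) (simp add: scaleC_one)
  then have "p2 (- v) \<le> - p2 v" using p2(3)[of v "- p1 v"] p2(2)[of v] by linarith
  moreover have "p2 (- u) \<le> - p2 u" if "u \<in> set vs" for u
    using p2(2)[of u] p2(2)[of "-u"] p1(3)[OF that] by linarith
  ultimately show ?case using p2(1,2) p1(2)
    by (intro exI[of _ p2]) (auto intro: order_trans)
qed

text \<open>Finite-dimensional Hahn--Banach theorem: a sublinear functional below the supremum norm of the first \<open>m\<close>
  coordinates dominates the real part of a complex functional, which then has \<open>\<ell>\<^sub>1\<close>-norm at most 1. After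
  antisymmetrizing along the real basis \<open>e\<^sub>i, \<i> e\<^sub>i\<close>, the functional is real linear on the span of these vectors.\<close>
lemma sublinear_minorant_l1:
  fixes p :: "(nat \<Rightarrow> complex) \<Rightarrow> real"
  assumes p: "sublinear p" and bound: "\<And>v b. 0 \<le> b \<Longrightarrow> (\<And>i. i < m \<Longrightarrow> cmod (v i) \<le> b) \<Longrightarrow> p v \<le> b"
  obtains a where "(\<Sum>i<m. cmod (a i)) \<le> 1" "\<And>v. Re (\<Sum>i<m. a i * v i) \<le> p v"
proof -
  define e :: "nat \<Rightarrow> complex \<Rightarrow> nat \<Rightarrow> complex" where "e i c = (\<lambda>j. if j = i then c else 0)" for i c
  obtain q where q: "sublinear q" "\<And>x. q x \<le> p x"
    and anti: "\<And>v. v \<in> set (map (\<lambda>i. e i 1) [0..<m] @ map (\<lambda>i. e i \<i>) [0..<m]) \<Longrightarrow> q (- v) \<le> - q v"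
    using sublinear_antisymmetrize[OF p] by blast
  define L where "L = {v. q (- v) \<le> - q v}"
  have Leq: "q (- v) = - q v" if "v \<in> L" for v
    using that sublinear_minus[OF q(1), of v] by (simp add: L_def)
  have Ladd: "q (u + x) = q u + q x" if "u \<in> L" for u x
  proof (rule antisym)
    show "q (u + x) \<le> q u + q x" by (rule sublinear_add[OF q(1)])
    have "q x \<le> q (u + x) + q (- u)" using sublinear_add[OF q(1), of "u + x" "- u"] by simp
    then show "q u + q x \<le> q (u + x)" using Leq[OF that] by simp
  qed
  have L0: "0 \<in> L" using sublinear_0[OF q(1)] by (simp add: L_def)
  have Lneg: "- u \<in> L" if "u \<in> L" for u using Leq[OF that] by (simp add: L_def)
  have Lplus: "u + x \<in> L" if "u \<in> L" "x \<in> L" for u x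
    using Ladd[OF that(1), of x] Ladd[OF Lneg[OF that(1)], of "- x"] Leq[OF that(1)] Leq[OF that(2)]
    by (simp add: L_def)
  have scale_minus: "complex_of_real t *\<^sub>C (- u) = - (complex_of_real t *\<^sub>C u)" for t and u :: "nat \<Rightarrow> complex"
    by (rule complex_vector.scale_minus_right)
  have Lscale: "complex_of_real t *\<^sub>C u \<in> L \<and> q (complex_of_real t *\<^sub>C u) = t * q u" if u: "u \<in> L" for u t
  proof -
    have pos: "complex_of_real t *\<^sub>C u \<in> L \<and> q (complex_of_real t *\<^sub>C u) = t * q u" if "0 \<le> t" for t
      using sublinear_scale[OF q(1) that, of u] sublinear_scale[OF q(1) that, of "- u"] Leq[OF u]
      by (simp add: L_def scale_minus)
    show ?thesis
    proof (cases "0 \<le> t")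
      case True then show ?thesis by (rule pos)
    next
      case False
      then have *: "complex_of_real (- t) *\<^sub>C u \<in> L \<and> q (complex_of_real (- t) *\<^sub>C u) = - t * q u"
        by (intro pos) simp
      have "complex_of_real (- t) *\<^sub>C u = - (complex_of_real t *\<^sub>C u)" by simp
      then show ?thesis using * Lneg[of "- (complex_of_real t *\<^sub>C u)"] Leq[of "- (complex_of_real t *\<^sub>C u)"] by simp
    qed
  qed
  have eL: "e i 1 \<in> L" "e i \<i> \<in> L" if "i < m" for i using anti that by (auto simp: L_def)
  \<comment> \<open>The complex coefficients are recovered from the values of the real functional at \<open>e\<^sub>i\<close> and \<open>\<i> e\<^sub>i\<close>.\<close>
  have ecL: "e i c \<in> L \<and> q (e i c) = Re c * q (e i 1) + Im c * q (e i \<i>)" if "i < m" for i c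
  proof -
    have "e i c = complex_of_real (Re c) *\<^sub>C e i 1 + complex_of_real (Im c) *\<^sub>C e i \<i>"
      by (auto simp: e_def fun_eq_iff scaleC_fun_def scaleC_complex_def complex_eq_iff)
    then show ?thesis
      using Lscale[OF eL(1)[OF that]] Lscale[OF eL(2)[OF that]] Lplus Ladd by metis
  qed
  define a where "a i = Complex (q (e i 1)) (- q (e i \<i>))" for i
  have Lsum: "(\<Sum>i<k. e i (v i)) \<in> L \<and> q (\<Sum>i<k. e i (v i)) = Re (\<Sum>i<k. a i * v i)" if "k \<le> m" for k v
    using that
  proof (induction k)
    case 0
    then show ?case using L0 sublinear_0[OF q(1)] by (simp add: zero_fun_def)
  next
    case (Suc k)
    then have IH: "(\<Sum>i<k. e i (v i)) \<in> L" "q (\<Sum>i<k. e i (v i)) = Re (\<Sum>i<k. a i * v i)" by auto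
    have k: "k < m" using Suc by simp
    have "q ((\<Sum>i<k. e i (v i)) + e k (v k)) = Re (\<Sum>i<Suc k. a i * v i)"
      using ecL[OF k, of "v k"] IH(2) unfolding Ladd[OF IH(1)] by (simp add: a_def mult.commute)
    then show ?case unfolding sum.lessThan_Suc[of "\<lambda>i. e i (v i)"]
      using Lplus[OF IH(1)] ecL[OF k, of "v k"] by blast
  qed
  have main: "Re (\<Sum>i<m. a i * v i) \<le> q v" for v
  proof -
    define u where "u = (\<Sum>i<m. e i (v i))"
    have uL: "u \<in> L" "q u = Re (\<Sum>i<m. a i * v i)" using Lsum[of m v] by (auto simp: u_def)
    have "u i = v i" if "i < m" for i
    proof -
      have sum_app: "(\<Sum>j\<in>J. e j (v j)) i = (\<Sum>j\<in>J. e j (v j) i)" if "finite J" for J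
        using that by induction auto
      have "(\<Sum>j<m. e j (v j) i) = (\<Sum>j<m. if j = i then v i else 0)"
        by (rule sum.cong) (auto simp: e_def)
      then show ?thesis unfolding u_def using that sum_app by simp
    qed
    then have "q (u - v) \<le> 0" using bound[of 0 "u - v"] q(2)[of "u - v"] by force
    moreover have "q (v + (u - v)) \<le> q v + q (u - v)" by (rule sublinear_add[OF q(1)])
    ultimately show ?thesis using uL(2) by simp
  qed
  show thesis
  proof (rule that)
    show "Re (\<Sum>i<m. a i * v i) \<le> p v" for v using main[of v] q(2)[of v] by linarith
    define v where "v i = (if a i = 0 then 0 else cnj (a i) / complex_of_real (cmod (a i)))" for i
    have 1: "a i * v i = complex_of_real (cmod (a i))" for i
      by (simp add: v_def complex_norm_square[symmetric] power2_eq_square divide_simps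
          flip: of_real_mult)
    have 2: "cmod (v i) \<le> 1" for i by (simp add: v_def norm_divide)
    have "Re (\<Sum>i<m. a i * v i) \<le> 1"
      using main[of v] q(2)[of v] bound[of 1 v] 2 by (meson order_trans zero_le_one)
    then show "(\<Sum>i<m. cmod (a i)) \<le> 1" by (simp add: 1)
  qed
qed

lemma clinear_onD:
  assumes "clinear_on V f"
  shows "x \<in> V \<Longrightarrow> y \<in> V \<Longrightarrow> f (x + y) = f x + f y" and "x \<in> V \<Longrightarrow> f (c *\<^sub>C x) = c *\<^sub>C f x"
  using assms by (auto simp: clinear_on_def)

lemma clinear_on_0: "clinear_on V f \<Longrightarrow> 0 \<in> V \<Longrightarrow> f 0 = 0"
  using clinear_onD(2)[of V f 0 0] by simp

lemma clinear_on_diff: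
  assumes f: "clinear_on V f" and V: "complex_vector.subspace V" and xy: "x \<in> V" "y \<in> V"
  shows "f (x - y) = f x - f y"
proof -
  have "x - y \<in> V" using V xy by (rule complex_vector.subspace_diff)
  then have "f (x - y + y) = f (x - y) + f y" using f xy by (intro clinear_onD(1)) auto
  then show ?thesis by simp
qed

lemma clinear_on_sum:
  assumes f: "clinear_on V f" and V: "complex_vector.subspace V" and x: "\<And>i. i \<in> I \<Longrightarrow> x i \<in> V"
  shows "f (\<Sum>i\<in>I. c i *\<^sub>C x i) = (\<Sum>i\<in>I. c i *\<^sub>C f (x i))"
  using x
proof (induction I rule: infinite_finite_induct)
  case (insert i I)
  have "(\<Sum>i\<in>I. c i *\<^sub>C x i) \<in> V"
    using insert V by (intro complex_vector.subspace_sum complex_vector.subspace_scale) auto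
  then show ?case using insert V
    by (simp add: clinear_onD[OF f] complex_vector.subspace_scale)
qed (use clinear_on_0[OF f] V in \<open>auto simp: complex_vector.subspace_0\<close>)

lemma linf_norm_ge: "i < d \<Longrightarrow> cmod (v i) \<le> linf_norm d v"
  unfolding linf_norm_def by (intro Max_ge) auto

lemma linf_norm_le: "1 \<le> d \<Longrightarrow> (\<And>i. i < d \<Longrightarrow> cmod (v i) \<le> b) \<Longrightarrow> linf_norm d v \<le> b"
  unfolding linf_norm_def by (subst Max_le_iff) (auto simp: lessThan_empty_iff)

lemma linf_norm_attained:
  assumes "1 \<le> d" obtains i where "i < d" "linf_norm d v = cmod (v i)"
proof -
  have "linf_norm d v \<in> (\<lambda>i. cmod (v i)) ` {..<d}"
    unfolding linf_norm_def using assms by (intro Max_in) (auto simp: lessThan_empty_iff)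
  then show thesis using that by auto
qed

lemma sublinear_linf_norm:
  assumes "1 \<le> d" shows "sublinear (linf_norm d)"
  unfolding sublinear_def
proof (intro conjI allI impI)
  fix u v :: "nat \<Rightarrow> complex"
  show "linf_norm d (u + v) \<le> linf_norm d u + linf_norm d v"
  proof (rule linf_norm_le[OF assms])
    fix i assume "i < d"
    then show "cmod ((u + v) i) \<le> linf_norm d u + linf_norm d v"
      using linf_norm_ge[of i d u] linf_norm_ge[of i d v] norm_triangle_ineq[of "u i" "v i"] by simp
  qed
  fix t :: real assume t: "0 \<le> t"
  show "linf_norm d (complex_of_real t *\<^sub>C u) \<le> t * linf_norm d u"
    using t linf_norm_ge[of _ d u]
    by (intro linf_norm_le[OF assms]) (auto simp: scaleC_fun_def scaleC_complex_def norm_mult intro: mult_left_mono)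
qed

lemma subspace_linf: "complex_vector.subspace (linf d)"
  unfolding complex_vector.subspace_def by (auto simp: linf_def scaleC_fun_def scaleC_complex_def)

text \<open>The hypothesis compares the support functions of two convex sets of functionals on the coefficient
  space: \<open>g\<close> alone on the one hand, and the absolutely convex hull of the coordinates of \<open>\<phi>\<close>, enlarged by a
  supremum-norm ball of radius \<open>\<delta>\<close>, on the other. The conclusion is that \<open>g\<close> lies in the second set.\<close>
lemma functional_near_absolutely_convex_hull:
  fixes \<phi> :: "'x::complex_vector \<Rightarrow> nat \<Rightarrow> complex" and g :: "'x \<Rightarrow> complex"
  assumes \<Omega>: "finite \<Omega>" and m: "1 \<le> m" and \<delta>: "0 \<le> \<delta>"
    and \<phi>: "clinear_on UNIV \<phi>" and g: "clinear_on UNIV g"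
    and dom: "\<And>c. cmod (g (\<Sum>x\<in>\<Omega>. c x *\<^sub>C x)) \<le> linf_norm m (\<phi> (\<Sum>x\<in>\<Omega>. c x *\<^sub>C x)) + \<delta> * (\<Sum>x\<in>\<Omega>. cmod (c x))"
  obtains a where "(\<Sum>i<m. cmod (a i)) \<le> 1" "\<And>x. x \<in> \<Omega> \<Longrightarrow> cmod ((\<Sum>i<m. a i * \<phi> x i) - g x) \<le> \<delta>"
proof -
  define z where "z c = (\<Sum>x\<in>\<Omega>. c x *\<^sub>C x)" for c :: "'x \<Rightarrow> complex"
  define l1 where "l1 c = (\<Sum>x\<in>\<Omega>. cmod (c x))" for c :: "'x \<Rightarrow> complex"
  have zadd: "z (\<lambda>x. c x + c' x) = z c + z c'" for c c'
    by (simp add: z_def scaleC_add_left sum.distrib)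
  have zscale: "z (\<lambda>x. t * c x) = t *\<^sub>C z c" for c t
    by (simp add: z_def complex_vector.scale_sum_right scaleC_scaleC)
  have l1scale: "l1 (\<lambda>x. t * c x) = cmod t * l1 c" for c t
    by (simp add: l1_def sum_distrib_left norm_mult)
  have l1add: "l1 (\<lambda>x. c x + c' x) \<le> l1 c + l1 c'" for c c'
    by (simp add: l1_def sum.distrib[symmetric] sum_mono norm_triangle_ineq)
  have neg: "f (- x) = - f x" if "clinear_on UNIV f" for f :: "'x \<Rightarrow> 'w::complex_vector" and x
    using clinear_onD(2)[OF that, of x "-1"] by (simp add: complex_vector.scale_minus_left scaleC_one)
  \<comment> \<open>A minorant compatible with this cone is, on the range of \<open>\<phi> \<circ> z\<close>, at most \<open>Re g + \<delta> l1\<close>.\<close>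
  define S where "S = {(- \<phi> (z c), r) | c r. \<delta> * l1 c + Re (g (z c)) \<le> r}"
  note sub = sublinear_linf_norm[OF m]
  obtain p where p: "sublinear p" "\<And>v. p v \<le> linf_norm m v" "\<And>w r. (w, r) \<in> S \<Longrightarrow> p (- w) \<le> r"
  proof (rule sublinear_inf_cone[OF sub, of S])
    have "z (\<lambda>_. 0) = 0" "l1 (\<lambda>_. 0) = 0" by (auto simp: z_def l1_def)
    then show "(0, 0) \<in> S" unfolding S_def
      by (intro CollectI exI[of _ "\<lambda>_. 0"] exI[of _ 0]) (simp add: clinear_on_0[OF \<phi>] clinear_on_0[OF g])
    show "(w + w', r + r') \<in> S" if "(w, r) \<in> S" "(w', r') \<in> S" for w r w' r'
    proof -
      from that obtain c c' where c: "w = - \<phi> (z c)" "\<delta> * l1 c + Re (g (z c)) \<le> r"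
        "w' = - \<phi> (z c')" "\<delta> * l1 c' + Re (g (z c')) \<le> r'" unfolding S_def by blast
      have "\<delta> * l1 (\<lambda>x. c x + c' x) \<le> \<delta> * (l1 c + l1 c')"
        using \<delta> l1add by (rule mult_left_mono[rotated])
      then show ?thesis unfolding S_def using c
        by (intro CollectI exI[of _ "\<lambda>x. c x + c' x"] exI[of _ "r + r'"])
          (simp add: zadd clinear_onD[OF \<phi>] clinear_onD[OF g] distrib_left)
    qed
    show "(complex_of_real t *\<^sub>C w, t * r) \<in> S" if "(w, r) \<in> S" "0 \<le> t" for t w r
    proof -
      from that obtain c where c: "w = - \<phi> (z c)" "\<delta> * l1 c + Re (g (z c)) \<le> r" unfolding S_def by blast
      then have "t * (\<delta> * l1 c + Re (g (z c))) \<le> t * r" using that by (intro mult_left_mono)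
      then show ?thesis unfolding S_def using c that
        by (intro CollectI exI[of _ "\<lambda>x. complex_of_real t * c x"] exI[of _ "t * r"])
          (simp add: zscale l1scale clinear_onD[OF \<phi>] clinear_onD[OF g] scaleC_complex_def algebra_simps)
    qed
    show "0 \<le> linf_norm m w + r" if "(w, r) \<in> S" for w r
    proof -
      from that obtain c where c: "w = - \<phi> (z c)" "\<delta> * l1 c + Re (g (z c)) \<le> r" unfolding S_def by blast
      have "linf_norm m w = linf_norm m (\<phi> (z c))" by (simp add: c linf_norm_def)
      then show ?thesis using dom[of c] c(2) abs_Re_le_cmod[of "g (z c)"] by (simp add: z_def l1_def)
    qed
  qed (rule that)
  obtain a where a: "(\<Sum>i<m. cmod (a i)) \<le> 1" "\<And>v. Re (\<Sum>i<m. a i * v i) \<le> p v"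
  proof (rule sublinear_minorant_l1[OF p(1), of m])
    show "p v \<le> b" if "0 \<le> b" "\<And>i. i < m \<Longrightarrow> cmod (v i) \<le> b" for v b
      using that(2) by (intro order_trans[OF p(2)] linf_norm_le[OF m])
  qed (rule that)
  show thesis
  proof (rule that)
    show "(\<Sum>i<m. cmod (a i)) \<le> 1" by (rule a)
    fix x assume x: "x \<in> \<Omega>"
    define h where "h = (\<Sum>i<m. a i * \<phi> x i) - g x"
    \<comment> \<open>Evaluate the constraint at the coefficient vector that is \<open>t\<close> at \<open>x\<close> and 0 elsewhere.\<close>
    have *: "Re (t * h) \<le> \<delta> * cmod t" for t
    proof -
      define c where "c y = (if y = x then t else 0)" for y
      have "z c = (\<Sum>y\<in>\<Omega>. if y = x then t *\<^sub>C x else 0)" unfolding z_def c_def by (rule sum.cong) auto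
      then have zc: "z c = t *\<^sub>C x" using \<Omega> x by simp
      have "l1 c = (\<Sum>y\<in>\<Omega>. if y = x then cmod t else 0)" unfolding l1_def c_def by (rule sum.cong) auto
      then have lc: "l1 c = cmod t" using \<Omega> x by simp
      have "(- \<phi> (z c), \<delta> * l1 c + Re (g (z c))) \<in> S" unfolding S_def by blast
      then have "Re (\<Sum>i<m. a i * \<phi> (z c) i) \<le> \<delta> * l1 c + Re (g (z c))"
        using p(3) a(2)[of "\<phi> (z c)"] by fastforce
      moreover have "(\<Sum>i<m. a i * \<phi> (z c) i) = t * (\<Sum>i<m. a i * \<phi> x i)"
        by (simp add: zc clinear_onD[OF \<phi>] scaleC_fun_def scaleC_complex_def sum_distrib_left mult.left_commute)
      moreover have "g (z c) = t * g x" by (simp add: zc clinear_onD[OF g] scaleC_complex_def)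
      ultimately show ?thesis by (simp add: lc h_def right_diff_distrib)
    qed
    have "cmod h * cmod h \<le> \<delta> * cmod h"
      using *[of "cnj h"] by (simp add: mult.commute complex_norm_square[symmetric] power2_eq_square flip: of_real_mult)
    then have "h \<noteq> 0 \<Longrightarrow> cmod h \<le> \<delta>" by simp
    then show "cmod ((\<Sum>i<m. a i * \<phi> x i) - g x) \<le> \<delta>" using \<delta> by (cases "h = 0") (auto simp: h_def)
  qed
qed

section \<open>Norm nets bound the CA rank\<close>

lemma rc_le:
  assumes "(\<phi>, \<psi>, d) \<in> CA \<iota> \<Omega> \<delta>" shows "rc \<iota> \<Omega> \<delta> \<le> d"
  unfolding rc_def using assms by (intro cInf_lower) auto

text \<open>The norming functionals are taken among the coordinates of a CA approximation \<open>\<phi>'\<close> that is also accurate on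
  the net, so that only the finite-dimensional Hahn--Banach theorem is needed. Each of the \<open>M\<close> coordinates of \<open>\<phi>'\<close>
  is close on \<open>\<Omega>\<close> to an absolutely convex combination of the \<open>card Z\<close> selected ones; these combinations form a
  contraction \<open>\<theta>\<close> from \<open>\<ell>\<^sub>\<infinity>\<close> of dimension \<open>card Z\<close> to \<open>\<ell>\<^sub>\<infinity>\<close> of dimension \<open>M\<close>, and \<open>\<psi>' \<circ> \<theta>\<close> is the new second map.\<close>
lemma rc_le_card_net:
  fixes \<iota> :: "'x::complex_banach \<Rightarrow> 'y::complex_banach"
  assumes \<iota>: "CA_embedding \<iota>" and \<Omega>: "finite \<Omega>" and Z: "finite Z" "Z \<noteq> {}" and \<delta>: "0 < \<delta>"
    and net: "\<And>c. (\<Sum>x\<in>\<Omega>. cmod (c x)) \<le> 1 \<Longrightarrow> \<exists>z\<in>Z. norm ((\<Sum>x\<in>\<Omega>. c x *\<^sub>C x) - z) \<le> \<delta>"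
  shows "rc \<iota> \<Omega> (3 * \<delta>) \<le> card Z"
proof -
  have \<iota>lin: "clinear_on UNIV \<iota>" and \<iota>iso: "\<And>x. norm (\<iota> x) = norm x"
    and "CA \<iota> (\<Omega> \<union> Z) (\<delta> / 4) \<noteq> {}"
    using \<iota> \<Omega> Z(1) \<delta> unfolding CA_embedding_def by auto
  then obtain \<phi>' \<psi>' M where CA: "(\<phi>', \<psi>', M) \<in> CA \<iota> (\<Omega> \<union> Z) (\<delta> / 4)"
    by (auto simp: ex_in_conv[symmetric])
  then have M: "1 \<le> M" and \<phi>'V: "\<And>x. \<phi>' x \<in> linf M" and \<phi>'lin: "clinear_on UNIV \<phi>'"
    and \<phi>'c: "\<And>x. linf_norm M (\<phi>' x) \<le> norm x"
    and \<psi>'lin: "clinear_on (linf M) \<psi>'" and \<psi>'c: "\<And>v. v \<in> linf M \<Longrightarrow> norm (\<psi>' v) \<le> linf_norm M v"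
    and app: "\<And>x. x \<in> \<Omega> \<union> Z \<Longrightarrow> norm (\<psi>' (\<phi>' x) - \<iota> x) < \<delta> / 4"
    unfolding CA_def contractive_linear_on_def by (auto simp: Pi_def)
  define m where "m = card Z"
  have m: "1 \<le> m" using Z by (simp add: m_def Suc_le_eq card_gt_0_iff)
  obtain h where h: "bij_betw h {..<m} Z"
    using ex_bij_betw_nat_finite[OF Z(1)] by (auto simp: m_def lessThan_atLeast0)
  have "\<exists>j<M. linf_norm M (\<phi>' z) = cmod (\<phi>' z j)" for z
    using linf_norm_attained[OF M] by metis
  then obtain J where J: "\<And>z. J z < M" "\<And>z. linf_norm M (\<phi>' z) = cmod (\<phi>' z (J z))" by metis
  define \<phi> where "\<phi> x = (\<lambda>i. if i < m then \<phi>' x (J (h i)) else 0)" for x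
  have \<phi>'add: "\<phi>' (x + y) = \<phi>' x + \<phi>' y" and \<phi>'sc: "\<phi>' (c *\<^sub>C x) = c *\<^sub>C \<phi>' x" for x y c
    using clinear_onD[OF \<phi>'lin] by auto
  have \<phi>lin: "clinear_on UNIV \<phi>"
    unfolding clinear_on_def by (auto simp: \<phi>_def \<phi>'add \<phi>'sc scaleC_fun_def fun_eq_iff scaleC_complex_def)
  have coord_le: "cmod (\<phi>' x j) \<le> norm x" if "j < M" for x j
    using linf_norm_ge[OF that, of "\<phi>' x"] \<phi>'c[of x] by simp
  have \<phi>c: "linf_norm m (\<phi> x) \<le> norm x" for x
    using J(1) coord_le by (intro linf_norm_le[OF m]) (auto simp: \<phi>_def)
  have \<phi>V: "\<phi> x \<in> linf m" for x by (auto simp: linf_def \<phi>_def)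
  have norming: "norm z \<le> linf_norm m (\<phi> z) + \<delta> / 4" if "z \<in> Z" for z
  proof -
    have "z \<in> h ` {..<m}" using h that by (simp add: bij_betw_def)
    then obtain i where i: "i < m" "h i = z" by blast
    have "norm z = norm (\<iota> z)" by (simp add: \<iota>iso)
    also have "\<dots> \<le> norm (\<psi>' (\<phi>' z)) + norm (\<psi>' (\<phi>' z) - \<iota> z)"
      using norm_triangle_sub[of "\<iota> z" "\<psi>' (\<phi>' z)"] by (simp add: norm_minus_commute)
    also have "norm (\<psi>' (\<phi>' z)) \<le> cmod (\<phi>' z (J z))" using \<psi>'c[OF \<phi>'V[of z]] J(2) by simp
    also have "cmod (\<phi>' z (J z)) = cmod (\<phi> z i)" using i by (simp add: \<phi>_def)
    also have "\<dots> \<le> linf_norm m (\<phi> z)" by (rule linf_norm_ge[OF i(1)])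
    finally show ?thesis using app[of z] that by simp
  qed
  \<comment> \<open>Passing to the net and back costs \<open>2 \<delta>\<close>, and the functionals norm the net up to \<open>\<delta> / 4\<close>.\<close>
  define \<eta> where "\<eta> = 9 / 4 * \<delta>"
  have unit: "norm (\<Sum>x\<in>\<Omega>. c x *\<^sub>C x) \<le> linf_norm m (\<phi> (\<Sum>x\<in>\<Omega>. c x *\<^sub>C x)) + \<eta>"
    if c: "(\<Sum>x\<in>\<Omega>. cmod (c x)) \<le> 1" for c
  proof -
    define w where "w = (\<Sum>x\<in>\<Omega>. c x *\<^sub>C x)"
    obtain z where z: "z \<in> Z" "norm (w - z) \<le> \<delta>" using net[OF c] by (auto simp: w_def)
    have "norm w \<le> norm z + norm (w - z)" using norm_triangle_sub[of w z] by simp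
    also have "norm z \<le> linf_norm m (\<phi> z) + \<delta> / 4" by (rule norming[OF z(1)])
    also have "linf_norm m (\<phi> z) \<le> linf_norm m (\<phi> w) + linf_norm m (\<phi> (z - w))"
      using sublinear_add[OF sublinear_linf_norm[OF m], of "\<phi> w" "\<phi> (z - w)"]
        clinear_onD(1)[OF \<phi>lin, of w "z - w"] by simp
    also have "linf_norm m (\<phi> (z - w)) \<le> \<delta>" using \<phi>c[of "z - w"] z(2) by (simp add: norm_minus_commute)
    finally show ?thesis unfolding w_def[symmetric] \<eta>_def using z(2) by simp
  qed
  have dom: "norm (\<Sum>x\<in>\<Omega>. c x *\<^sub>C x) \<le> linf_norm m (\<phi> (\<Sum>x\<in>\<Omega>. c x *\<^sub>C x)) + \<eta> * (\<Sum>x\<in>\<Omega>. cmod (c x))" for c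
  proof -
    define s where "s = (\<Sum>x\<in>\<Omega>. cmod (c x))"
    define w where "w = (\<Sum>x\<in>\<Omega>. c x *\<^sub>C x)"
    have s0: "0 \<le> s" by (simp add: s_def sum_nonneg)
    show ?thesis
    proof (cases "s = 0")
      case True
      then have "\<And>x. x \<in> \<Omega> \<Longrightarrow> c x = 0" using \<Omega> by (simp add: s_def sum_nonneg_eq_0_iff)
      then have "w = 0" by (simp add: w_def)
      moreover have "linf_norm m (\<phi> 0) = 0"
        using clinear_on_0[OF \<phi>lin] sublinear_0[OF sublinear_linf_norm[OF m]] by simp
      ultimately show ?thesis using True by (simp flip: s_def w_def)
    next
      case False
      then have s: "0 < s" using s0 by simp
      define c' where "c' x = complex_of_real (1 / s) * c x" for x
      have w': "(\<Sum>x\<in>\<Omega>. c' x *\<^sub>C x) = complex_of_real (1 / s) *\<^sub>C w"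
        by (simp add: w_def c'_def complex_vector.scale_sum_right scaleC_scaleC)
      have "(\<Sum>x\<in>\<Omega>. cmod (c' x)) = (1 / s) * (\<Sum>x\<in>\<Omega>. cmod (c x))"
        unfolding sum_distrib_left using s by (intro sum.cong) (simp_all add: c'_def norm_mult norm_divide)
      then have "(\<Sum>x\<in>\<Omega>. cmod (c' x)) = 1" using s by (simp flip: s_def)
      then have "norm (complex_of_real (1 / s) *\<^sub>C w) \<le> linf_norm m (\<phi> (complex_of_real (1 / s) *\<^sub>C w)) + \<eta>"
        using unit[of c'] w' s by simp
      moreover have "linf_norm m (\<phi> (complex_of_real (1 / s) *\<^sub>C w)) = (1 / s) * linf_norm m (\<phi> w)"
        unfolding clinear_onD(2)[OF \<phi>lin UNIV_I] using s
        by (intro sublinear_scale[OF sublinear_linf_norm[OF m]]) simp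
      moreover have "norm (complex_of_real (1 / s) *\<^sub>C w) = (1 / s) * norm w"
        using s by (simp add: norm_scaleC norm_divide)
      ultimately have "(1 / s) * norm w \<le> (1 / s) * linf_norm m (\<phi> w) + \<eta>" by simp
      then show ?thesis using s unfolding w_def[symmetric] s_def[symmetric] by (simp add: field_simps)
    qed
  qed
  have "\<exists>a. (\<Sum>i<m. cmod (a i)) \<le> 1 \<and> (\<forall>x\<in>\<Omega>. cmod ((\<Sum>i<m. a i * \<phi> x i) - \<phi>' x j) \<le> \<eta>)" if j: "j < M" for j
  proof -
    have g: "clinear_on UNIV (\<lambda>x. \<phi>' x j)"
      unfolding clinear_on_def by (auto simp: \<phi>'add \<phi>'sc scaleC_fun_def)
    have g_le: "cmod (\<phi>' (\<Sum>x\<in>\<Omega>. c x *\<^sub>C x) j) \<le> linf_norm m (\<phi> (\<Sum>x\<in>\<Omega>. c x *\<^sub>C x)) + \<eta> * (\<Sum>x\<in>\<Omega>. cmod (c x))" for c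
      using coord_le[OF j] dom by (rule order_trans)
    have "0 \<le> \<eta>" using \<delta> by (simp add: \<eta>_def)
    then obtain a where "(\<Sum>i<m. cmod (a i)) \<le> 1"
      "\<And>x. x \<in> \<Omega> \<Longrightarrow> cmod ((\<Sum>i<m. a i * \<phi> x i) - \<phi>' x j) \<le> \<eta>"
      by (rule functional_near_absolutely_convex_hull[OF \<Omega> m _ \<phi>lin g g_le]) (rule that)
    then show ?thesis by blast
  qed
  then obtain a where a: "\<And>j. j < M \<Longrightarrow> (\<Sum>i<m. cmod (a j i)) \<le> 1"
    "\<And>j x. j < M \<Longrightarrow> x \<in> \<Omega> \<Longrightarrow> cmod ((\<Sum>i<m. a j i * \<phi> x i) - \<phi>' x j) \<le> \<eta>" by metis
  define \<theta> where "\<theta> v = (\<lambda>j. if j < M then \<Sum>i<m. a j i * v i else 0)" for v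
  have \<theta>V: "\<theta> v \<in> linf M" for v by (auto simp: linf_def \<theta>_def)
  have \<theta>add: "\<theta> (u + v) = \<theta> u + \<theta> v" and \<theta>sc: "\<theta> (c *\<^sub>C v) = c *\<^sub>C \<theta> v" for u v c
    by (auto simp: \<theta>_def fun_eq_iff scaleC_fun_def scaleC_complex_def distrib_left sum.distrib
        sum_distrib_left mult.left_commute)
  have \<theta>c: "linf_norm M (\<theta> v) \<le> linf_norm m v" for v
  proof (rule linf_norm_le[OF M])
    fix j assume j: "j < M"
    have n0: "0 \<le> linf_norm m v" using linf_norm_ge[of 0 m v] m by (simp add: order_trans[OF norm_ge_zero])
    have "cmod (\<theta> v j) \<le> (\<Sum>i<m. cmod (a j i) * linf_norm m v)"
      using j by (auto simp: \<theta>_def norm_mult intro!: sum_norm_le mult_left_mono linf_norm_ge)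
    also have "\<dots> = (\<Sum>i<m. cmod (a j i)) * linf_norm m v" by (simp add: sum_distrib_right)
    also have "\<dots> \<le> linf_norm m v" using mult_right_mono[OF a(1)[OF j] n0] by simp
    finally show "cmod (\<theta> v j) \<le> linf_norm m v" .
  qed
  have "(\<phi>, \<lambda>v. \<psi>' (\<theta> v), m) \<in> CA \<iota> \<Omega> (3 * \<delta>)"
  proof -
    have "contractive_linear_on UNIV norm (linf m) (linf_norm m) \<phi>"
      using \<phi>lin \<phi>c \<phi>V by (auto simp: contractive_linear_on_def)
    moreover have "contractive_linear_on (linf m) (linf_norm m) UNIV norm (\<lambda>v. \<psi>' (\<theta> v))"
      using clinear_onD[OF \<psi>'lin] \<theta>V order_trans[OF \<psi>'c[OF \<theta>V] \<theta>c]
      by (auto simp: contractive_linear_on_def clinear_on_def \<theta>add \<theta>sc)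
    moreover have "norm (\<psi>' (\<theta> (\<phi> x)) - \<iota> x) < 3 * \<delta>" if x: "x \<in> \<Omega>" for x
    proof -
      have "norm (\<psi>' (\<theta> (\<phi> x)) - \<psi>' (\<phi>' x)) = norm (\<psi>' (\<theta> (\<phi> x) - \<phi>' x))"
        using clinear_on_diff[OF \<psi>'lin subspace_linf \<theta>V \<phi>'V] by simp
      also have "\<dots> \<le> linf_norm M (\<theta> (\<phi> x) - \<phi>' x)"
        by (intro \<psi>'c complex_vector.subspace_diff subspace_linf \<theta>V \<phi>'V)
      also have "\<dots> \<le> \<eta>" using a(2)[OF _ x] by (intro linf_norm_le[OF M]) (simp add: \<theta>_def)
      finally have "norm (\<psi>' (\<theta> (\<phi> x)) - \<psi>' (\<phi>' x)) \<le> \<eta>" .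
      moreover have "norm (\<psi>' (\<theta> (\<phi> x)) - \<iota> x) \<le> norm (\<psi>' (\<theta> (\<phi> x)) - \<psi>' (\<phi>' x)) + norm (\<psi>' (\<phi>' x) - \<iota> x)"
        using norm_triangle_ineq[of "\<psi>' (\<theta> (\<phi> x)) - \<psi>' (\<phi>' x)" "\<psi>' (\<phi>' x) - \<iota> x"] by simp
      ultimately show ?thesis using app[of x] x \<delta> by (simp add: \<eta>_def)
    qed
    ultimately show ?thesis using m by (simp add: CA_def)
  qed
  then show ?thesis unfolding m_def[symmetric] by (rule rc_le)
qed

section \<open>Minimal projections in finite-dimensional C*-algebras\<close>

locale fd_cstar =
  fixes B :: star_algebra
  assumes fd_cstar: "fd_cstar_algebra B"
begin

abbreviation V :: "(nat \<Rightarrow> complex) set" where "V \<equiv> B_carrier B"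
abbreviation times :: "(nat \<Rightarrow> complex) \<Rightarrow> (nat \<Rightarrow> complex) \<Rightarrow> nat \<Rightarrow> complex" (infixl "\<odot>" 70)
  where "x \<odot> y \<equiv> B_mul B x y"
abbreviation adj :: "(nat \<Rightarrow> complex) \<Rightarrow> nat \<Rightarrow> complex" where "adj x \<equiv> B_star B x"
definition nrm :: "(nat \<Rightarrow> complex) \<Rightarrow> real" where "nrm x = B_mnorm B 1 (mat1 x)"
abbreviation abelian :: "(nat \<Rightarrow> complex) set \<Rightarrow> bool" where "abelian A \<equiv> abelian_star_subalgebra B A"

lemma cstar: "cstar_algebra V (B_mul B) (B_star B) nrm"
  using fd_cstar by (simp add: fd_cstar_algebra_def nrm_def[abs_def])

lemma
  shows subspace_V: "complex_vector.subspace V"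
    and mul_in: "x \<in> V \<Longrightarrow> y \<in> V \<Longrightarrow> x \<odot> y \<in> V"
    and clinear_mul_left: "x \<in> V \<Longrightarrow> clinear_on V ((\<odot>) x)"
    and clinear_mul_right: "y \<in> V \<Longrightarrow> clinear_on V (\<lambda>x. x \<odot> y)"
    and mul_assoc: "x \<in> V \<Longrightarrow> y \<in> V \<Longrightarrow> z \<in> V \<Longrightarrow> x \<odot> y \<odot> z = x \<odot> (y \<odot> z)"
    and adj_in: "x \<in> V \<Longrightarrow> adj x \<in> V"
    and adj_add: "x \<in> V \<Longrightarrow> y \<in> V \<Longrightarrow> adj (x + y) = adj x + adj y"
    and adj_scale: "x \<in> V \<Longrightarrow> adj (c *\<^sub>C x) = cnj c *\<^sub>C adj x"
    and adj_adj: "x \<in> V \<Longrightarrow> adj (adj x) = x"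
    and adj_mul: "x \<in> V \<Longrightarrow> y \<in> V \<Longrightarrow> adj (x \<odot> y) = adj y \<odot> adj x"
    and nrm_add: "x \<in> V \<Longrightarrow> y \<in> V \<Longrightarrow> nrm (x + y) \<le> nrm x + nrm y"
    and nrm_scale: "x \<in> V \<Longrightarrow> nrm (c *\<^sub>C x) = cmod c * nrm x"
    and nrm_eq_0: "x \<in> V \<Longrightarrow> nrm x = 0 \<Longrightarrow> x = 0"
    and nrm_mul: "x \<in> V \<Longrightarrow> y \<in> V \<Longrightarrow> nrm (x \<odot> y) \<le> nrm x * nrm y"
    and nrm_adj_mul: "x \<in> V \<Longrightarrow> nrm (adj x \<odot> x) = (nrm x)\<^sup>2"
  using cstar unfolding cstar_algebra_def by (elim conjE, simp)+

lemma
  shows V_0: "0 \<in> V" and V_add: "x \<in> V \<Longrightarrow> y \<in> V \<Longrightarrow> x + y \<in> V"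
    and V_scale: "x \<in> V \<Longrightarrow> c *\<^sub>C x \<in> V" and V_diff: "x \<in> V \<Longrightarrow> y \<in> V \<Longrightarrow> x - y \<in> V"
    and V_sum: "(\<And>i. i \<in> I \<Longrightarrow> g i \<in> V) \<Longrightarrow> sum g I \<in> V"
  using subspace_V
  by (auto simp: complex_vector.subspace_0 complex_vector.subspace_add complex_vector.subspace_scale
      complex_vector.subspace_diff complex_vector.subspace_sum)

lemma
  shows mul_add_right: "x \<in> V \<Longrightarrow> y \<in> V \<Longrightarrow> z \<in> V \<Longrightarrow> x \<odot> (y + z) = x \<odot> y + x \<odot> z"
    and mul_add_left: "x \<in> V \<Longrightarrow> y \<in> V \<Longrightarrow> z \<in> V \<Longrightarrow> (x + y) \<odot> z = x \<odot> z + y \<odot> z"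
    and mul_diff_right: "x \<in> V \<Longrightarrow> y \<in> V \<Longrightarrow> z \<in> V \<Longrightarrow> x \<odot> (y - z) = x \<odot> y - x \<odot> z"
    and mul_diff_left: "x \<in> V \<Longrightarrow> y \<in> V \<Longrightarrow> z \<in> V \<Longrightarrow> (x - y) \<odot> z = x \<odot> z - y \<odot> z"
    and mul_scale_right: "x \<in> V \<Longrightarrow> y \<in> V \<Longrightarrow> x \<odot> (c *\<^sub>C y) = c *\<^sub>C (x \<odot> y)"
    and mul_scale_left: "x \<in> V \<Longrightarrow> y \<in> V \<Longrightarrow> (c *\<^sub>C x) \<odot> y = c *\<^sub>C (x \<odot> y)"
    and mul_0_right: "x \<in> V \<Longrightarrow> x \<odot> 0 = 0"
    and mul_0_left: "y \<in> V \<Longrightarrow> 0 \<odot> y = 0"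
  using clinear_onD[OF clinear_mul_left] clinear_onD[OF clinear_mul_right]
    clinear_on_diff[OF clinear_mul_left subspace_V] clinear_on_diff[OF clinear_mul_right subspace_V]
    clinear_on_0[OF clinear_mul_left V_0] clinear_on_0[OF clinear_mul_right V_0] by simp_all

lemma mul_sum_right: "x \<in> V \<Longrightarrow> (\<And>i. i \<in> I \<Longrightarrow> y i \<in> V) \<Longrightarrow> x \<odot> (\<Sum>i\<in>I. c i *\<^sub>C y i) = (\<Sum>i\<in>I. c i *\<^sub>C (x \<odot> y i))"
  by (rule clinear_on_sum[OF clinear_mul_left subspace_V])

lemma mul_sum_left: "x \<in> V \<Longrightarrow> (\<And>i. i \<in> I \<Longrightarrow> y i \<in> V) \<Longrightarrow> (\<Sum>i\<in>I. c i *\<^sub>C y i) \<odot> x = (\<Sum>i\<in>I. c i *\<^sub>C (y i \<odot> x))"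
  by (rule clinear_on_sum[OF clinear_mul_right subspace_V])

lemma mul_sum_right': "x \<in> V \<Longrightarrow> (\<And>i. i \<in> I \<Longrightarrow> y i \<in> V) \<Longrightarrow> x \<odot> (\<Sum>i\<in>I. y i) = (\<Sum>i\<in>I. x \<odot> y i)"
  using mul_sum_right[of x I y "\<lambda>_. 1"] by (simp add: scaleC_one)

lemma mul_sum_left': "x \<in> V \<Longrightarrow> (\<And>i. i \<in> I \<Longrightarrow> y i \<in> V) \<Longrightarrow> (\<Sum>i\<in>I. y i) \<odot> x = (\<Sum>i\<in>I. y i \<odot> x)"
  using mul_sum_left[of x I y "\<lambda>_. 1"] by (simp add: scaleC_one)

lemma adj_0: "adj 0 = 0"
  using adj_scale[OF V_0, of 0] by simp

lemma adj_diff: "x \<in> V \<Longrightarrow> y \<in> V \<Longrightarrow> adj (x - y) = adj x - adj y"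
  using adj_add[of "x - y" y] V_diff by fastforce

lemma adj_sum: "(\<And>i. i \<in> I \<Longrightarrow> g i \<in> V) \<Longrightarrow> adj (sum g I) = (\<Sum>i\<in>I. adj (g i))"
  by (induction I rule: infinite_finite_induct) (auto simp: adj_0 adj_add V_sum)

lemma nrm_0: "nrm 0 = 0"
  using nrm_scale[OF V_0, of 0] by simp

lemma nrm_minus: "x \<in> V \<Longrightarrow> nrm (- x) = nrm x"
  using nrm_scale[of x "-1"] by (simp add: complex_vector.scale_minus_left scaleC_one)

lemma nrm_nonneg: "x \<in> V \<Longrightarrow> 0 \<le> nrm x"
  using nrm_add[of x "- x"] nrm_minus[of x] nrm_0 complex_vector.subspace_neg[OF subspace_V, of x] by simp

lemma nrm_sum: "(\<And>i. i \<in> I \<Longrightarrow> g i \<in> V) \<Longrightarrow> nrm (sum g I) \<le> (\<Sum>i\<in>I. nrm (g i))"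
proof (induction I rule: infinite_finite_induct)
  case (insert i I)
  then have "nrm (g i + sum g I) \<le> nrm (g i) + nrm (sum g I)" by (intro nrm_add V_sum) auto
  moreover have "nrm (sum g I) \<le> (\<Sum>i\<in>I. nrm (g i))" using insert by blast
  ultimately show ?case unfolding sum.insert[OF insert.hyps] by linarith
qed (auto simp: nrm_0)

lemma nrm_adj_le: "x \<in> V \<Longrightarrow> nrm x \<le> nrm (adj x)"
proof -
  assume x: "x \<in> V"
  have "nrm x * nrm x \<le> nrm (adj x) * nrm x"
    using nrm_adj_mul[OF x] nrm_mul[OF adj_in[OF x] x] by (simp add: power2_eq_square)
  then show ?thesis using nrm_nonneg[OF x] nrm_nonneg[OF adj_in[OF x]]
    by (cases "nrm x = 0") (auto simp: mult_le_cancel_right)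
qed

lemma nrm_adj: "x \<in> V \<Longrightarrow> nrm (adj x) = nrm x"
  using nrm_adj_le[of x] nrm_adj_le[of "adj x"] adj_in adj_adj by fastforce

lemma adj_mul_self_eq_0: "x \<in> V \<Longrightarrow> adj x \<odot> x = 0 \<Longrightarrow> x = 0"
  using nrm_adj_mul[of x] nrm_0 nrm_eq_0 by simp

lemma independent_bounded: "\<exists>n. \<forall>X. X \<subseteq> V \<longrightarrow> complex_vector.independent X \<longrightarrow> finite X \<and> card X \<le> n"
proof -
  obtain S where S: "finite S" "V = complex_vector.span S"
    using fd_cstar by (auto simp: fd_cstar_algebra_def)
  then show ?thesis using complex_vector.independent_span_bound by (intro exI[of _ "card S"]) blast
qed

text \<open>Inside a finite-dimensional \<open>V\<close>, although the ambient space of all sequences has infinite dimension.\<close>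
lemma dim_less:
  assumes "complex_vector.subspace U" "complex_vector.subspace W" "U \<subset> W" "W \<subseteq> V"
  shows "complex_vector.dim U < complex_vector.dim W"
proof -
  obtain X where X: "X \<subseteq> U" "complex_vector.independent X" "U \<subseteq> complex_vector.span X"
    "card X = complex_vector.dim U" using complex_vector.basis_exists by blast
  obtain w where w: "w \<in> W" "w \<notin> U" using assms by blast
  have "complex_vector.span X \<subseteq> U" using X assms by (intro complex_vector.span_minimal)
  then have ind: "complex_vector.independent (insert w X)" using w X by (intro complex_vector.independent_insertI) auto
  obtain n where "\<And>X. X \<subseteq> V \<Longrightarrow> complex_vector.independent X \<Longrightarrow> finite X \<and> card X \<le> n"
    using independent_bounded by blast
  then have fin: "finite X'" if "complex_vector.independent X'" "X' \<subseteq> W" for X' using that assms by blast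
  obtain Y where Y: "Y \<subseteq> W" "complex_vector.independent Y" "W \<subseteq> complex_vector.span Y"
    "card Y = complex_vector.dim W" using complex_vector.basis_exists by blast
  have "card (insert w X) \<le> card Y"
    using complex_vector.independent_span_bound[OF fin[OF Y(2,1)] ind] w X Y assms by blast
  moreover have "card (insert w X) = Suc (card X)"
    using fin[OF X(2)] w X assms by (subst card_insert_disjoint) auto
  ultimately show ?thesis using X Y by simp
qed

text \<open>The usual argument with an annihilating polynomial: the first linear dependence among the iterates
  \<open>h\<^sup>i v\<^sub>0\<close> gives a polynomial \<open>p\<close> of minimal degree; with a root \<open>\<mu>\<close> split off, the remaining
  factor \<open>r\<close> does not annihilate \<open>v\<^sub>0\<close>, and \<open>r(h) v\<^sub>0\<close> is an eigenvector.\<close>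
lemma eigenvector_exists:
  assumes h: "h \<in> V" and F: "complex_vector.subspace F" "F \<subseteq> V" "\<And>v. v \<in> F \<Longrightarrow> h \<odot> v \<in> F"
    and v0: "v0 \<in> F" "v0 \<noteq> 0"
  obtains \<mu> v where "v \<in> F" "v \<noteq> 0" "h \<odot> v = \<mu> *\<^sub>C v"
proof -
  define u where "u i = (((\<odot>) h) ^^ i) v0" for i
  have u0: "u 0 = v0" and uSuc: "u (Suc i) = h \<odot> u i" for i by (auto simp: u_def)
  have uF: "u i \<in> F" for i by (induction i) (auto simp: u0 uSuc v0 F)
  define Q where "Q n \<longleftrightarrow> (\<exists>c. u n = (\<Sum>i<n. c i *\<^sub>C u i))" for n
  have span_form: "\<exists>c. x = (\<Sum>i<n. c i *\<^sub>C u i)" if "x \<in> complex_vector.span (u ` {..<n})" for x n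
  proof -
    let ?W = "{\<Sum>i<n. c i *\<^sub>C u i | c. True}"
    have "complex_vector.subspace ?W"
    proof (rule complex_vector.subspaceI)
      show "0 \<in> ?W" by (intro CollectI exI[of _ "\<lambda>_. 0"]) simp
      show "x + y \<in> ?W" if xy: "x \<in> ?W" "y \<in> ?W" for x y
      proof -
        obtain c d where "x = (\<Sum>i<n. c i *\<^sub>C u i)" "y = (\<Sum>i<n. d i *\<^sub>C u i)" using xy by blast
        then show ?thesis by (intro CollectI exI[of _ "\<lambda>i. c i + d i"]) (simp only: scaleC_add_left sum.distrib)
      qed
      show "t *\<^sub>C x \<in> ?W" if x: "x \<in> ?W" for t x
      proof -
        obtain c where "x = (\<Sum>i<n. c i *\<^sub>C u i)" using x by blast
        then show ?thesis
          by (intro CollectI exI[of _ "\<lambda>i. t * c i"]) (simp only: complex_vector.scale_sum_right scaleC_scaleC)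
      qed
    qed
    moreover have "u ` {..<n} \<subseteq> ?W"
    proof
      fix x assume "x \<in> u ` {..<n}"
      then obtain j where j: "j < n" "x = u j" by blast
      have "(\<Sum>i<n. (if i = j then 1 else 0) *\<^sub>C u i) = (\<Sum>i<n. if i = j then u i else 0)"
        by (rule sum.cong) (auto simp: scaleC_one)
      then have "x = (\<Sum>i<n. (if i = j then 1 else 0) *\<^sub>C u i)" using j by simp
      then show "x \<in> ?W" by (intro CollectI exI[of _ "\<lambda>i. if i = j then 1 else 0"] conjI TrueI)
    qed
    ultimately have "complex_vector.span (u ` {..<n}) \<subseteq> ?W" by (rule complex_vector.span_minimal[rotated])
    then show ?thesis using that by blast
  qed
  have "\<exists>n. Q n"
  proof (rule ccontr)
    assume no: "\<not> (\<exists>n. Q n)"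
    have ind: "complex_vector.independent (u ` {..<n}) \<and> card (u ` {..<n}) = n" for n
    proof (induction n)
      case 0
      then show ?case by (simp add: complex_vector.independent_empty)
    next
      case (Suc n)
      have "u n \<notin> complex_vector.span (u ` {..<n})" using no span_form unfolding Q_def by blast
      moreover from this have "u n \<notin> u ` {..<n}"
        using complex_vector.span_base[of "u n" "u ` {..<n}"] by auto
      ultimately show ?case using Suc by (simp add: lessThan_Suc complex_vector.independent_insertI)
    qed
    obtain n where n: "\<And>X. X \<subseteq> V \<Longrightarrow> complex_vector.independent X \<Longrightarrow> finite X \<and> card X \<le> n"
      using independent_bounded by blast
    have "u ` {..<Suc n} \<subseteq> V" using uF F by blast
    then have "card (u ` {..<Suc n}) \<le> n" using n ind[of "Suc n"] by blast
    then show False using ind[of "Suc n"] by linarith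
  qed
  then obtain n where n: "Q n" and least: "\<And>k. k < n \<Longrightarrow> \<not> Q k"
    using exists_least_iff[of Q] by blast
  obtain c where c: "u n = (\<Sum>i<n. c i *\<^sub>C u i)" using n by (auto simp: Q_def)
  have "n \<noteq> 0" using c v0 u0 by (cases n) auto
  then obtain k where k: "n = Suc k" by (cases n) auto
  define p where "p = monom 1 n - (\<Sum>i<n. monom (c i) i)"
  have coeff_p: "coeff p i = (if i = n then 1 else if i < n then - c i else 0)" for i
    by (auto simp: p_def coeff_sum)
  have "degree p = n"
    by (rule antisym[OF degree_le le_degree]) (auto simp: coeff_p)
  then have "\<not> constant (poly p)" using k by (simp add: constant_degree)
  then obtain \<mu> where "poly p \<mu> = 0" using fundamental_theorem_of_algebra by blast
  then obtain r where r: "p = [:- \<mu>, 1:] * r" by (auto simp: poly_eq_0_iff_dvd dvd_def)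
  have r0: "r \<noteq> 0" using r coeff_p[of n] by auto
  have "degree p = 1 + degree r" unfolding r using r0 by (subst degree_mult_eq) auto
  then have degr: "degree r = k" using \<open>degree p = n\<close> k by simp
  have coeffr: "coeff p i = (case i of 0 \<Rightarrow> 0 | Suc j \<Rightarrow> coeff r j) - \<mu> * coeff r i" for i
    by (simp add: r coeff_pCons split: nat.split)
  have coeffk: "coeff r k = 1" using coeffr[of n] coeff_p[of n] k degr by (simp add: coeff_eq_0)
  define w where "w = (\<Sum>i<Suc k. coeff r i *\<^sub>C u i)"
  have "u ` UNIV \<subseteq> V" using uF F by blast
  then have uV: "u i \<in> V" for i by blast
  have wF: "w \<in> F" unfolding w_def using F(1) uF by (intro complex_vector.subspace_sum complex_vector.subspace_scale)
  have w0: "w \<noteq> 0"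
  proof
    assume "w = 0"
    then have "u k = - (\<Sum>i<k. coeff r i *\<^sub>C u i)"
      by (simp add: w_def coeffk scaleC_one add_eq_0_iff)
    also have "\<dots> = (\<Sum>i<k. (- coeff r i) *\<^sub>C u i)" by (simp add: sum_negf)
    finally have "Q k" unfolding Q_def by (rule exI[of _ "\<lambda>i. - coeff r i"])
    then show False using least[of k] k by simp
  qed
  have "0 = (\<Sum>i<Suc n. coeff p i *\<^sub>C u i)"
  proof -
    have "(\<Sum>i<n. coeff p i *\<^sub>C u i) = (\<Sum>i<n. - (c i *\<^sub>C u i))" by (rule sum.cong) (auto simp: coeff_p)
    then show ?thesis using c by (simp add: coeff_p scaleC_one sum_negf)
  qed
  also have "\<dots> = (\<Sum>i<Suc n. (case i of 0 \<Rightarrow> 0 | Suc j \<Rightarrow> coeff r j) *\<^sub>C u i) - (\<Sum>i<Suc n. (\<mu> * coeff r i) *\<^sub>C u i)"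
    unfolding coeffr complex_vector.scale_left_diff_distrib sum_subtractf ..
  also have "(\<Sum>i<Suc n. (case i of 0 \<Rightarrow> 0 | Suc j \<Rightarrow> coeff r j) *\<^sub>C u i) = (\<Sum>j<n. coeff r j *\<^sub>C u (Suc j))"
    by (subst sum.lessThan_Suc_shift) simp
  also have "\<dots> = h \<odot> w" unfolding w_def k uSuc using h uV by (subst mul_sum_right) auto
  also have "(\<Sum>i<Suc n. (\<mu> * coeff r i) *\<^sub>C u i) = \<mu> *\<^sub>C w"
    using degr by (simp add: k w_def coeff_eq_0 complex_vector.scale_sum_right scaleC_scaleC scaleC_add_right)
  finally have "h \<odot> w = \<mu> *\<^sub>C w" by (simp only: eq_iff_diff_eq_0[of "h \<odot> w"])
  then show thesis using that wF w0 by blast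
qed

lemma
  assumes "abelian A"
  shows abelian_in: "x \<in> A \<Longrightarrow> x \<in> V" and abelian_subspace: "complex_vector.subspace A"
    and abelian_mul: "x \<in> A \<Longrightarrow> y \<in> A \<Longrightarrow> x \<odot> y \<in> A" and abelian_adj: "x \<in> A \<Longrightarrow> adj x \<in> A"
    and abelian_comm: "x \<in> A \<Longrightarrow> y \<in> A \<Longrightarrow> x \<odot> y = y \<odot> x"
  using assms unfolding abelian_star_subalgebra_def by blast+

text \<open>A commutative C*-algebra has no nilpotent elements: apply the C*-identity first to \<open>x\<^sup>*x\<close> and then to \<open>x\<close>.\<close>
lemma abelian_reduced:
  assumes A: "abelian A" and x: "x \<in> A" "x \<odot> x = 0"
  shows "x = 0"
proof -
  note in_V = abelian_in[OF A]
  let ?a = "adj x"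
  have a: "?a \<in> A" by (rule abelian_adj[OF A x(1)])
  have "adj (?a \<odot> x) \<odot> (?a \<odot> x) = ?a \<odot> x \<odot> (?a \<odot> x)"
    using a x by (simp add: adj_mul adj_adj in_V)
  also have "\<dots> = ?a \<odot> x \<odot> (x \<odot> ?a)" using abelian_comm[OF A a x(1)] by simp
  also have "\<dots> = ?a \<odot> (x \<odot> x \<odot> ?a)" using a x(1) by (simp add: mul_assoc mul_in in_V)
  also have "\<dots> = 0" using a x by (simp add: mul_0_left mul_0_right in_V)
  finally have "?a \<odot> x = 0" using a x(1) by (intro adj_mul_self_eq_0[of "?a \<odot> x"]) (auto simp: mul_in in_V)
  then show ?thesis using adj_mul_self_eq_0 in_V x(1) by blast
qed

definition projection :: "(nat \<Rightarrow> complex) \<Rightarrow> bool" where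
  "projection e \<longleftrightarrow> e \<in> V \<and> e \<odot> e = e \<and> adj e = e"

text \<open>For a normal idempotent \<open>e\<close> the element \<open>d = e - e\<^sup>*e\<close> satisfies \<open>d\<^sup>*d = 0\<close>, so \<open>e = e\<^sup>*e\<close> is self-adjoint.\<close>
lemma abelian_idempotent_projection:
  assumes A: "abelian A" and e: "e \<in> A" "e \<odot> e = e"
  shows "projection e"
proof -
  note in_V = abelian_in[OF A]
  let ?a = "adj e"
  have a: "?a \<in> A" by (rule abelian_adj[OF A e(1)])
  have V: "e \<in> V" "?a \<in> V" "?a \<odot> e \<in> V" using e a by (auto simp: mul_in in_V)
  have aa: "?a \<odot> ?a = ?a" using adj_mul[OF V(1) V(1)] e by simp
  have 1: "e \<odot> (?a \<odot> e) = ?a \<odot> e"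
    using abelian_comm[OF A e(1) a] e V by (metis mul_assoc)
  have 2: "?a \<odot> (?a \<odot> e) = ?a \<odot> e" using V aa by (metis mul_assoc)
  have adj_ae: "adj (?a \<odot> e) = ?a \<odot> e" using V by (simp add: adj_mul adj_adj)
  have 3: "?a \<odot> e \<odot> (?a \<odot> e) = ?a \<odot> e" using V 1 2 by (simp add: mul_assoc)
  have 4: "?a \<odot> e \<odot> e = ?a \<odot> e" using V e by (simp add: mul_assoc)
  let ?d = "e - ?a \<odot> e"
  have "adj ?d \<odot> ?d = (?a - ?a \<odot> e) \<odot> (e - ?a \<odot> e)" using V by (simp add: adj_diff adj_ae)
  also have "\<dots> = 0"
    using V 2 3 4 by (simp add: mul_diff_left mul_diff_right V_diff)
  finally have "?d = 0" by (rule adj_mul_self_eq_0[OF V_diff[OF V(1,3)]])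
  then have "?a \<odot> e = e" by simp
  then have "adj e = e" using adj_ae by simp
  then show ?thesis using V e by (simp add: projection_def)
qed

text \<open>A nonzero principal ideal \<open>F\<close> of least dimension has no zero divisors, because each of its nonzero elements generates it
  as an ideal. Hence it contains an idempotent \<open>e\<close> acting as its unit. As multiplication by \<open>e a\<close> on \<open>F\<close> has an eigenvector,
  \<open>e a - \<mu> e\<close> is a zero divisor of \<open>F\<close> for the eigenvalue \<open>\<mu>\<close>, and so it vanishes.\<close>
lemma minimal_projection_exists:
  assumes A: "abelian A" and nz: "x0 \<in> A" "x0 \<noteq> 0"
  obtains e where "e \<in> A" "e \<noteq> 0" "projection e" "\<And>a. a \<in> A \<Longrightarrow> \<exists>\<mu>. e \<odot> a = \<mu> *\<^sub>C e"
proof -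
  note in_V = abelian_in[OF A] and mulA = abelian_mul[OF A] and comm = abelian_comm[OF A]
  have assoc: "a \<odot> b \<odot> c = a \<odot> (b \<odot> c)" if "a \<in> A" "b \<in> A" "c \<in> A" for a b c
    using that by (simp add: mul_assoc in_V)
  define I where "I x = (\<odot>) x ` A" for x
  have I_sub: "complex_vector.subspace (I x)" if x: "x \<in> A" for x
  proof (rule complex_vector.subspaceI)
    show "0 \<in> I x" unfolding I_def
      using complex_vector.subspace_0[OF abelian_subspace[OF A]] mul_0_right[OF in_V[OF x]] by force
    show "a + b \<in> I x" if ab: "a \<in> I x" "b \<in> I x" for a b
    proof -
      obtain u w where "u \<in> A" "w \<in> A" "a = x \<odot> u" "b = x \<odot> w" using ab by (auto simp: I_def)
      then have "a + b = x \<odot> (u + w)" "u + w \<in> A"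
        using mul_add_right[of x u w] x in_V complex_vector.subspace_add[OF abelian_subspace[OF A]] by auto
      then show ?thesis unfolding I_def by (rule image_eqI)
    qed
    show "c *\<^sub>C a \<in> I x" if a: "a \<in> I x" for a c
    proof -
      obtain u where "u \<in> A" "a = x \<odot> u" using a by (auto simp: I_def)
      then have "c *\<^sub>C a = x \<odot> (c *\<^sub>C u)" "c *\<^sub>C u \<in> A"
        using mul_scale_right[of x u c] x in_V complex_vector.subspace_scale[OF abelian_subspace[OF A]] by auto
      then show ?thesis unfolding I_def by (rule image_eqI)
    qed
  qed
  have I_A: "I x \<subseteq> A" if "x \<in> A" for x using that mulA by (auto simp: I_def)
  have I_mul: "a \<odot> b \<in> I x" if "a \<in> I x" "b \<in> A" "x \<in> A" for a b x
    using that assoc mulA by (auto simp: I_def)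
  obtain x where x: "x \<in> A" "x \<noteq> 0"
    and least: "\<And>y. y \<in> A \<Longrightarrow> y \<noteq> 0 \<Longrightarrow> complex_vector.dim (I x) \<le> complex_vector.dim (I y)"
    using ex_has_least_nat[of "\<lambda>x. x \<in> A \<and> x \<noteq> 0" x0 "\<lambda>x. complex_vector.dim (I x)"] nz by blast
  define F where "F = I x"
  have FA: "F \<subseteq> A" using I_A x by (simp add: F_def)
  have principal: "I y = F" if y: "y \<in> F" "y \<noteq> 0" for y
  proof (rule ccontr)
    assume "I y \<noteq> F"
    moreover have "I y \<subseteq> F" using y x I_mul by (auto simp: I_def[of y] F_def)
    ultimately have "complex_vector.dim (I y) < complex_vector.dim F"
      using y FA x in_V by (intro dim_less) (auto simp: F_def I_sub)
    then show False using least[of y] y FA by (auto simp: F_def)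
  qed
  have no_zero_div: "a \<odot> b \<noteq> 0" if ab: "a \<in> F" "b \<in> F" "a \<noteq> 0" "b \<noteq> 0" for a b
  proof
    assume 0: "a \<odot> b = 0"
    have "b \<in> I a" using principal ab by blast
    then obtain c where c: "c \<in> A" "b = a \<odot> c" by (auto simp only: I_def)
    have aA: "a \<in> A" and bA: "b \<in> A" using ab FA by auto
    have "b \<odot> b = c \<odot> a \<odot> b" using c comm[OF aA c(1)] by simp
    also have "\<dots> = c \<odot> (a \<odot> b)" by (rule assoc[OF c(1) aA bA])
    also have "\<dots> = 0" using 0 c mul_0_right in_V by simp
    finally show False using abelian_reduced[OF A] ab FA by blast
  qed
  define y where "y = x \<odot> x"
  have yF: "y \<in> F" using x by (auto simp: y_def F_def I_def)
  have y0: "y \<noteq> 0" using abelian_reduced[OF A x(1)] x(2) by (auto simp: y_def)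
  have yyF: "y \<odot> y \<in> F" "y \<odot> y \<noteq> 0" using no_zero_div[of y y] yF y0 I_mul FA x by (auto simp: F_def)
  then have "y \<in> I (y \<odot> y)" using principal yF by simp
  then obtain c where c: "c \<in> A" "y = y \<odot> y \<odot> c" by (auto simp only: I_def)
  define e where "e = y \<odot> c"
  have eF: "e \<in> F" using yF c x I_mul by (auto simp: e_def F_def)
  then have eA: "e \<in> A" using FA by blast
  have yA: "y \<in> A" using yF FA by blast
  have ye: "y \<odot> e = y" using c(2) assoc[OF yA yA c(1)] by (simp add: e_def)
  have e0: "e \<noteq> 0" using ye y0 mul_0_right in_V yA by auto
  have diffF: "a - b \<in> F" if "a \<in> F" "b \<in> F" for a b
    using that I_sub[OF x(1)] by (simp add: F_def complex_vector.subspace_diff)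
  have ee: "e \<odot> e = e"
  proof (rule ccontr)
    assume "e \<odot> e \<noteq> e"
    moreover have "e \<odot> e - e \<in> F" using eF eA x I_mul by (intro diffF) (auto simp: F_def)
    ultimately have "y \<odot> (e \<odot> e - e) \<noteq> 0" using no_zero_div yF y0 by simp
    moreover have "y \<odot> (e \<odot> e - e) = y \<odot> e \<odot> e - y \<odot> e"
      using yA eA by (simp add: mul_diff_right mul_assoc mul_in in_V)
    ultimately show False using ye by simp
  qed
  have proj: "projection e" by (rule abelian_idempotent_projection[OF A eA ee])
  have "\<exists>\<mu>. e \<odot> a = \<mu> *\<^sub>C e" if a: "a \<in> A" for a
  proof -
    have hF: "e \<odot> a \<in> F" using eF a x I_mul by (simp add: F_def)
    have inv: "e \<odot> a \<odot> v \<in> F" if "v \<in> F" for v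
      using hF that I_mul[where x = x and a = "e \<odot> a" and b = v] FA x(1) unfolding F_def by blast
    obtain \<mu> v where v: "v \<in> F" "v \<noteq> 0" "e \<odot> a \<odot> v = \<mu> *\<^sub>C v"
    proof (rule eigenvector_exists[of "e \<odot> a" F e])
      show "e \<odot> a \<in> V" "complex_vector.subspace F" "F \<subseteq> V"
        using hF FA in_V I_sub[OF x(1)] by (auto simp: F_def)
    qed (use inv eF e0 in auto)
    have "v \<in> I e" using principal[OF eF e0] v by simp
    then obtain b where b: "b \<in> A" "v = e \<odot> b" by (auto simp only: I_def)
    have ev: "e \<odot> v = v" using b eA ee assoc[of e e b] by simp
    have scF: "\<mu> *\<^sub>C e \<in> F" using eF I_sub[OF x(1)] by (simp add: F_def complex_vector.subspace_scale)
    have "(e \<odot> a - \<mu> *\<^sub>C e) \<odot> v = 0"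
      using v(3) ev v(1) hF eA scF FA in_V
      by (subst mul_diff_left) (auto simp: mul_scale_left subset_iff)
    then have "e \<odot> a - \<mu> *\<^sub>C e = 0" using no_zero_div[OF diffF[OF hF scF] v(1)] v(2) by blast
    then show ?thesis by (intro exI[of _ \<mu>]) simp
  qed
  then show thesis using that eA e0 proj by blast
qed

definition orthogonal_projections :: "(nat \<Rightarrow> complex) set \<Rightarrow> bool" where
  "orthogonal_projections P \<longleftrightarrow> (\<forall>p\<in>P. projection p \<and> p \<noteq> 0) \<and> (\<forall>p\<in>P. \<forall>q\<in>P. p \<noteq> q \<longrightarrow> p \<odot> q = 0)"

lemma orthogonal_projectionsD:
  assumes "orthogonal_projections P" and "p \<in> P"
  shows "p \<in> V" "p \<odot> p = p" "adj p = p" "p \<noteq> 0" "\<And>q. q \<in> P \<Longrightarrow> p \<odot> q = (if p = q then p else 0)"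
  using assms by (auto simp: orthogonal_projections_def projection_def)

lemma orthogonal_projections_independent:
  assumes P: "orthogonal_projections P"
  shows "complex_vector.independent P"
  unfolding complex_vector.dependent_explicit
proof clarify
  fix T c p assume T: "finite T" "T \<subseteq> P" and sum: "(\<Sum>v\<in>T. c v *\<^sub>C v) = 0" and p: "p \<in> T" "c p \<noteq> 0"
  have pV: "p \<in> V" using orthogonal_projectionsD(1)[OF P] T p by blast
  have TV: "v \<in> V" if "v \<in> T" for v using orthogonal_projectionsD(1)[OF P] T that by blast
  have "0 = p \<odot> (\<Sum>v\<in>T. c v *\<^sub>C v)" unfolding sum by (rule mul_0_right[OF pV, symmetric])
  also have "\<dots> = (\<Sum>v\<in>T. c v *\<^sub>C (p \<odot> v))" using TV pV by (intro mul_sum_right)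
  also have "\<dots> = (\<Sum>v\<in>T. if v = p then c p *\<^sub>C p else 0)"
    using orthogonal_projectionsD(5)[OF P] T p by (intro sum.cong) (auto simp: subset_iff)
  also have "\<dots> = c p *\<^sub>C p" using T p by simp
  finally have "c p *\<^sub>C p = 0" by (rule sym)
  then show False using p orthogonal_projectionsD(4)[OF P] T by auto
qed

text \<open>Spectral theorem for commutative finite-dimensional C*-algebras. Orthogonal projections are linearly independent, so there is an
  orthogonal family of minimal projections of greatest size. If its sum \<open>u\<close> were not a unit of \<open>A\<close>, then the annihilator
  of \<open>u\<close> in \<open>A\<close> would contain a further minimal projection.\<close>
lemma abelian_span_projections:
  assumes A: "abelian A"
  obtains P where "finite P" "P \<subseteq> A" "orthogonal_projections P" "A = complex_vector.span P"
proof -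
  note in_V = abelian_in[OF A] and mulA = abelian_mul[OF A] and comm = abelian_comm[OF A]
  define good where "good P \<longleftrightarrow> finite P \<and> P \<subseteq> A \<and> orthogonal_projections P \<and>
    (\<forall>p\<in>P. \<forall>a\<in>A. \<exists>\<mu>. p \<odot> a = \<mu> *\<^sub>C p)" for P
  obtain n where n: "\<And>X. X \<subseteq> V \<Longrightarrow> complex_vector.independent X \<Longrightarrow> finite X \<and> card X \<le> n"
    using independent_bounded by blast
  have bound: "card P < Suc n" if "good P" for P
    using that n[of P] orthogonal_projections_independent[of P] in_V by (auto simp: good_def subset_iff less_Suc_eq_le)
  have "good {}" by (simp add: good_def orthogonal_projections_def)
  then obtain P where P: "good P" and max: "\<And>P'. good P' \<Longrightarrow> card P' \<le> card P"
    using ex_has_greatest_nat[of good "{}" card "Suc n"] bound less_imp_le by metis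
  have fin: "finite P" and PA: "P \<subseteq> A" and orth: "orthogonal_projections P"
    and min: "\<And>p a. p \<in> P \<Longrightarrow> a \<in> A \<Longrightarrow> \<exists>\<mu>. p \<odot> a = \<mu> *\<^sub>C p" using P by (auto simp: good_def)
  note PD = orthogonal_projectionsD[OF orth]
  define u where "u = sum (\<lambda>p. p) P"
  have uA: "u \<in> A" unfolding u_def using PA by (intro complex_vector.subspace_sum abelian_subspace[OF A]) auto
  have pu: "p \<odot> u = p" if p: "p \<in> P" for p
  proof -
    have "p \<odot> u = (\<Sum>q\<in>P. p \<odot> q)" unfolding u_def using PD(1) p by (intro mul_sum_right') auto
    also have "\<dots> = (\<Sum>q\<in>P. if q = p then p else 0)" using PD(5)[OF p] by (intro sum.cong) auto
    finally show ?thesis using p fin by simp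
  qed
  have ub: "u \<odot> b = b" if b: "b \<in> A" for b
  proof (rule ccontr)
    assume ne: "u \<odot> b \<noteq> b"
    define A' where "A' = {a \<in> A. u \<odot> a = 0}"
    have uV: "u \<in> V" using uA in_V by blast
    have uu: "u \<odot> u = u"
    proof -
      have "u \<odot> u = (\<Sum>p\<in>P. p \<odot> u)" unfolding u_def
        using PD(1) uV unfolding u_def by (intro mul_sum_left') auto
      then show ?thesis using pu by (simp add: u_def)
    qed
    have AA: "abelian A'"
      unfolding abelian_star_subalgebra_def
    proof (intro conjI ballI)
      show "A' \<subseteq> V" using in_V by (auto simp: A'_def)
      show "complex_vector.subspace A'"
        using abelian_subspace[OF A] in_V uV
        by (auto simp: A'_def complex_vector.subspace_def mul_0_right mul_add_right mul_scale_right)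
      fix x assume x: "x \<in> A'"
      then have xA: "x \<in> A" "u \<odot> x = 0" by (auto simp: A'_def)
      have "u \<odot> adj x = adj (x \<odot> u)"
        using xA in_V uA PD(1,3) adj_mul[of x u] adj_sum[of P "\<lambda>p. p"] by (simp add: u_def)
      also have "x \<odot> u = 0" using comm[OF xA(1) uA] xA by simp
      finally have "u \<odot> adj x = 0" unfolding adj_0 .
      then show "adj x \<in> A'" using abelian_adj[OF A xA(1)] by (simp add: A'_def)
      fix y assume y: "y \<in> A'"
      then have yA: "y \<in> A" by (auto simp: A'_def)
      show "x \<odot> y = y \<odot> x" using comm xA yA by blast
      have "u \<odot> (x \<odot> y) = u \<odot> x \<odot> y" using uV xA(1) yA in_V by (simp add: mul_assoc)
      also have "\<dots> = 0" using xA(2) yA in_V by (simp add: mul_0_left)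
      finally show "x \<odot> y \<in> A'" using mulA xA yA in_V by (simp add: A'_def)
    qed
    have sub0: "a - u \<odot> a \<in> A'" if "a \<in> A" for a
    proof -
      have "u \<odot> (a - u \<odot> a) = u \<odot> a - u \<odot> u \<odot> a"
        using that uA in_V mulA by (simp add: mul_diff_right mul_assoc)
      then show ?thesis using that uA mulA uu complex_vector.subspace_diff[OF abelian_subspace[OF A]]
        by (simp add: A'_def)
    qed
    obtain e where e: "e \<in> A'" "e \<noteq> 0" "projection e" "\<And>a. a \<in> A' \<Longrightarrow> \<exists>\<mu>. e \<odot> a = \<mu> *\<^sub>C e"
      using minimal_projection_exists[OF AA sub0[OF b]] ne by auto
    have eA: "e \<in> A" "u \<odot> e = 0" using e by (auto simp: A'_def)
    have eu: "e \<odot> u = 0" using comm[OF eA(1) uA] eA by simp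
    have pe: "p \<odot> e = 0" if p: "p \<in> P" for p
    proof -
      have "p \<odot> e = p \<odot> u \<odot> e" using pu[OF p] by simp
      also have "\<dots> = p \<odot> (u \<odot> e)" using PD(1)[OF p] uV eA in_V by (intro mul_assoc) auto
      finally show ?thesis using eA(2) PD(1)[OF p] by (simp add: mul_0_right)
    qed
    have ep: "e \<odot> p = 0" if p: "p \<in> P" for p using comm[OF eA(1), of p] pe[OF p] PA p by auto
    have emin: "\<exists>\<mu>. e \<odot> a = \<mu> *\<^sub>C e" if a: "a \<in> A" for a
    proof -
      have "e \<odot> (a - u \<odot> a) = e \<odot> a - e \<odot> u \<odot> a"
        using a uA eA in_V mulA by (simp add: mul_diff_right mul_assoc)
      also have "\<dots> = e \<odot> a" using a eu in_V by (simp add: mul_0_left)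
      finally show ?thesis using e(4)[OF sub0[OF a]] by simp
    qed
    have "e \<notin> P" using pe e(2,3) by (auto simp: projection_def)
    moreover have "good (insert e P)"
      unfolding good_def
    proof (intro conjI)
      show "orthogonal_projections (insert e P)"
        using orth e(2,3) pe ep unfolding orthogonal_projections_def by blast
      show "\<forall>p\<in>insert e P. \<forall>a\<in>A. \<exists>\<mu>. p \<odot> a = \<mu> *\<^sub>C p" using emin min by blast
    qed (use fin PA eA in auto)
    ultimately show False using max[of "insert e P"] fin by simp
  qed
  have "A = complex_vector.span P"
  proof
    show "complex_vector.span P \<subseteq> A" using PA abelian_subspace[OF A] by (rule complex_vector.span_minimal)
    show "A \<subseteq> complex_vector.span P"
    proof
      fix a assume a: "a \<in> A"
      have "a = u \<odot> a" using ub[OF a] by simp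
      also have "\<dots> = (\<Sum>p\<in>P. p \<odot> a)" unfolding u_def using PD(1) a in_V by (intro mul_sum_left') auto
      also have "\<dots> \<in> complex_vector.span P"
      proof (rule complex_vector.span_sum)
        fix p assume p: "p \<in> P"
        then obtain \<mu> where "p \<odot> a = \<mu> *\<^sub>C p" using min a by blast
        then show "p \<odot> a \<in> complex_vector.span P" using p
          by (simp add: complex_vector.span_scale complex_vector.span_base)
      qed
      finally show "a \<in> complex_vector.span P" .
    qed
  qed
  then show thesis using that fin PA orth by blast
qed

lemma masa_exists: obtains A where "maximal_abelian_star_subalgebra B A"
proof -
  obtain n where n: "\<And>X. X \<subseteq> V \<Longrightarrow> complex_vector.independent X \<Longrightarrow> finite X \<and> card X \<le> n"
    using independent_bounded by blast
  have bound: "complex_vector.dim A < Suc n" if "abelian A" for A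
  proof -
    obtain X where X: "X \<subseteq> A" "complex_vector.independent X" "A \<subseteq> complex_vector.span X"
      "card X = complex_vector.dim A" using complex_vector.basis_exists by blast
    then have "X \<subseteq> V" using abelian_in[OF that] by blast
    then show ?thesis using n[of X] X by simp
  qed
  have ab0: "abelian {0}"
    by (auto simp: abelian_star_subalgebra_def V_0 mul_0_left adj_0 complex_vector.subspace_def)
  then obtain A where A: "abelian A" and max: "\<And>A'. abelian A' \<Longrightarrow> complex_vector.dim A' \<le> complex_vector.dim A"
    using ex_has_greatest_nat[of "\<lambda>A. abelian A" "{0}" complex_vector.dim "Suc n"] bound less_imp_le by metis
  have "A' = A" if A': "abelian A'" "A \<subseteq> A'" for A'
  proof (rule ccontr)
    assume "A' \<noteq> A"
    then have "complex_vector.dim A < complex_vector.dim A'"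
      using A' abelian_subspace[OF A] abelian_subspace[OF A'(1)] abelian_in[OF A'(1)] by (intro dim_less) auto
    then show False using max[OF A'(1)] by simp
  qed
  then show thesis using A that by (auto simp: maximal_abelian_star_subalgebra_def)
qed

text \<open>The bicommutant of \<open>A\<close> together with \<open>z\<close> is commutative, because \<open>A\<close> and \<open>z\<close> commute, and so it equals \<open>A\<close> by maximality.\<close>
lemma masa_contains_commutant:
  assumes A: "maximal_abelian_star_subalgebra B A" and z: "z \<in> V" "adj z = z"
    and zA: "\<And>a. a \<in> A \<Longrightarrow> z \<odot> a = a \<odot> z"
  shows "z \<in> A"
proof -
  have ab: "abelian A" and max: "\<And>A'. abelian A' \<Longrightarrow> A \<subseteq> A' \<Longrightarrow> A' = A"
    using A by (auto simp: maximal_abelian_star_subalgebra_def)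
  note in_V = abelian_in[OF ab]
  define comm where "comm X = {b \<in> V. \<forall>x\<in>X. b \<odot> x = x \<odot> b}" for X
  have comm_sub: "complex_vector.subspace (comm X)" if "X \<subseteq> V" for X
    using that V_0 V_add V_scale unfolding comm_def complex_vector.subspace_def
    by (auto simp: mul_0_left mul_0_right mul_add_left mul_add_right mul_scale_left mul_scale_right subset_iff)
  have comm_mul: "x \<odot> y \<in> comm X" if "X \<subseteq> V" "x \<in> comm X" "y \<in> comm X" for X x y
  proof -
    have "x \<odot> y \<odot> w = w \<odot> (x \<odot> y)" if w: "w \<in> X" for w
    proof -
      have V: "x \<in> V" "y \<in> V" "w \<in> V" and c: "x \<odot> w = w \<odot> x" "y \<odot> w = w \<odot> y"
        using that w \<open>X \<subseteq> V\<close> \<open>x \<in> comm X\<close> \<open>y \<in> comm X\<close> by (auto simp: comm_def)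
      have "x \<odot> y \<odot> w = x \<odot> (w \<odot> y)" using V c by (simp add: mul_assoc)
      also have "\<dots> = w \<odot> x \<odot> y" using V c by (simp add: mul_assoc[symmetric])
      also have "\<dots> = w \<odot> (x \<odot> y)" using V by (simp add: mul_assoc)
      finally show ?thesis .
    qed
    then show ?thesis using that by (simp add: comm_def mul_in)
  qed
  have comm_adj: "adj x \<in> comm X" if "X \<subseteq> V" "adj ` X \<subseteq> X" "x \<in> comm X" for X x
  proof -
    have "adj x \<odot> w = w \<odot> adj x" if w: "w \<in> X" for w
    proof -
      have V: "x \<in> V" "w \<in> V" and c: "x \<odot> adj w = adj w \<odot> x"
        using w \<open>X \<subseteq> V\<close> \<open>adj ` X \<subseteq> X\<close> \<open>x \<in> comm X\<close> by (auto simp: comm_def)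
      show ?thesis using arg_cong[OF c, of adj] V by (simp add: adj_mul adj_in adj_adj)
    qed
    then show ?thesis using that by (simp add: comm_def adj_in)
  qed
  define X where "X = insert z A"
  define C where "C = comm X"
  have XV: "X \<subseteq> V" using z in_V by (auto simp: X_def)
  have Xadj: "adj ` X \<subseteq> X" using z abelian_adj[OF ab] by (auto simp: X_def)
  have XC: "X \<subseteq> C" using XV zA abelian_comm[OF ab] by (auto simp: X_def C_def comm_def)
  have CV: "C \<subseteq> V" by (auto simp: C_def comm_def)
  have Cadj: "adj ` C \<subseteq> C" using comm_adj[OF XV Xadj] by (auto simp: C_def)
  have CC: "comm C \<subseteq> C"
    using XC unfolding C_def[of] by (auto simp: C_def comm_def)
  have "abelian (comm C)"
    unfolding abelian_star_subalgebra_def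
  proof (intro conjI ballI)
    show "comm C \<subseteq> V" by (auto simp: comm_def)
    show "complex_vector.subspace (comm C)" by (rule comm_sub[OF CV])
    fix x assume x: "x \<in> comm C"
    show "adj x \<in> comm C" by (rule comm_adj[OF CV Cadj x])
    fix y assume y: "y \<in> comm C"
    show "x \<odot> y \<in> comm C" by (rule comm_mul[OF CV x y])
    show "x \<odot> y = y \<odot> x" using x y CC unfolding comm_def[of C] by blast
  qed
  moreover have XCC: "X \<subseteq> comm C"
  proof
    fix x assume x: "x \<in> X"
    have "x \<odot> c = c \<odot> x" if "c \<in> C" for c using that x by (simp add: C_def comm_def)
    then show "x \<in> comm C" using x XV by (auto simp: comm_def)
  qed
  ultimately have "comm C = A" using max by (auto simp: X_def)
  then show ?thesis using XCC by (auto simp: X_def)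
qed

lemma nrm_projection: "projection p \<Longrightarrow> p \<noteq> 0 \<Longrightarrow> nrm p = 1"
  using nrm_adj_mul[of p] nrm_eq_0[of p] by (auto simp: projection_def power2_eq_square)

text \<open>Both statements use that self-adjoint elements commuting with the projections in \<open>P\<close> belong to \<open>A\<close>. If \<open>y = b - u b\<close>
  with \<open>u\<close> the sum of \<open>P\<close>, then \<open>y y\<^sup>*\<close> is such an element, but it is annihilated by \<open>P\<close>, hence by \<open>A\<close> and
  by itself; so it is zero. If \<open>k\<close> is self-adjoint, then \<open>p k p\<close> is such an element; being in the span of \<open>P\<close> and equal to \<open>p (p k p)\<close>,
  it is a scalar multiple of \<open>p\<close>.\<close>
lemma
  assumes A: "maximal_abelian_star_subalgebra B A" and P: "finite P" "orthogonal_projections P"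
    and AP: "A = complex_vector.span P"
  shows masa_unit: "b \<in> V \<Longrightarrow> (\<Sum>p\<in>P. p) \<odot> b = b"
    and masa_corner: "p \<in> P \<Longrightarrow> x \<in> V \<Longrightarrow> \<exists>\<mu>. p \<odot> x \<odot> p = \<mu> *\<^sub>C p"
proof -
  note PD = orthogonal_projectionsD[OF P(2)]
  have ab: "abelian A" using A by (simp add: maximal_abelian_star_subalgebra_def)
  have AI: "a \<in> W" if "a \<in> A" "complex_vector.subspace W" "P \<subseteq> W" for a W
    using that complex_vector.span_minimal[of P W] AP by blast
  define u where "u = (\<Sum>p\<in>P. p)"
  have uV: "u \<in> V" unfolding u_def using PD(1) by (rule V_sum)
  have pu: "p \<odot> u = p" if p: "p \<in> P" for p
  proof -
    have "p \<odot> u = (\<Sum>q\<in>P. p \<odot> q)" unfolding u_def using PD(1) p by (intro mul_sum_right') auto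
    also have "\<dots> = (\<Sum>q\<in>P. if q = p then p else 0)" using PD(5)[OF p] by (intro sum.cong) auto
    finally show ?thesis using p P by simp
  qed
  have commI: "z \<in> A"
    if z: "z \<in> V" "adj z = z" "\<And>p. p \<in> P \<Longrightarrow> z \<odot> p = p \<odot> z" for z
  proof (rule masa_contains_commutant[OF A z(1,2)])
    fix a assume a: "a \<in> A"
    have "complex_vector.subspace {a \<in> V. z \<odot> a = a \<odot> z}"
      using V_0 V_add V_scale z(1) unfolding complex_vector.subspace_def
      by (auto simp: mul_0_left mul_0_right mul_add_left mul_add_right mul_scale_left mul_scale_right)
    moreover have "P \<subseteq> {a \<in> V. z \<odot> a = a \<odot> z}" using PD(1) z(3) by blast
    ultimately show "z \<odot> a = a \<odot> z" using AI[OF a] by blast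
  qed
  show "(\<Sum>p\<in>P. p) \<odot> b = b" if b: "b \<in> V"
  proof -
    define y where "y = b - u \<odot> b"
    have yV: "y \<in> V" unfolding y_def using uV b by (intro V_diff mul_in)
    define z where "z = y \<odot> adj y"
    have zV: "z \<in> V" and zadj: "adj z = z" using yV by (auto simp: z_def mul_in adj_in adj_mul adj_adj)
    have pz: "p \<odot> z = 0" if p: "p \<in> P" for p
    proof -
      have "p \<odot> y = p \<odot> b - p \<odot> u \<odot> b"
        using PD(1)[OF p] b uV by (simp add: y_def mul_diff_right mul_assoc mul_in)
      then have "p \<odot> y = 0" using pu[OF p] by simp
      moreover have "p \<odot> z = p \<odot> y \<odot> adj y" using PD(1)[OF p] yV by (simp add: z_def mul_assoc adj_in)
      ultimately show ?thesis using mul_0_left[OF adj_in[OF yV]] by simp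
    qed
    have zp: "z \<odot> p = 0" if p: "p \<in> P" for p
    proof -
      have "adj (p \<odot> z) = z \<odot> p" using adj_mul[OF PD(1)[OF p] zV] zadj PD(3)[OF p] by simp
      then show ?thesis unfolding pz[OF p] adj_0 by (rule sym)
    qed
    have zA: "z \<in> A" using zV zadj pz zp by (intro commI) auto
    have "complex_vector.subspace {a \<in> V. a \<odot> z = 0}"
      using V_0 V_add V_scale zV unfolding complex_vector.subspace_def
      by (auto simp: mul_0_left mul_add_left mul_scale_left)
    moreover have "P \<subseteq> {a \<in> V. a \<odot> z = 0}" using PD(1) pz by blast
    ultimately have "z \<odot> z = 0" using AI[OF zA] by blast
    then have "z = 0" by (rule abelian_reduced[OF ab zA])
    then have "adj (adj y) \<odot> adj y = 0" using yV by (simp add: adj_adj z_def)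
    then have "adj y = 0" using adj_in[OF yV] by (rule adj_mul_self_eq_0[rotated])
    then have "adj (adj y) = adj 0" by (rule arg_cong)
    then have "y = 0" unfolding adj_adj[OF yV] adj_0 .
    then show ?thesis by (simp add: y_def u_def)
  qed
  show "\<exists>\<mu>. p \<odot> x \<odot> p = \<mu> *\<^sub>C p" if p: "p \<in> P" and x: "x \<in> V"
  proof -
    note pD = PD[OF p]
    have selfadj: "\<exists>\<mu>. p \<odot> k \<odot> p = \<mu> *\<^sub>C p" if k: "k \<in> V" "adj k = k" for k
    proof -
      define h where "h = p \<odot> k \<odot> p"
      have hV: "h \<in> V" and hadj: "adj h = h"
        using pD(1,3) k by (auto simp: h_def mul_in adj_mul mul_assoc)
      have ph: "p \<odot> h = h" using pD(1,2) k by (simp add: h_def mul_in mul_assoc[symmetric])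
      have hp: "h \<odot> p = h" using pD(1,2) k by (simp add: h_def mul_in mul_assoc)
      have "h \<odot> q = q \<odot> h" if q: "q \<in> P" for q
      proof (cases "q = p")
        case True then show ?thesis using ph hp by simp
      next
        case False
        have qp: "q \<odot> p = 0" "p \<odot> q = 0" using pD(5)[OF q] PD(5)[OF q p] False by auto
        have "h \<odot> q = h \<odot> (p \<odot> q)" using hp hV pD(1) PD(1)[OF q] by (simp flip: mul_assoc)
        moreover have "q \<odot> h = q \<odot> p \<odot> h" using ph hV pD(1) PD(1)[OF q] by (simp add: mul_assoc)
        ultimately show ?thesis using qp hV by (simp add: mul_0_left mul_0_right)
      qed
      then have hA: "h \<in> A" using hV hadj by (intro commI)
      have "complex_vector.subspace {a \<in> V. \<exists>\<mu>. p \<odot> a = \<mu> *\<^sub>C p}"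
        unfolding complex_vector.subspace_def
      proof (intro conjI ballI allI)
        show "0 \<in> {a \<in> V. \<exists>\<mu>. p \<odot> a = \<mu> *\<^sub>C p}"
          using V_0 mul_0_right[OF pD(1)] by (auto intro: exI[of _ 0])
        fix a assume "a \<in> {a \<in> V. \<exists>\<mu>. p \<odot> a = \<mu> *\<^sub>C p}"
        then obtain \<mu> where a: "a \<in> V" "p \<odot> a = \<mu> *\<^sub>C p" by blast
        show "c *\<^sub>C a \<in> {a \<in> V. \<exists>\<mu>. p \<odot> a = \<mu> *\<^sub>C p}" for c
          using a pD(1) by (auto simp: V_scale mul_scale_right)
        fix b assume "b \<in> {a \<in> V. \<exists>\<mu>. p \<odot> a = \<mu> *\<^sub>C p}"
        then obtain \<nu> where b: "b \<in> V" "p \<odot> b = \<nu> *\<^sub>C p" by blast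
        have "p \<odot> (a + b) = (\<mu> + \<nu>) *\<^sub>C p" using a b pD(1) by (simp add: mul_add_right scaleC_add_left)
        then show "a + b \<in> {a \<in> V. \<exists>\<mu>. p \<odot> a = \<mu> *\<^sub>C p}" using V_add a b by blast
      qed
      moreover have "P \<subseteq> {a \<in> V. \<exists>\<mu>. p \<odot> a = \<mu> *\<^sub>C p}"
      proof
        fix q assume q: "q \<in> P"
        have "p \<odot> q = (if p = q then 1 else 0) *\<^sub>C p" using pD(5)[OF q] by (simp add: scaleC_one)
        then show "q \<in> {a \<in> V. \<exists>\<mu>. p \<odot> a = \<mu> *\<^sub>C p}" using PD(1)[OF q] by blast
      qed
      ultimately have "\<exists>\<mu>. p \<odot> h = \<mu> *\<^sub>C p" using AI[OF hA] by blast
      then show ?thesis using ph by (simp add: h_def)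
    qed
    define k1 where "k1 = x + adj x"
    define k2 where "k2 = \<i> *\<^sub>C (x - adj x)"
    have k1: "k1 \<in> V" "adj k1 = k1" using x by (auto simp: k1_def V_add adj_in adj_add adj_adj add.commute)
    have k2V: "k2 \<in> V" using x by (auto simp: k2_def V_scale V_diff adj_in)
    have "adj k2 = (- \<i>) *\<^sub>C (adj x - x)" using x by (simp add: k2_def adj_scale V_diff adj_in adj_diff adj_adj)
    also have "\<dots> = k2" by (simp only: k2_def complex_vector.scale_minus_left complex_vector.scale_right_diff_distrib minus_diff_minus minus_diff_eq)
    finally have k2: "adj k2 = k2" .
    obtain \<mu> where \<mu>: "p \<odot> k1 \<odot> p = \<mu> *\<^sub>C p" using selfadj[OF k1] by blast
    obtain \<nu> where \<nu>: "p \<odot> k2 \<odot> p = \<nu> *\<^sub>C p" using selfadj[OF k2V k2] by blast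
    have xeq: "x = (1/2) *\<^sub>C k1 + (- \<i> / 2) *\<^sub>C k2"
      by (auto simp: k1_def k2_def fun_eq_iff scaleC_fun_def scaleC_complex_def field_simps)
    have "p \<odot> x \<odot> p = (1/2) *\<^sub>C (p \<odot> k1 \<odot> p) + (- \<i> / 2) *\<^sub>C (p \<odot> k2 \<odot> p)"
      by (subst xeq) (use pD(1) k1 k2V in \<open>simp only: mul_add_left mul_add_right mul_scale_left mul_scale_right mul_in V_scale\<close>)
    also have "\<dots> = (\<mu> / 2 - \<i> * \<nu> / 2) *\<^sub>C p"
      unfolding \<mu> \<nu> scaleC_scaleC scaleC_add_left[symmetric] by simp
    finally show ?thesis by blast
  qed
qed

text \<open>An Auerbach-type system whose size is only quadratic in the rank. For the minimal projections \<open>p, q\<close> spanning a maximal abelian subalgebra the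
  corner \<open>p V q\<close> is at most one-dimensional: for \<open>v \<noteq> 0\<close> and \<open>y\<close> in it, \<open>v v\<^sup>*\<close> is a nonzero multiple of \<open>p\<close> and
  \<open>v\<^sup>*y\<close> is a multiple of \<open>q\<close>, so \<open>v v\<^sup>*y\<close> is a multiple of both \<open>y\<close> and \<open>v\<close>. The functionals are the coordinates
  of \<open>p x q\<close> with respect to a unit vector; they recover \<open>x\<close> because the projections add up to the unit.\<close>
lemma coordinate_functionals:
  obtains I :: "((nat \<Rightarrow> complex) \<times> (nat \<Rightarrow> complex)) set" and f where
    "finite I" "card I = (B_rank B)\<^sup>2" "\<And>i. i \<in> I \<Longrightarrow> clinear_on V (f i :: _ \<Rightarrow> complex)"
    "\<And>i x. i \<in> I \<Longrightarrow> x \<in> V \<Longrightarrow> cmod (f i x) \<le> nrm x"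
    "\<And>x. x \<in> V \<Longrightarrow> nrm x \<le> (\<Sum>i\<in>I. cmod (f i x))"
proof -
  define A where "A = (SOME A. maximal_abelian_star_subalgebra B A)"
  have A: "maximal_abelian_star_subalgebra B A"
    unfolding A_def using masa_exists by (metis someI_ex)
  then have "abelian A" by (simp add: maximal_abelian_star_subalgebra_def)
  then obtain P where P: "finite P" "P \<subseteq> A" "orthogonal_projections P" "A = complex_vector.span P"
    by (rule abelian_span_projections)
  note PD = orthogonal_projectionsD[OF P(3)]
  have projP: "projection p" if "p \<in> P" for p using P(3) that by (simp add: orthogonal_projections_def)
  have rank: "B_rank B = card P"
    unfolding B_rank_def A_def[symmetric] P(4)
    by (rule complex_vector.dim_span_eq_card_independent[OF orthogonal_projections_independent[OF P(3)]])
  note unit = masa_unit[OF A P(1,3,4)] and corner = masa_corner[OF A P(1,3,4)]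
  have line: "\<exists>w\<in>V. nrm w = 1 \<and> (\<forall>x\<in>V. \<exists>\<mu>. p \<odot> x \<odot> q = \<mu> *\<^sub>C w)" if p: "p \<in> P" and q: "q \<in> P" for p q
  proof (cases "\<forall>x\<in>V. p \<odot> x \<odot> q = 0")
    case True
    then have "\<forall>x\<in>V. \<exists>\<mu>. p \<odot> x \<odot> q = \<mu> *\<^sub>C p" by (auto intro!: exI[of _ 0])
    then show ?thesis using nrm_projection projP[OF p] PD(1,4)[OF p] by blast
  next
    case False
    then obtain x0 where x0: "x0 \<in> V" "p \<odot> x0 \<odot> q \<noteq> 0" by blast
    define v where "v = p \<odot> x0 \<odot> q"
    have V: "p \<in> V" "q \<in> V" "v \<in> V" using PD(1) p q x0 by (auto simp: v_def mul_in)
    have v0: "nrm v \<noteq> 0" using nrm_eq_0[OF V(3)] x0 by (auto simp: v_def)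
    \<comment> \<open>\<open>\<mu>\<close> and \<open>\<nu>\<close> are the scalars of \<open>v v\<^sup>*\<close> and of \<open>v\<^sup>*y\<close>.\<close>
    have line_v: "\<exists>\<mu>. p \<odot> y \<odot> q = \<mu> *\<^sub>C v" if y: "y \<in> V" for y
    proof -
      have aV: "adj v \<in> V" "x0 \<odot> q \<odot> adj v \<in> V" "adj v \<odot> (p \<odot> y) \<in> V" using V x0 y by (auto simp: adj_in mul_in)
      have vq: "v \<odot> q = v" using V x0 PD(2)[OF q] by (simp add: v_def mul_assoc mul_in)
      have adjv: "q \<odot> adj v = adj v" using arg_cong[OF vq, of adj] V PD(3)[OF q] by (simp add: adj_mul)
      have adjv': "adj v \<odot> p = adj v"
      proof -
        have "p \<odot> v = v" using V x0 PD(2)[OF p] by (simp add: v_def mul_assoc[symmetric] mul_in)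
        then show ?thesis using adj_mul[OF V(1,3)] PD(3)[OF p] by simp
      qed
      obtain \<mu> where \<mu>: "p \<odot> (x0 \<odot> q \<odot> adj v) \<odot> p = \<mu> *\<^sub>C p" using corner[OF p aV(2)] by blast
      obtain \<nu> where \<nu>: "q \<odot> (adj v \<odot> (p \<odot> y)) \<odot> q = \<nu> *\<^sub>C q" using corner[OF q aV(3)] by blast
      have vv: "v \<odot> adj v = \<mu> *\<^sub>C p"
      proof -
        have "p \<odot> (x0 \<odot> q \<odot> adj v) \<odot> p = v \<odot> (adj v \<odot> p)" using V x0 aV by (simp add: v_def mul_assoc mul_in)
        then show ?thesis using \<mu> adjv' by simp
      qed
      have \<mu>0: "\<mu> \<noteq> 0"
      proof
        assume "\<mu> = 0"
        then have "adj (adj v) \<odot> adj v = 0" using vv V by (simp add: adj_adj)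
        then have "adj v = 0" by (rule adj_mul_self_eq_0[OF aV(1)])
        then show False using nrm_adj[OF V(3)] nrm_0 v0 by simp
      qed
      have "\<mu> *\<^sub>C (p \<odot> y \<odot> q) = \<mu> *\<^sub>C p \<odot> (p \<odot> y \<odot> q)"
      proof -
        have "p \<odot> (p \<odot> y \<odot> q) = p \<odot> y \<odot> q"
          using V y PD(2)[OF p] by (simp add: mul_assoc[symmetric] mul_in)
        then show ?thesis using V y by (simp add: mul_scale_left mul_in)
      qed
      also have "\<dots> = v \<odot> adj v \<odot> (p \<odot> y \<odot> q)" by (simp only: vv)
      also have "\<dots> = v \<odot> (q \<odot> adj v) \<odot> (p \<odot> y \<odot> q)" by (simp only: adjv)
      also have "\<dots> = v \<odot> (q \<odot> (adj v \<odot> (p \<odot> y)) \<odot> q)" using V y aV by (simp add: mul_assoc mul_in)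
      also have "\<dots> = \<nu> *\<^sub>C (v \<odot> q)" unfolding \<nu> using V by (simp add: mul_scale_right)
      finally have "\<mu> *\<^sub>C (p \<odot> y \<odot> q) = \<nu> *\<^sub>C v" by (simp only: vq)
      then have "(1 / \<mu>) *\<^sub>C (\<mu> *\<^sub>C (p \<odot> y \<odot> q)) = (1 / \<mu>) *\<^sub>C (\<nu> *\<^sub>C v)" by (rule arg_cong)
      then show ?thesis using \<mu>0 unfolding scaleC_scaleC by (auto simp: scaleC_one)
    qed
    define c where "c = complex_of_real (nrm v)"
    have c0: "c \<noteq> 0" using v0 by (simp add: c_def)
    have "nrm ((1 / c) *\<^sub>C v) = 1" using V v0 nrm_nonneg[OF V(3)] by (simp add: nrm_scale c_def norm_divide)
    moreover have "\<exists>\<mu>. p \<odot> x \<odot> q = \<mu> *\<^sub>C ((1 / c) *\<^sub>C v)" if x: "x \<in> V" for x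
    proof -
      obtain \<mu> where "p \<odot> x \<odot> q = \<mu> *\<^sub>C v" using line_v[OF x] by blast
      also have "\<dots> = (\<mu> * c) *\<^sub>C ((1 / c) *\<^sub>C v)" using c0 by (simp only: scaleC_scaleC) simp
      finally show ?thesis by blast
    qed
    moreover have "(1 / c) *\<^sub>C v \<in> V" by (rule V_scale[OF V(3)])
    ultimately show ?thesis by blast
  qed
  then obtain w where w: "\<And>p q. p \<in> P \<Longrightarrow> q \<in> P \<Longrightarrow> w p q \<in> V" "\<And>p q. p \<in> P \<Longrightarrow> q \<in> P \<Longrightarrow> nrm (w p q) = 1"
    "\<And>p q x. p \<in> P \<Longrightarrow> q \<in> P \<Longrightarrow> x \<in> V \<Longrightarrow> \<exists>\<mu>. p \<odot> x \<odot> q = \<mu> *\<^sub>C w p q" by metis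
  then obtain g where g: "\<And>p q x. p \<in> P \<Longrightarrow> q \<in> P \<Longrightarrow> x \<in> V \<Longrightarrow> p \<odot> x \<odot> q = g p q x *\<^sub>C w p q" by metis
  have norm_g: "cmod (g p q x) = nrm (p \<odot> x \<odot> q)" if "p \<in> P" "q \<in> P" "x \<in> V" for p q x
    using g[OF that] nrm_scale[OF w(1)] w(2) that by simp
  define f where "f i = g (fst i) (snd i)" for i :: "(nat \<Rightarrow> complex) \<times> (nat \<Rightarrow> complex)"
  show thesis
  proof (rule that[of "P \<times> P" f])
    show "finite (P \<times> P)" using P by simp
    show "card (P \<times> P) = (B_rank B)\<^sup>2" by (simp add: rank card_cartesian_product power2_eq_square)
    fix i assume "i \<in> P \<times> P"
    then obtain p q where i: "i = (p, q)" "p \<in> P" "q \<in> P" by blast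
    note pq = i(2,3) and V = PD(1)[OF i(2)] PD(1)[OF i(3)]
    have w0: "w p q \<noteq> 0" using w(2)[OF pq] nrm_0 by auto
    show "clinear_on V (f i)"
      unfolding clinear_on_def
    proof (intro conjI ballI allI)
      fix x assume x: "x \<in> V"
      show "f i (c *\<^sub>C x) = c *\<^sub>C f i x" for c
      proof -
        have "g p q (c *\<^sub>C x) *\<^sub>C w p q = (c * g p q x) *\<^sub>C w p q"
          unfolding g[OF pq V_scale[OF x], symmetric] scaleC_scaleC[symmetric] g[OF pq x, symmetric]
          using V x by (simp only: mul_scale_left mul_scale_right mul_in)
        then show ?thesis using w0 by (simp add: f_def i scaleC_complex_def)
      qed
      fix y assume y: "y \<in> V"
      have "g p q (x + y) *\<^sub>C w p q = (g p q x + g p q y) *\<^sub>C w p q"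
        unfolding g[OF pq V_add[OF x y], symmetric] scaleC_add_left g[OF pq x, symmetric] g[OF pq y, symmetric]
        using V x y by (simp only: mul_add_left mul_add_right mul_in)
      then show "f i (x + y) = f i x + f i y" using w0 by (simp add: f_def i)
    qed
    fix x assume x: "x \<in> V"
    have "nrm (p \<odot> x \<odot> q) \<le> nrm (p \<odot> x) * nrm q" using V x by (intro nrm_mul mul_in)
    also have "\<dots> \<le> nrm p * nrm x * nrm q"
      using V x by (intro mult_right_mono nrm_mul nrm_nonneg)
    also have "\<dots> = nrm x" using nrm_projection[OF projP] PD(4) pq by simp
    finally show "cmod (f i x) \<le> nrm x" using norm_g[OF pq x] by (simp add: f_def i)
  next
    fix x assume x: "x \<in> V"
    define u where "u = (\<Sum>p\<in>P. p)"
    have uV: "u \<in> V" unfolding u_def using PD(1) by (rule V_sum)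
    have uadj: "adj u = u" unfolding u_def using PD(1,3) by (simp add: adj_sum)
    have ux: "u \<odot> x = x" using unit[OF x] by (simp add: u_def)
    have "u \<odot> adj x = adj x" using unit[OF adj_in[OF x]] by (simp add: u_def)
    then have "adj (u \<odot> adj x) = x" using adj_adj[OF x] by simp
    then have xu: "x \<odot> u = x" using adj_mul[OF uV adj_in[OF x]] adj_adj[OF x] uadj by simp
    have "x = (\<Sum>p\<in>P. p \<odot> x)" using ux mul_sum_left'[of x P "\<lambda>p. p"] x PD(1) by (simp add: u_def)
    also have "\<dots> = (\<Sum>p\<in>P. \<Sum>q\<in>P. p \<odot> x \<odot> q)"
    proof (rule sum.cong[OF refl])
      fix p assume p: "p \<in> P"
      have "p \<odot> x = p \<odot> x \<odot> u" using xu PD(1)[OF p] x uV by (simp add: mul_assoc)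
      also have "\<dots> = (\<Sum>q\<in>P. p \<odot> x \<odot> q)" unfolding u_def using PD(1) p x by (intro mul_sum_right' mul_in) auto
      finally show "p \<odot> x = (\<Sum>q\<in>P. p \<odot> x \<odot> q)" .
    qed
    also have "\<dots> = (\<Sum>i\<in>P \<times> P. fst i \<odot> x \<odot> snd i)" by (simp add: sum.cartesian_product case_prod_beta)
    finally have "nrm x \<le> (\<Sum>i\<in>P \<times> P. nrm (fst i \<odot> x \<odot> snd i))"
      using nrm_sum[of "P \<times> P" "\<lambda>i. fst i \<odot> x \<odot> snd i"] PD(1) x by (auto simp: mul_in)
    also have "\<dots> = (\<Sum>i\<in>P \<times> P. cmod (f i x))"
      using norm_g x by (intro sum.cong) (auto simp: f_def)
    finally show "nrm x \<le> (\<Sum>i\<in>P \<times> P. cmod (f i x))" .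
  qed
qed

end

section \<open>Random signs and noncommutative polynomials\<close>

text \<open>A word of length \<open>L\<close> indexes a monomial of degree \<open>L\<close> in noncommuting elements with indices below \<open>k\<close>.\<close>
definition words :: "nat \<Rightarrow> nat \<Rightarrow> nat list set" where
  "words k L = {w. set w \<subseteq> {..<k} \<and> length w = L}"

definition signs :: "nat \<Rightarrow> (nat \<Rightarrow> real) set" where
  "signs k = {..<k} \<rightarrow>\<^sub>E {-1, 1}"

definition sign_word :: "(nat \<Rightarrow> real) \<Rightarrow> nat list \<Rightarrow> real" where
  "sign_word \<epsilon> w = prod_list (map \<epsilon> w)"

lemma finite_signs: "finite (signs k)"
  unfolding signs_def by (rule finite_PiE) auto

lemma card_signs: "card (signs k) = 2 ^ k"
  unfolding signs_def by (subst card_PiE) (auto simp: numeral_2_eq_2)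

lemma sign_word_append: "sign_word \<epsilon> (u @ v) = sign_word \<epsilon> u * sign_word \<epsilon> v"
  by (simp add: sign_word_def)

lemma bij_betw_words_append: "bij_betw (\<lambda>(u, v). u @ v) (words k L \<times> words k L') (words k (L + L'))"
proof (rule bij_betwI[where g = "\<lambda>w. (take L w, drop L w)"])
  show "(\<lambda>w. (take L w, drop L w)) \<in> words k (L + L') \<rightarrow> words k L \<times> words k L'"
    by (auto simp: words_def dest: in_set_takeD in_set_dropD)
qed (auto simp: words_def)

lemma bij_betw_words_1: "bij_betw (\<lambda>l. [l]) {..<k} (words k 1)"
  by (rule bij_betwI[where g = hd]) (auto simp: words_def length_Suc_conv)

lemma sum_words_1: "(\<Sum>w\<in>words k 1. g w) = (\<Sum>l<k. g [l])"
  by (rule sum.reindex_bij_betw[OF bij_betw_words_1, symmetric])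

lemma sum_words_add: "(\<Sum>w\<in>words k (L + L'). g w) = (\<Sum>u\<in>words k L. \<Sum>v\<in>words k L'. g (u @ v))"
  by (simp add: sum.reindex_bij_betw[OF bij_betw_words_append, symmetric] sum.cartesian_product case_prod_beta)

lemma sum_sign_word: "(\<Sum>w\<in>words k L. sign_word \<epsilon> w) = (\<Sum>l<k. \<epsilon> l) ^ L"
proof (induction L)
  case 0
  have "words k 0 = {[]}" by (auto simp: words_def)
  then show ?case by (simp add: sign_word_def)
next
  case (Suc L)
  have "(\<Sum>w\<in>words k (1 + L). sign_word \<epsilon> w) = (\<Sum>u\<in>words k 1. sign_word \<epsilon> u) * (\<Sum>v\<in>words k L. sign_word \<epsilon> v)"
    unfolding sum_words_add sign_word_append sum_product ..
  also have "(\<Sum>u\<in>words k 1. sign_word \<epsilon> u) = (\<Sum>l<k. \<epsilon> l)"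
    unfolding sum_words_1 by (simp add: sign_word_def)
  finally show ?case using Suc by simp
qed

lemma sum_signs_prod:
  fixes g :: "nat \<Rightarrow> real \<Rightarrow> real"
  shows "(\<Sum>\<epsilon>\<in>signs k. \<Prod>l<k. g l (\<epsilon> l)) = (\<Prod>l<k. g l (-1) + g l 1)"
  unfolding signs_def by (subst prod_sum_PiE[symmetric]) auto

text \<open>The average of a product of independent signs is 1 if all multiplicities are even and 0 otherwise. Only its nonnegativity
  matters: it allows to replace the coefficients of a noncommutative polynomial by an upper bound for their norms.\<close>
lemma sum_signs_sign_word_nonneg:
  assumes "w \<in> words k L" shows "0 \<le> (\<Sum>\<epsilon>\<in>signs k. sign_word \<epsilon> w)"
proof -
  have eq: "sign_word \<epsilon> w = (\<Prod>l<k. \<epsilon> l ^ count_list w l)" for \<epsilon>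
    using assms
  proof (induction w arbitrary: L)
    case Nil
    then show ?case by (simp add: sign_word_def)
  next
    case (Cons a w)
    then have a: "a < k" and w: "w \<in> words k (length w)" by (auto simp: words_def)
    have "(\<Prod>l<k. \<epsilon> l ^ count_list (a # w) l) = (\<Prod>l<k. (if l = a then \<epsilon> a else 1) * \<epsilon> l ^ count_list w l)"
      by (rule prod.cong) auto
    also have "\<dots> = \<epsilon> a * (\<Prod>l<k. \<epsilon> l ^ count_list w l)" using a by (simp add: prod.distrib)
    finally show ?case using Cons.IH[OF w] by (simp add: sign_word_def)
  qed
  have "0 \<le> (\<Prod>l<k. (-1) ^ count_list w l + 1 ^ count_list w l :: real)"
  proof (rule prod_nonneg)
    fix l show "0 \<le> (-1) ^ count_list w l + (1 ^ count_list w l :: real)"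
      by (cases "even (count_list w l)") auto
  qed
  then show ?thesis unfolding eq by (simp only: sum_signs_prod[where k = k and g = "\<lambda>l e. e ^ count_list w l"])
qed

lemma even_power_le_exp: "(x::real) ^ (2 * q) / fact (2 * q) \<le> exp x + exp (- x)"
proof -
  have "\<bar>x\<bar> ^ (2 * q) / fact (2 * q) \<le> exp \<bar>x\<bar>"
  proof -
    have s: "(\<lambda>n. \<bar>x\<bar> ^ n / fact n) sums exp \<bar>x\<bar>"
      using exp_converges[of "\<bar>x\<bar>"] by (simp add: divide_inverse mult.commute)
    have "(\<Sum>n\<in>{2 * q}. \<bar>x\<bar> ^ n / fact n) \<le> (\<Sum>n. \<bar>x\<bar> ^ n / fact n)"
      using s by (intro sum_le_suminf) (auto simp: sums_iff)
    then show ?thesis using s by (simp add: sums_iff)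
  qed
  also have "exp \<bar>x\<bar> \<le> exp x + exp (- x)" by (cases "0 \<le> x") auto
  finally show ?thesis by (simp add: power_even_abs)
qed

lemma exp_plus_exp_minus_le:
  assumes "0 \<le> t" "t \<le> 1" shows "exp (- t) + exp t \<le> 2 * exp ((t::real)\<^sup>2)"
proof -
  have 1: "exp t \<le> 1 + t + t\<^sup>2" using assms by (intro exp_bound) auto
  have pos: "0 < 1 + t + t\<^sup>2 / 2" using assms by (simp add: add_pos_nonneg)
  have "exp (- t) \<le> 1 / (1 + t + t\<^sup>2 / 2)"
    unfolding exp_minus inverse_eq_divide
    using exp_lower_Taylor_quadratic[of t] assms pos by (intro divide_left_mono) auto
  also have "\<dots> \<le> 1 - t + t\<^sup>2"
  proof -
    have "1 \<le> (1 - t + t\<^sup>2) * (1 + t + t\<^sup>2 / 2)"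
    proof -
      have "(1 - t + t\<^sup>2) * (1 + t + t\<^sup>2 / 2) = 1 + (t\<^sup>2 / 2 + t ^ 3 / 2 + t ^ 4 / 2)"
        by (simp add: field_simps power2_eq_square power3_eq_cube power4_eq_xxxx)
      then show ?thesis using assms by simp
    qed
    then show ?thesis using pos by (simp only: pos_divide_le_eq)
  qed
  finally have "exp (- t) + exp t \<le> 2 * (1 + t\<^sup>2)" using 1 by simp
  also have "\<dots> \<le> 2 * exp (t\<^sup>2)" by (intro mult_left_mono exp_ge_add_one_self) simp
  finally show ?thesis .
qed

text \<open>The moment is estimated by the exponential moments at \<open>t\<close> and \<open>- t\<close>, with \<open>t = sqrt (2 q / k)\<close>;
  the condition \<open>2 q \<le> k\<close> keeps \<open>t\<close> at most 1, which is the range of \<open>exp_plus_exp_minus_le\<close>.\<close>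
lemma rademacher_moment:
  assumes q: "1 \<le> q" and k: "2 * q \<le> k"
  shows "(\<Sum>\<epsilon>\<in>signs k. (\<Sum>l<k. \<epsilon> l) ^ (2 * q)) \<le> 2 ^ k * (2 * (2 * real q * real k * exp 2) ^ q)"
proof -
  define t where "t = sqrt (2 * real q / real k)"
  have k0: "0 < real k" and q0: "0 < real q" using q k by auto
  have t2: "t\<^sup>2 = 2 * real q / real k" using k0 by (simp add: t_def)
  have t0: "0 < t" and t1: "t \<le> 1" using q0 k k0 by (auto simp: t_def real_le_lsqrt)
  have mgf: "(\<Sum>\<epsilon>\<in>signs k. exp (s * (\<Sum>l<k. \<epsilon> l))) = (exp (- s) + exp s) ^ k" for s :: real
    using sum_signs_prod[where k = k and g = "\<lambda>l e. exp (s * e)"] by (simp add: sum_distrib_left exp_sum)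
  have "(\<Sum>\<epsilon>\<in>signs k. (t * (\<Sum>l<k. \<epsilon> l)) ^ (2 * q) / fact (2 * q))
      \<le> (\<Sum>\<epsilon>\<in>signs k. exp (t * (\<Sum>l<k. \<epsilon> l)) + exp (- t * (\<Sum>l<k. \<epsilon> l)))"
    using even_power_le_exp[of "t * _" q] by (intro sum_mono) simp
  also have "\<dots> = 2 * (exp (- t) + exp t) ^ k"
    unfolding sum.distrib mgf by (simp add: add.commute)
  also have "\<dots> \<le> 2 * (2 * exp (t\<^sup>2)) ^ k"
    using exp_plus_exp_minus_le[of t] t0 t1 by (intro mult_left_mono power_mono) auto
  also have "\<dots> = 2 ^ k * (2 * exp (2 * real q))"
    using k0 by (simp add: power_mult_distrib exp_of_nat_mult[symmetric] t2)
  finally have "(t ^ (2 * q) / fact (2 * q)) * (\<Sum>\<epsilon>\<in>signs k. (\<Sum>l<k. \<epsilon> l) ^ (2 * q)) \<le> 2 ^ k * (2 * exp (2 * real q))"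
    unfolding power_mult_distrib times_divide_eq_left[symmetric] sum_distrib_left[symmetric] .
  then have "(\<Sum>\<epsilon>\<in>signs k. (\<Sum>l<k. \<epsilon> l) ^ (2 * q)) \<le> 2 ^ k * (2 * (exp (2 * real q) * (fact (2 * q) / t ^ (2 * q))))"
    using t0 by (simp add: field_simps)
  also have "\<dots> \<le> 2 ^ k * (2 * (2 * real q * real k * exp 2) ^ q)"
  proof -
    have "fact (2 * q) / t ^ (2 * q) \<le> (2 * real q) ^ (2 * q) / t ^ (2 * q)"
    proof -
      have "(fact (2 * q) :: real) \<le> real ((2 * q) ^ (2 * q))"
        by (rule fact_le_power)
      then show ?thesis using t0 by (intro divide_right_mono) auto
    qed
    also have "\<dots> = (2 * real q * real k) ^ q"
    proof -
      have "(2 * real q) ^ (2 * q) / t ^ (2 * q) = ((2 * real q)\<^sup>2 / t\<^sup>2) ^ q"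
        by (simp add: power_mult power_divide)
      also have "(2 * real q)\<^sup>2 / t\<^sup>2 = 2 * real q * real k"
        unfolding t2 using q0 k0 by (simp add: power2_eq_square field_simps)
      finally show ?thesis .
    qed
    finally have "exp (2 * real q) * (fact (2 * q) / t ^ (2 * q)) \<le> exp (2 * real q) * (2 * real q * real k) ^ q"
      by (rule mult_left_mono) simp
    moreover have "exp (2 * real q) = exp 2 ^ q" by (simp add: exp_of_nat_mult[symmetric] mult.commute)
    ultimately have "exp (2 * real q) * (fact (2 * q) / t ^ (2 * q)) \<le> (2 * real q * real k * exp 2) ^ q"
      by (simp only: power_mult_distrib mult.commute)
    then show ?thesis by (intro mult_left_mono) auto
  qed
  finally show ?thesis .
qed

context fd_cstar begin

text \<open>Noncommutative polynomials in random signs that are homogeneous of degree \<open>L\<close> and whose coefficients have norm at most \<open>C\<close>.\<close>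
definition chaos :: "nat \<Rightarrow> nat \<Rightarrow> real \<Rightarrow> ((nat \<Rightarrow> real) \<Rightarrow> nat \<Rightarrow> complex) \<Rightarrow> bool" where
  "chaos k L C F \<longleftrightarrow> (\<exists>T. (\<forall>w\<in>words k L. T w \<in> V \<and> nrm (T w) \<le> C) \<and>
     (\<forall>\<epsilon>. F \<epsilon> = (\<Sum>w\<in>words k L. complex_of_real (sign_word \<epsilon> w) *\<^sub>C T w)))"

lemma chaos_linear:
  assumes x: "\<And>l. l < k \<Longrightarrow> x l \<in> V" "\<And>l. l < k \<Longrightarrow> nrm (x l) \<le> R"
  shows "chaos k 1 R (\<lambda>\<epsilon>. \<Sum>l<k. complex_of_real (\<epsilon> l) *\<^sub>C x l)"
  unfolding chaos_def sum_words_1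
  by (rule exI[of _ "\<lambda>w. x (hd w)"]) (use x in \<open>auto simp: words_def length_Suc_conv sign_word_def\<close>)

lemma chaos_mul:
  assumes F: "chaos k L C F" and F': "chaos k L' C' F'" and C: "0 \<le> C"
  shows "chaos k (L + L') (C * C') (\<lambda>\<epsilon>. F \<epsilon> \<odot> F' \<epsilon>)"
proof -
  obtain T where T: "\<And>w. w \<in> words k L \<Longrightarrow> T w \<in> V" "\<And>w. w \<in> words k L \<Longrightarrow> nrm (T w) \<le> C"
    "\<And>\<epsilon>. F \<epsilon> = (\<Sum>w\<in>words k L. complex_of_real (sign_word \<epsilon> w) *\<^sub>C T w)"
    using F unfolding chaos_def by blast
  obtain T' where T': "\<And>w. w \<in> words k L' \<Longrightarrow> T' w \<in> V" "\<And>w. w \<in> words k L' \<Longrightarrow> nrm (T' w) \<le> C'"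
    "\<And>\<epsilon>. F' \<epsilon> = (\<Sum>w\<in>words k L'. complex_of_real (sign_word \<epsilon> w) *\<^sub>C T' w)"
    using F' unfolding chaos_def by blast
  define S where "S w = T (take L w) \<odot> T' (drop L w)" for w
  have "S w \<in> V \<and> nrm (S w) \<le> C * C'" if w: "w \<in> words k (L + L')" for w
  proof -
    have u: "take L w \<in> words k L" "drop L w \<in> words k L'"
      using w by (auto simp: words_def dest: in_set_takeD in_set_dropD)
    note V = T(1)[OF u(1)] T'(1)[OF u(2)]
    have "nrm (S w) \<le> nrm (T (take L w)) * nrm (T' (drop L w))" unfolding S_def by (rule nrm_mul[OF V])
    also have "\<dots> \<le> C * C'" using T(2)[OF u(1)] T'(2)[OF u(2)] nrm_nonneg V C by (intro mult_mono) auto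
    finally show ?thesis using V by (simp add: S_def mul_in)
  qed
  moreover have "F \<epsilon> \<odot> F' \<epsilon> = (\<Sum>w\<in>words k (L + L'). complex_of_real (sign_word \<epsilon> w) *\<^sub>C S w)" for \<epsilon>
  proof -
    have FV: "F' \<epsilon> \<in> V" unfolding T'(3) using T'(1) by (intro V_sum V_scale)
    have "F \<epsilon> \<odot> F' \<epsilon> = (\<Sum>u\<in>words k L. complex_of_real (sign_word \<epsilon> u) *\<^sub>C (T u \<odot> F' \<epsilon>))"
      unfolding T(3) by (rule mul_sum_left[OF FV T(1)])
    also have "\<dots> = (\<Sum>u\<in>words k L. \<Sum>v\<in>words k L'. complex_of_real (sign_word \<epsilon> (u @ v)) *\<^sub>C S (u @ v))"
    proof (rule sum.cong[OF refl])
      fix u assume u: "u \<in> words k L"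
      have "T u \<odot> F' \<epsilon> = (\<Sum>v\<in>words k L'. complex_of_real (sign_word \<epsilon> v) *\<^sub>C (T u \<odot> T' v))"
        unfolding T'(3) by (rule mul_sum_right[OF T(1)[OF u] T'(1)])
      moreover have "S (u @ v) = T u \<odot> T' v" for v using u by (simp add: S_def words_def)
      ultimately show "complex_of_real (sign_word \<epsilon> u) *\<^sub>C (T u \<odot> F' \<epsilon>) =
          (\<Sum>v\<in>words k L'. complex_of_real (sign_word \<epsilon> (u @ v)) *\<^sub>C S (u @ v))"
        by (simp only: complex_vector.scale_sum_right scaleC_scaleC sign_word_append of_real_mult)
    qed
    finally show ?thesis unfolding sum_words_add .
  qed
  ultimately show ?thesis unfolding chaos_def by blast
qed

text \<open>Expand the square of the modulus into pairs of words and use that the averages of sign words are nonnegative: the result is at most the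
  same moment with all coefficients replaced by \<open>C\<close>, that is, a moment of \<open>\<Sum> \<epsilon>\<^sub>l\<close>.\<close>
lemma chaos_functional_second_moment:
  assumes F: "chaos k L C F" and f: "clinear_on V f" "\<And>x. x \<in> V \<Longrightarrow> cmod (f x) \<le> nrm x"
  shows "(\<Sum>\<epsilon>\<in>signs k. (cmod (f (F \<epsilon>)))\<^sup>2) \<le> C\<^sup>2 * (\<Sum>\<epsilon>\<in>signs k. (\<Sum>l<k. \<epsilon> l) ^ (2 * L))"
proof -
  obtain T where T: "\<And>w. w \<in> words k L \<Longrightarrow> T w \<in> V" "\<And>w. w \<in> words k L \<Longrightarrow> nrm (T w) \<le> C"
    "\<And>\<epsilon>. F \<epsilon> = (\<Sum>w\<in>words k L. complex_of_real (sign_word \<epsilon> w) *\<^sub>C T w)"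
    using F unfolding chaos_def by blast
  define c where "c u v = Re (f (T u) * cnj (f (T v)))" for u v
  have c: "c u v \<le> C\<^sup>2" if "u \<in> words k L" "v \<in> words k L" for u v
  proof -
    have "c u v \<le> cmod (f (T u) * cnj (f (T v)))" unfolding c_def by (rule complex_Re_le_cmod)
    also have "\<dots> = cmod (f (T u)) * cmod (f (T v))" by (simp add: norm_mult)
    also have "\<dots> \<le> C * C"
      using that T f(2) by (intro mult_mono order_trans[OF f(2)]) (auto intro: order_trans[OF norm_ge_zero order_trans[OF f(2)]])
    finally show ?thesis by (simp add: power2_eq_square)
  qed
  have "(cmod (f (F \<epsilon>)))\<^sup>2 = (\<Sum>u\<in>words k L. \<Sum>v\<in>words k L. sign_word \<epsilon> (u @ v) * c u v)" for \<epsilon>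
  proof -
    have fF: "f (F \<epsilon>) = (\<Sum>u\<in>words k L. complex_of_real (sign_word \<epsilon> u) * f (T u))"
      unfolding T(3) using clinear_on_sum[OF f(1) subspace_V T(1)] by (simp add: scaleC_complex_def)
    have "complex_of_real ((cmod (f (F \<epsilon>)))\<^sup>2) = f (F \<epsilon>) * cnj (f (F \<epsilon>))"
      by (rule complex_norm_square)
    also have "\<dots> = (\<Sum>u\<in>words k L. \<Sum>v\<in>words k L.
        complex_of_real (sign_word \<epsilon> (u @ v)) * (f (T u) * cnj (f (T v))))"
      unfolding fF cnj_sum sum_product by (simp add: sign_word_append mult_ac)
    finally have "Re (complex_of_real ((cmod (f (F \<epsilon>)))\<^sup>2)) = Re \<dots>" by (rule arg_cong)
    moreover have "Re (complex_of_real r * y) = r * Re y" for r y by simp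
    ultimately show ?thesis by (simp only: Re_complex_of_real Re_sum c_def)
  qed
  then have "(\<Sum>\<epsilon>\<in>signs k. (cmod (f (F \<epsilon>)))\<^sup>2)
      = (\<Sum>u\<in>words k L. \<Sum>v\<in>words k L. (\<Sum>\<epsilon>\<in>signs k. sign_word \<epsilon> (u @ v)) * c u v)"
    by (simp add: sum_distrib_right sum.swap[of _ "signs k"])
  also have "\<dots> \<le> (\<Sum>u\<in>words k L. \<Sum>v\<in>words k L. (\<Sum>\<epsilon>\<in>signs k. sign_word \<epsilon> (u @ v)) * C\<^sup>2)"
  proof (intro sum_mono mult_left_mono c)
    fix u v assume "u \<in> words k L" "v \<in> words k L"
    then have "u @ v \<in> words k (L + L)" by (auto simp: words_def)
    then show "0 \<le> (\<Sum>\<epsilon>\<in>signs k. sign_word \<epsilon> (u @ v))" by (rule sum_signs_sign_word_nonneg)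
  qed
  also have "\<dots> = C\<^sup>2 * (\<Sum>\<epsilon>\<in>signs k. \<Sum>w\<in>words k (L + L). sign_word \<epsilon> w)"
    unfolding sum_words_add by (simp add: sum_distrib_left sum.swap[of _ "signs k"] mult.commute)
  also have "\<dots> = C\<^sup>2 * (\<Sum>\<epsilon>\<in>signs k. (\<Sum>l<k. \<epsilon> l) ^ (2 * L))"
    unfolding sum_sign_word by (simp add: mult_2)
  finally show ?thesis .
qed

text \<open>The power of exponent \<open>2 ^ j\<close>. Powers of two suffice, and for these the C*-identity
  gives the norm of a power of a self-adjoint element without spectral theory.\<close>
primrec iterated_square :: "nat \<Rightarrow> (nat \<Rightarrow> complex) \<Rightarrow> nat \<Rightarrow> complex" where
  "iterated_square 0 a = a"
| "iterated_square (Suc j) a = iterated_square j a \<odot> iterated_square j a"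

lemma iterated_square:
  assumes a: "a \<in> V" "adj a = a"
  shows "iterated_square j a \<in> V \<and> adj (iterated_square j a) = iterated_square j a \<and>
    nrm (iterated_square j a) = nrm a ^ 2 ^ j"
proof (induction j)
  case 0
  then show ?case using a by simp
next
  case (Suc j)
  then show ?case using nrm_adj_mul[of "iterated_square j a"]
    by (simp add: mul_in adj_mul power_mult[symmetric] mult.commute)
qed

lemma chaos_iterated_square:
  assumes "chaos k L C F" "0 \<le> C"
  shows "chaos k (L * 2 ^ j) (C ^ 2 ^ j) (\<lambda>\<epsilon>. iterated_square j (F \<epsilon>))"
proof (induction j)
  case 0
  then show ?case using assms by simp
next
  case (Suc j)
  then show ?case using chaos_mul[OF Suc Suc] assms(2)
    by (simp add: mult_2 distrib_left power_add)
qed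

text \<open>With \<open>z = \<Sum> \<epsilon>\<^sub>l x\<^sub>l\<close> and \<open>h\<close> the power of \<open>z\<^sup>*z\<close> of exponent \<open>2 ^ j\<close>, one has \<open>\<parallel>z\<parallel>\<^sup>q = \<parallel>h\<parallel>\<close>, and
  \<open>\<parallel>h\<parallel>\<close> is at most the sum of \<open>D = rank\<^sup>2\<close> coordinate functionals at \<open>h\<close>, whose second moments are known. The
  factor \<open>2 D\<^sup>2\<close> that is lost becomes harmless after taking a root of order \<open>2 q\<close>, because \<open>q\<close> is at least of the order of \<open>log D\<close>.\<close>
lemma signs_exist:
  assumes x: "\<And>l. l < k \<Longrightarrow> x l \<in> V" "\<And>l. l < k \<Longrightarrow> nrm (x l) \<le> R" and R: "0 \<le> R"
    and q: "q = 2 * 2 ^ j" and rank: "2 * real (B_rank B) ^ 4 \<le> exp (2 * real q)" and k: "2 * q \<le> k"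
  obtains \<epsilon> where "\<epsilon> \<in> signs k"
    "nrm (\<Sum>l<k. complex_of_real (\<epsilon> l) *\<^sub>C x l) \<le> exp 2 * sqrt 2 * R * sqrt (real q * real k)"
proof -
  define z where "z \<epsilon> = (\<Sum>l<k. complex_of_real (\<epsilon> l) *\<^sub>C x l)" for \<epsilon> :: "nat \<Rightarrow> real"
  have zV: "z \<epsilon> \<in> V" for \<epsilon> unfolding z_def using x by (intro V_sum V_scale) auto
  have adjz: "adj (z \<epsilon>) = (\<Sum>l<k. complex_of_real (\<epsilon> l) *\<^sub>C adj (x l))" for \<epsilon>
    unfolding z_def using x by (subst adj_sum) (auto simp: V_scale adj_scale intro!: sum.cong)
  have "chaos k (1 + 1) (R * R) (\<lambda>\<epsilon>. adj (z \<epsilon>) \<odot> z \<epsilon>)"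
    unfolding adjz unfolding z_def using x R
    by (intro chaos_mul chaos_linear) (auto simp: adj_in nrm_adj)
  then have "chaos k 2 (R * R) (\<lambda>\<epsilon>. adj (z \<epsilon>) \<odot> z \<epsilon>)" by (simp add: numeral_2_eq_2)
  then have chaos: "chaos k q (R ^ q) (\<lambda>\<epsilon>. iterated_square j (adj (z \<epsilon>) \<odot> z \<epsilon>))"
    using chaos_iterated_square[of k 2 "R * R" _ j] R
    by (simp add: q power_mult power2_eq_square)
  define h where "h \<epsilon> = iterated_square j (adj (z \<epsilon>) \<odot> z \<epsilon>)" for \<epsilon>
  have hV: "h \<epsilon> \<in> V" and nrm_h: "nrm (h \<epsilon>) = nrm (z \<epsilon>) ^ q" for \<epsilon>
    using iterated_square[of "adj (z \<epsilon>) \<odot> z \<epsilon>" j] zV[of \<epsilon>]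
    by (simp_all add: h_def mul_in adj_in adj_mul adj_adj nrm_adj_mul q power_mult)
  obtain I :: "((nat \<Rightarrow> complex) \<times> (nat \<Rightarrow> complex)) set" and f where I: "finite I" "card I = (B_rank B)\<^sup>2"
    and f: "\<And>i. i \<in> I \<Longrightarrow> clinear_on V (f i :: _ \<Rightarrow> complex)"
      "\<And>i x. i \<in> I \<Longrightarrow> x \<in> V \<Longrightarrow> cmod (f i x) \<le> nrm x"
      "\<And>x. x \<in> V \<Longrightarrow> nrm x \<le> (\<Sum>i\<in>I. cmod (f i x))" using coordinate_functionals by blast
  define D where "D = real (card I)"
  define M where "M = (2 * real q * real k * exp 2) ^ q"
  have q1: "1 \<le> q" by (simp add: q)
  have DM: "(\<Sum>\<epsilon>\<in>signs k. nrm (z \<epsilon>) ^ (2 * q)) \<le> 2 ^ k * (2 * D\<^sup>2 * (R ^ q)\<^sup>2 * M)"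
  proof -
    have "nrm (z \<epsilon>) ^ (2 * q) \<le> D * (\<Sum>i\<in>I. (cmod (f i (h \<epsilon>)))\<^sup>2)" for \<epsilon>
    proof -
      have "nrm (z \<epsilon>) ^ (2 * q) = (nrm (h \<epsilon>))\<^sup>2" by (simp add: nrm_h power_mult[symmetric] mult.commute)
      also have "\<dots> \<le> (\<Sum>i\<in>I. cmod (f i (h \<epsilon>)))\<^sup>2"
        using f(3)[OF hV] nrm_nonneg[OF hV] by (intro power_mono)
      also have "\<dots> \<le> D * (\<Sum>i\<in>I. (cmod (f i (h \<epsilon>)))\<^sup>2)"
        unfolding D_def by (subst mult.commute) (rule sum_squared_le_sum_of_squares)
      finally show ?thesis .
    qed
    then have "(\<Sum>\<epsilon>\<in>signs k. nrm (z \<epsilon>) ^ (2 * q)) \<le> (\<Sum>\<epsilon>\<in>signs k. D * (\<Sum>i\<in>I. (cmod (f i (h \<epsilon>)))\<^sup>2))"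
      by (intro sum_mono)
    also have "\<dots> = D * (\<Sum>i\<in>I. \<Sum>\<epsilon>\<in>signs k. (cmod (f i (h \<epsilon>)))\<^sup>2)"
      by (simp add: sum_distrib_left sum.swap[of _ I])
    also have "\<dots> \<le> D * (\<Sum>i\<in>I. (R ^ q)\<^sup>2 * (2 ^ k * (2 * M)))"
    proof (intro mult_left_mono sum_mono)
      fix i assume i: "i \<in> I"
      have "(\<Sum>\<epsilon>\<in>signs k. (cmod (f i (h \<epsilon>)))\<^sup>2) \<le> (R ^ q)\<^sup>2 * (\<Sum>\<epsilon>\<in>signs k. (\<Sum>l<k. \<epsilon> l) ^ (2 * q))"
        unfolding h_def by (rule chaos_functional_second_moment[OF chaos f(1)[OF i] f(2)[OF i]])
      also have "\<dots> \<le> (R ^ q)\<^sup>2 * (2 ^ k * (2 * M))"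
        unfolding M_def by (intro mult_left_mono rademacher_moment q1 k) simp
      finally show "(\<Sum>\<epsilon>\<in>signs k. (cmod (f i (h \<epsilon>)))\<^sup>2) \<le> (R ^ q)\<^sup>2 * (2 ^ k * (2 * M))" .
    qed (simp add: D_def)
    finally show ?thesis by (simp add: D_def[symmetric] power2_eq_square mult_ac)
  qed
  have "\<exists>\<epsilon>\<in>signs k. nrm (z \<epsilon>) ^ (2 * q) \<le> 2 * D\<^sup>2 * (R ^ q)\<^sup>2 * M"
  proof (rule ccontr)
    assume "\<not> ?thesis"
    then have "(\<Sum>\<epsilon>\<in>signs k. 2 * D\<^sup>2 * (R ^ q)\<^sup>2 * M) < (\<Sum>\<epsilon>\<in>signs k. nrm (z \<epsilon>) ^ (2 * q))"
      using card_signs[of k] by (intro sum_strict_mono finite_signs) (auto simp: not_le)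
    then show False using DM by (simp add: card_signs)
  qed
  then obtain \<epsilon> where \<epsilon>: "\<epsilon> \<in> signs k" "nrm (z \<epsilon>) ^ (2 * q) \<le> 2 * D\<^sup>2 * (R ^ q)\<^sup>2 * M" by blast
  define b where "b = exp 2 * sqrt 2 * R * sqrt (real q * real k)"
  have b0: "0 \<le> b" using R by (simp add: b_def)
  have "2 * D\<^sup>2 \<le> exp (2 * real q)" using rank by (simp add: D_def I(2) power_mult[symmetric])
  then have "2 * D\<^sup>2 * (R ^ q)\<^sup>2 * M \<le> exp (2 * real q) * (R ^ q)\<^sup>2 * M"
    by (intro mult_right_mono) (auto simp: M_def)
  also have "\<dots> = b ^ (2 * q)"
  proof -
    have "exp (2 * real q) = exp 2 ^ q" by (simp add: exp_of_nat_mult[symmetric] mult.commute)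
    moreover have "b\<^sup>2 = exp 2 * R\<^sup>2 * (2 * real q * real k * exp 2)"
      unfolding b_def power_mult_distrib by (simp add: power2_eq_square[of "exp 2"])
    ultimately show ?thesis
      by (simp add: M_def power_mult power_mult_distrib power2_eq_square)
  qed
  finally have "nrm (z \<epsilon>) ^ (2 * q) \<le> b ^ (2 * q)" using \<epsilon>(2) by simp
  then have "nrm (z \<epsilon>) \<le> b"
    using power_mono_iff[OF nrm_nonneg[OF zV] b0, of "2 * q" \<epsilon>] q1 by simp
  then show thesis using that \<epsilon>(1) by (simp add: z_def b_def)
qed

end

section \<open>Averages of few vectors\<close>

definition mean :: "nat \<Rightarrow> (nat \<Rightarrow> 'a::complex_vector) \<Rightarrow> 'a" where
  "mean k v = complex_of_real (1 / real k) *\<^sub>C (\<Sum>l<k. v l)"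

lemma clinear_on_mean:
  assumes "clinear_on UNIV f" shows "f (mean k v) = mean k (\<lambda>l. f (v l))"
  using clinear_on_sum[OF assms complex_vector.subspace_UNIV, of "{..<k}" v "\<lambda>_. 1"]
  by (simp add: mean_def clinear_onD[OF assms] scaleC_one)

lemma norm_mean_le:
  fixes v :: "nat \<Rightarrow> 'a::complex_banach"
  assumes "\<And>l. l < k \<Longrightarrow> norm (v l) \<le> b" "0 \<le> b" shows "norm (mean k v) \<le> b"
proof -
  have "norm (\<Sum>l<k. v l) \<le> (\<Sum>l<k. b)" using assms by (intro sum_norm_le) auto
  then show ?thesis using assms(2) by (cases "k = 0") (auto simp: mean_def norm_scaleC norm_divide field_simps)
qed

lemma sum_lessThan_double: "(\<Sum>l<2 * k. x l) = (\<Sum>l<k. x (2 * l) + x (2 * l + 1))" for k :: nat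
  by (induction k) (auto simp: add.assoc)

context fd_cstar begin

lemma mean_in: "(\<And>l. l < k \<Longrightarrow> x l \<in> V) \<Longrightarrow> mean k x \<in> V"
  unfolding mean_def by (intro V_scale V_sum) auto

text \<open>From each pair of consecutive terms keep one: the error is a signed sum of the differences within the pairs, and the signs may be chosen well.\<close>
lemma halving:
  assumes x: "\<And>l. l < 2 * k \<Longrightarrow> x l \<in> V" "\<And>l. l < 2 * k \<Longrightarrow> nrm (x l) \<le> R" and R: "0 \<le> R"
    and q: "q = 2 * 2 ^ j" and rank: "2 * real (B_rank B) ^ 4 \<le> exp (2 * real q)" and k: "2 * q \<le> k"
  obtains g where "\<And>l. l < k \<Longrightarrow> g l < 2 * k"
    "nrm (mean (2 * k) x - mean k (\<lambda>l. x (g l))) \<le> exp 2 * sqrt 2 * R * sqrt (real q / real k)"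
proof -
  have "1 \<le> q" by (simp add: q)
  then have k0: "0 < k" using k by linarith
  define y where "y l = x (2 * l) - x (2 * l + 1)" for l
  have yV: "y l \<in> V" "nrm (y l) \<le> 2 * R" if "l < k" for l
  proof -
    have V: "x (2 * l) \<in> V" "- x (2 * l + 1) \<in> V"
      using that x(1) complex_vector.subspace_neg[OF subspace_V] by auto
    then show "y l \<in> V" using V_add[OF V] by (simp add: y_def)
    have "nrm (x (2 * l) + - x (2 * l + 1)) \<le> nrm (x (2 * l)) + nrm (- x (2 * l + 1))" by (rule nrm_add[OF V])
    also have "\<dots> \<le> R + R" using x that by (intro add_mono) (auto simp: nrm_minus)
    finally show "nrm (y l) \<le> 2 * R" by (simp add: y_def)
  qed
  have R2: "0 \<le> 2 * R" using R by simp
  obtain \<epsilon> where \<epsilon>: "\<epsilon> \<in> signs k"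
    "nrm (\<Sum>l<k. complex_of_real (\<epsilon> l) *\<^sub>C y l) \<le> exp 2 * sqrt 2 * (2 * R) * sqrt (real q * real k)"
    by (rule signs_exist[OF yV R2 q rank k])
  define g where "g l = (if \<epsilon> l = 1 then 2 * l + 1 else 2 * l)" for l
  have g: "g l < 2 * k" if "l < k" for l using that by (auto simp: g_def)
  have "mean (2 * k) x - mean k (\<lambda>l. x (g l))
      = complex_of_real (1 / real (2 * k)) *\<^sub>C ((\<Sum>l<2 * k. x l) - 2 *\<^sub>C (\<Sum>l<k. x (g l)))"
    using k0 by (simp add: mean_def complex_vector.scale_right_diff_distrib scaleC_scaleC)
  also have "(\<Sum>l<2 * k. x l) - 2 *\<^sub>C (\<Sum>l<k. x (g l)) = (\<Sum>l<k. x (2 * l) + x (2 * l + 1) - 2 *\<^sub>C x (g l))"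
    unfolding sum_lessThan_double complex_vector.scale_sum_right sum_subtractf ..
  also have "\<dots> = (\<Sum>l<k. complex_of_real (\<epsilon> l) *\<^sub>C y l)"
  proof (rule sum.cong[OF refl])
    fix l assume "l \<in> {..<k}"
    then have "\<epsilon> l \<in> {-1, 1}" using \<epsilon>(1) by (auto simp: signs_def PiE_def Pi_def)
    moreover have two: "2 *\<^sub>C v = v + v" for v :: "nat \<Rightarrow> complex"
      using scaleC_add_left[of 1 1 v] by (simp add: scaleC_one)
    ultimately show "x (2 * l) + x (2 * l + 1) - 2 *\<^sub>C x (g l) = complex_of_real (\<epsilon> l) *\<^sub>C y l"
      unfolding two by (auto simp only: g_def y_def insert_iff empty_iff) (auto simp: fun_eq_iff scaleC_fun_def scaleC_complex_def)
  qed
  finally have eq: "mean (2 * k) x - mean k (\<lambda>l. x (g l)) =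
    complex_of_real (1 / real (2 * k)) *\<^sub>C (\<Sum>l<k. complex_of_real (\<epsilon> l) *\<^sub>C y l)" .
  have "nrm (mean (2 * k) x - mean k (\<lambda>l. x (g l)))
      = (1 / real (2 * k)) * nrm (\<Sum>l<k. complex_of_real (\<epsilon> l) *\<^sub>C y l)"
    unfolding eq using yV(1) by (subst nrm_scale) (auto intro!: V_sum V_scale simp: norm_divide norm_mult)
  also have "\<dots> \<le> (1 / real (2 * k)) * (exp 2 * sqrt 2 * (2 * R) * sqrt (real q * real k))"
    by (rule mult_left_mono[OF \<epsilon>(2)]) simp
  also have "\<dots> = exp 2 * sqrt 2 * R * (sqrt (real q * real k) / real k)" by simp
  also have "sqrt (real q * real k) / real k = sqrt (real q / real k)"
    using k0 by (simp add: real_sqrt_mult real_sqrt_divide field_simps)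
  finally show thesis using that g by blast
qed

text \<open>The errors of the successive halvings form a geometric series with ratio \<open>sqrt (1/2)\<close>, dominated by the last step.\<close>
lemma sparsification:
  assumes x: "\<And>l. l < 2 ^ s * k \<Longrightarrow> x l \<in> V" "\<And>l. l < 2 ^ s * k \<Longrightarrow> nrm (x l) \<le> R" and R: "0 \<le> R"
    and q: "q = 2 * 2 ^ j" and rank: "2 * real (B_rank B) ^ 4 \<le> exp (2 * real q)" and k: "2 * q \<le> k"
  shows "\<exists>g. (\<forall>l<k. g l < 2 ^ s * k) \<and> nrm (mean (2 ^ s * k) x - mean k (\<lambda>l. x (g l)))
    \<le> exp 2 * sqrt 2 * R * sqrt (real q / real k) * (4 - 4 * sqrt (1 / 2) ^ s)"
  using x
proof (induction s arbitrary: x)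
  case 0
  have "nrm (mean (2 ^ 0 * k) x - mean k (\<lambda>l. x l)) = 0" by (simp only: power_0 mult_1 diff_self nrm_0)
  then show ?case
    by (intro exI[of _ "\<lambda>l. l"]) (simp only: power_0 mult_1 mult_1_right diff_self mult_zero_right order_refl simp_thms)
next
  case (Suc s)
  define A where "A = exp 2 * sqrt 2 * R * sqrt (real q / real k)"
  have A0: "0 \<le> A" using R by (simp add: A_def)
  have K: "2 ^ Suc s * k = 2 * (2 ^ s * k)" by simp
  have "1 * k \<le> 2 ^ s * k" by (rule mult_right_mono) auto
  then have k': "2 * q \<le> 2 ^ s * k" using k by linarith
  obtain g where g: "\<And>l. l < 2 ^ s * k \<Longrightarrow> g l < 2 * (2 ^ s * k)"
    and err: "nrm (mean (2 * (2 ^ s * k)) x - mean (2 ^ s * k) (\<lambda>l. x (g l)))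
      \<le> exp 2 * sqrt 2 * R * sqrt (real q / real (2 ^ s * k))"
    by (rule halving[OF _ _ R q rank k', of x]) (use Suc.prems K in auto)
  have xg: "x (g l) \<in> V" "nrm (x (g l)) \<le> R" if "l < 2 ^ s * k" for l
    using g[OF that] Suc.prems unfolding K by auto
  obtain g' where g': "\<And>l. l < k \<Longrightarrow> g' l < 2 ^ s * k"
    "nrm (mean (2 ^ s * k) (\<lambda>l. x (g l)) - mean k (\<lambda>l. x (g (g' l)))) \<le> A * (4 - 4 * sqrt (1 / 2) ^ s)"
    using Suc.IH[of "\<lambda>l. x (g l)", OF xg] unfolding A_def by blast
  have r: "sqrt (real q / real (2 ^ s * k)) = sqrt (real q / real k) * sqrt (1 / 2) ^ s"
    by (simp add: real_sqrt_mult real_sqrt_divide real_sqrt_power power_divide)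
  have V: "mean (2 * (2 ^ s * k)) x \<in> V" "mean (2 ^ s * k) (\<lambda>l. x (g l)) \<in> V" "mean k (\<lambda>l. x (g (g' l))) \<in> V"
    using Suc.prems(1) xg g'(1) unfolding K by (auto intro!: mean_in)
  have "nrm (mean (2 * (2 ^ s * k)) x - mean k (\<lambda>l. x (g (g' l))))
      \<le> nrm (mean (2 * (2 ^ s * k)) x - mean (2 ^ s * k) (\<lambda>l. x (g l)))
       + nrm (mean (2 ^ s * k) (\<lambda>l. x (g l)) - mean k (\<lambda>l. x (g (g' l))))"
    using nrm_add[OF V_diff[OF V(1,2)] V_diff[OF V(2,3)]] by simp
  also have "\<dots> \<le> A * sqrt (1 / 2) ^ s + A * (4 - 4 * sqrt (1 / 2) ^ s)"
    using err g'(2) unfolding r A_def by (intro add_mono) (simp_all add: mult.assoc)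
  also have "\<dots> = A * (4 - 3 * sqrt (1 / 2) ^ s)" by (simp add: algebra_simps)
  also have "\<dots> \<le> A * (4 - 4 * sqrt (1 / 2) ^ Suc s)"
  proof (intro mult_left_mono A0 diff_left_mono)
    \<comment> \<open>With \<open>r = sqrt (1/2)\<close>, the gain from \<open>4 - 4 r ^ s\<close> to \<open>4 - 4 r ^ Suc s\<close> covers the new error \<open>r ^ s\<close> because \<open>4 r \<le> 3\<close>.\<close>
    have "sqrt (1 / 2) \<le> 3 / 4" by (rule real_le_lsqrt) (auto simp: power2_eq_square)
    then have "4 * sqrt (1 / 2) * sqrt (1 / 2) ^ s \<le> 3 * sqrt (1 / 2) ^ s" by (intro mult_right_mono) auto
    then show "4 * sqrt (1 / 2) ^ Suc s \<le> 3 * sqrt (1 / 2) ^ s" by simp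
  qed
  finally have close: "nrm (mean (2 * (2 ^ s * k)) x - mean k (\<lambda>l. x (g (g' l)))) \<le> A * (4 - 4 * sqrt (1 / 2) ^ Suc s)" .
  have "\<forall>l<k. g (g' l) < 2 * (2 ^ s * k)" using g g'(1) by blast
  from conjI[OF this close] show ?case unfolding K A_def[symmetric] by (rule exI[of _ "\<lambda>l. g (g' l)"])
qed

end

lemma sequence_with_multiplicities:
  fixes val :: "'a \<Rightarrow> 'b::complex_vector"
  assumes "finite A" "(\<Sum>a\<in>A. n a) \<le> K"
  shows "\<exists>v. (\<forall>l<K. v l \<in> insert 0 (val ` A)) \<and> (\<Sum>l<K. v l) = (\<Sum>a\<in>A. of_nat (n a) *\<^sub>C val a)"
  using assms
proof (induction A arbitrary: K)
  case empty
  show ?case by (rule exI[of _ "\<lambda>_. 0"]) simp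
next
  case (insert a A)
  define K' where "K' = K - n a"
  have K: "K = K' + n a" and le: "(\<Sum>a\<in>A. n a) \<le> K'" using insert by (auto simp: K'_def)
  obtain v where v: "\<And>l. l < K' \<Longrightarrow> v l \<in> insert 0 (val ` A)" "(\<Sum>l<K'. v l) = (\<Sum>a\<in>A. of_nat (n a) *\<^sub>C val a)"
    using insert.IH[OF le] by blast
  define v' where "v' l = (if l < K' then v l else val a)" for l
  have "(\<Sum>l<K' + m. v' l) = (\<Sum>l<K'. v l) + of_nat m *\<^sub>C val a" for m
    by (induction m) (auto simp: v'_def add.assoc scaleC_add_left scaleC_one add.commute)
  then have "(\<Sum>l<K. v' l) = (\<Sum>a\<in>insert a A. of_nat (n a) *\<^sub>C val a)"
    unfolding K sum.insert[OF insert.hyps] v(2) by (metis add.commute)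
  moreover have "v' l \<in> insert 0 (val ` insert a A)" for l
    using v(1) by (auto simp: v'_def)
  ultimately show ?case by (intro exI[of _ v']) blast
qed

text \<open>Every complex coefficient is a combination of the four phases with nonnegative weights \<open>Re\<^sup>+, Re\<^sup>-, Im\<^sup>+, Im\<^sup>-\<close> of total at
  most twice its modulus. The factor 2 makes the weights add up to at most 1, and the vector 0 fills up the remaining weight.\<close>
definition phases :: "'a::complex_vector set \<Rightarrow> 'a set" where
  "phases \<Omega> = insert 0 ((\<lambda>(x, u). (2 * u) *\<^sub>C x) ` (\<Omega> \<times> {1, -1, \<i>, -\<i>}))"

lemma finite_phases: "finite \<Omega> \<Longrightarrow> finite (phases \<Omega>)"
  by (simp add: phases_def)

lemma card_phases_le: "finite \<Omega> \<Longrightarrow> card (phases \<Omega>) \<le> 4 * card \<Omega> + 1"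
proof -
  assume \<Omega>: "finite \<Omega>"
  let ?U = "{1, -1, \<i>, -\<i>} :: complex set"
  have "card ?U \<le> 4" using card_length[of "[1, -1, \<i>, -\<i>]"] by simp
  then have "card (\<Omega> \<times> ?U) \<le> 4 * card \<Omega>" by (simp add: card_cartesian_product mult.commute)
  then have "card ((\<lambda>(x, u). (2 * u) *\<^sub>C x) ` (\<Omega> \<times> ?U)) \<le> 4 * card \<Omega>"
    using card_image_le[of "\<Omega> \<times> ?U" "\<lambda>(x, u). (2 * u) *\<^sub>C x"] \<Omega> by (meson finite.emptyI finite_SigmaI finite_insert order_trans)
  moreover have "card (phases \<Omega>) \<le> Suc (card ((\<lambda>(x, u). (2 * u) *\<^sub>C x) ` (\<Omega> \<times> ?U)))"
    unfolding phases_def by (rule card_insert_le_m1) auto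
  ultimately show ?thesis by linarith
qed

lemma phasesE:
  assumes "w \<in> phases \<Omega>"
  obtains "w = 0" | x u where "x \<in> \<Omega>" "cmod u = 1" "w = (2 * u) *\<^sub>C x"
proof (cases "w = 0")
  case False
  then have "w \<in> (\<lambda>(x, u). (2 * u) *\<^sub>C x) ` (\<Omega> \<times> {1, -1, \<i>, -\<i>})"
    using assms by (simp only: phases_def insert_iff simp_thms)
  then obtain x u where xu: "(x, u) \<in> \<Omega> \<times> {1, -1, \<i>, -\<i>}" "w = (2 * u) *\<^sub>C x" by (auto simp only: split: prod.splits)
  then have "cmod u = 1" by auto
  with xu show thesis by (intro that(2)[of x u]) auto
qed (rule that(1))

text \<open>Round the weights down to multiples of \<open>1 / K\<close> with \<open>K = 2 ^ s * k\<close> large. The total length has this form so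
  that it can be halved \<open>s\<close> times.\<close>
lemma l1_combination_near_mean:
  fixes \<Omega> :: "'x::complex_banach set"
  assumes \<Omega>: "finite \<Omega>" "\<And>x. x \<in> \<Omega> \<Longrightarrow> norm x \<le> R" and c: "(\<Sum>x\<in>\<Omega>. cmod (c x)) \<le> 1"
    and \<epsilon>: "0 < \<epsilon>" and k: "0 < k"
  obtains s v where "\<And>l. l < 2 ^ s * k \<Longrightarrow> v l \<in> phases \<Omega>"
    "norm ((\<Sum>x\<in>\<Omega>. c x *\<^sub>C x) - mean (2 ^ s * k) v) \<le> \<epsilon>"
proof -
  define U :: "complex set" where "U = {1, -1, \<i>, -\<i>}"
  define A where "A = \<Omega> \<times> U"
  define val where "val a = (2 * snd a) *\<^sub>C fst a" for a :: "'x \<times> complex"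
  define wt where "wt a = max 0 (Re (cnj (snd a) * c (fst a))) / 2" for a
  have U: "finite U" by (simp add: U_def)
  have A: "finite A" using \<Omega>(1) U by (simp add: A_def)
  have sumU: "(\<Sum>u\<in>U. f u) = f 1 + f (-1) + f \<i> + f (-\<i>)" for f :: "complex \<Rightarrow> 'b::comm_monoid_add"
    unfolding U_def by (simp add: complex_eq_iff add.assoc)
  have wt0: "0 \<le> wt a" for a by (simp add: wt_def)
  have "(\<Sum>a\<in>A. wt a) = (\<Sum>x\<in>\<Omega>. \<Sum>u\<in>U. wt (x, u))" by (simp add: A_def sum.cartesian_product)
  also have "\<dots> = (\<Sum>x\<in>\<Omega>. (\<bar>Re (c x)\<bar> + \<bar>Im (c x)\<bar>) / 2)"
    unfolding sumU by (rule sum.cong) (auto simp: wt_def max_def)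
  also have "\<dots> \<le> (\<Sum>x\<in>\<Omega>. cmod (c x))"
  proof (rule sum_mono)
    fix x show "(\<bar>Re (c x)\<bar> + \<bar>Im (c x)\<bar>) / 2 \<le> cmod (c x)"
      using abs_Re_le_cmod[of "c x"] abs_Im_le_cmod[of "c x"] by simp
  qed
  finally have wt1: "(\<Sum>a\<in>A. wt a) \<le> 1" using c by simp
  have "(\<Sum>a\<in>A. complex_of_real (wt a) *\<^sub>C val a) = (\<Sum>x\<in>\<Omega>. \<Sum>u\<in>U. complex_of_real (wt (x, u)) *\<^sub>C val (x, u))"
    by (simp add: A_def sum.cartesian_product case_prod_beta)
  also have "\<dots> = (\<Sum>x\<in>\<Omega>. (\<Sum>u\<in>U. complex_of_real (wt (x, u)) * (2 * u)) *\<^sub>C x)"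
    by (simp add: val_def scaleC_scaleC complex_vector.scale_sum_left)
  also have "\<dots> = (\<Sum>x\<in>\<Omega>. c x *\<^sub>C x)"
  proof (rule sum.cong[OF refl])
    fix x
    have "(\<Sum>u\<in>U. complex_of_real (wt (x, u)) * (2 * u)) = c x"
      unfolding sumU by (auto simp: wt_def max_def complex_eq_iff)
    then show "(\<Sum>u\<in>U. complex_of_real (wt (x, u)) * (2 * u)) *\<^sub>C x = c x *\<^sub>C x" by simp
  qed
  finally have comb: "(\<Sum>a\<in>A. complex_of_real (wt a) *\<^sub>C val a) = (\<Sum>x\<in>\<Omega>. c x *\<^sub>C x)" .
  define b where "b = real (card A) * (2 * \<bar>R\<bar>) / \<epsilon>"
  obtain s where s: "b < 2 ^ s" using real_arch_pow[of 2 b] by auto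
  define K where "K = 2 ^ s * k"
  have K0: "0 < K" using k by (simp add: K_def)
  have "2 ^ s \<le> real K" using k by (simp add: K_def)
  then have bK: "b \<le> real K" using s by linarith
  define n where "n a = nat \<lfloor>wt a * real K\<rfloor>" for a
  have n: "real (n a) \<le> wt a * real K" "wt a * real K - 1 \<le> real (n a)" for a
    using wt0[of a] unfolding n_def by (simp, linarith)
  have "real (\<Sum>a\<in>A. n a) \<le> (\<Sum>a\<in>A. wt a * real K)" using n(1) by (simp add: sum_mono)
  also have "\<dots> = (\<Sum>a\<in>A. wt a) * real K" by (simp add: sum_distrib_right)
  also have "\<dots> \<le> real K" using mult_right_mono[OF wt1, of "real K"] by simp
  finally have "(\<Sum>a\<in>A. n a) \<le> K" by linarith
  then obtain v where v: "\<And>l. l < K \<Longrightarrow> v l \<in> insert 0 (val ` A)" "(\<Sum>l<K. v l) = (\<Sum>a\<in>A. of_nat (n a) *\<^sub>C val a)"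
    using sequence_with_multiplicities[OF A, of n K val] by blast
  have "val ` A = (\<lambda>(x, u). (2 * u) *\<^sub>C x) ` (\<Omega> \<times> {1, -1, \<i>, -\<i>})"
    by (simp add: val_def[abs_def] A_def U_def case_prod_beta)
  then have vW: "v l \<in> phases \<Omega>" if "l < K" for l using v(1)[OF that] by (simp add: phases_def)
  have "mean K v = (\<Sum>a\<in>A. complex_of_real (real (n a) / real K) *\<^sub>C val a)"
    unfolding mean_def v(2) complex_vector.scale_sum_right scaleC_scaleC by simp
  then have "(\<Sum>x\<in>\<Omega>. c x *\<^sub>C x) - mean K v = (\<Sum>a\<in>A. complex_of_real (wt a - real (n a) / real K) *\<^sub>C val a)"
    by (simp add: comb[symmetric] sum_subtractf complex_vector.scale_left_diff_distrib)
  also have "norm \<dots> \<le> (\<Sum>a\<in>A. 1 / real K * (2 * \<bar>R\<bar>))"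
  proof (rule sum_norm_le)
    fix a assume a: "a \<in> A"
    have "cmod (snd a) = 1" using a by (auto simp: A_def U_def)
    moreover have "norm (fst a) \<le> \<bar>R\<bar>" using a \<Omega>(2)[of "fst a"] by (auto simp: A_def)
    ultimately have 1: "norm (val a) \<le> 2 * \<bar>R\<bar>" by (simp add: val_def norm_scaleC norm_mult)
    have "\<bar>wt a - real (n a) / real K\<bar> \<le> 1 / real K"
    proof -
      have "wt a - real (n a) / real K = (wt a * real K - real (n a)) / real K" using K0 by (simp add: field_simps)
      moreover have "\<bar>wt a * real K - real (n a)\<bar> \<le> 1" using n[of a] by (simp add: abs_le_iff)
      ultimately show ?thesis by (simp add: divide_right_mono)
    qed
    then show "norm (complex_of_real (wt a - real (n a) / real K) *\<^sub>C val a) \<le> 1 / real K * (2 * \<bar>R\<bar>)"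
      unfolding norm_scaleC norm_of_real using 1 by (intro mult_mono) auto
  qed
  also have "\<dots> = b * \<epsilon> / real K" using \<epsilon> by (simp add: b_def)
  also have "\<dots> \<le> \<epsilon>" using bK \<epsilon> K0 by (simp add: field_simps)
  finally show thesis using that vW unfolding K_def by blast
qed

definition means :: "nat \<Rightarrow> 'a::complex_vector set \<Rightarrow> 'a set" where
  "means k W = {mean k v | v. \<forall>l<k. v l \<in> W}"

text \<open>A mean depends only on how often each element of \<open>W\<close> occurs.\<close>
lemma means_finite_card:
  fixes W :: "'a::complex_vector set"
  assumes W: "finite W" "W \<noteq> {}"
  shows "finite (means k W) \<and> card (means k W) \<le> (k + card W - 1) choose k"
proof -
  define m where "m = card W"
  have m: "0 < m" using W by (simp add: m_def card_gt_0_iff)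
  obtain h where h: "bij_betw h {..<m} W"
    using ex_bij_betw_nat_finite[OF W(1)] by (auto simp: m_def lessThan_atLeast0)
  define L where "L = {ns :: nat list. length ns = m \<and> sum_list ns = k}"
  define F where "F ns = complex_of_real (1 / real k) *\<^sub>C (\<Sum>i<m. of_nat (ns ! i) *\<^sub>C h i)" for ns
  have cardL: "card L = (k + m - 1) choose k" unfolding L_def by (rule card_length_sum_list)
  have "0 < (k + m - 1) choose k" using m by (simp add: zero_less_binomial_iff)
  then have finL: "finite L" using cardL card_gt_0_iff[of L] by simp
  have "means k W \<subseteq> F ` L"
  proof
    fix z assume "z \<in> means k W"
    then obtain v where v: "z = mean k v" "\<And>l. l < k \<Longrightarrow> v l \<in> W" by (auto simp: means_def)
    define ns where "ns = map (\<lambda>i. card {l \<in> {..<k}. v l = h i}) [0..<m]"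
    have "sum_list ns = (\<Sum>i<m. card {l \<in> {..<k}. v l = h i})"
      unfolding ns_def by (simp add: interv_sum_list_conv_sum_set_nat lessThan_atLeast0)
    also have "\<dots> = (\<Sum>y\<in>W. card {l \<in> {..<k}. v l = y})" by (rule sum.reindex_bij_betw[OF h])
    also have "\<dots> = (\<Sum>y\<in>W. \<Sum>l | l \<in> {..<k} \<and> v l = y. 1)" by simp
    also have "\<dots> = (\<Sum>l<k. 1)" using v(2) W(1) by (intro sum.group) auto
    finally have "ns \<in> L" by (simp add: L_def ns_def)
    moreover have "z = F ns"
    proof -
      have "(\<Sum>l<k. v l) = (\<Sum>y\<in>W. \<Sum>l | l \<in> {..<k} \<and> v l = y. v l)"
        using v(2) W(1) by (intro sum.group[symmetric]) auto
      also have "\<dots> = (\<Sum>y\<in>W. of_nat (card {l \<in> {..<k}. v l = y}) *\<^sub>C y)"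
      proof (rule sum.cong[OF refl])
        fix y :: 'a
        have const: "(\<Sum>l\<in>S. y) = of_nat (card S) *\<^sub>C y" if "finite S" for S :: "nat set"
          using that by induction (auto simp: scaleC_add_left scaleC_one)
        have "(\<Sum>l | l \<in> {..<k} \<and> v l = y. v l) = (\<Sum>l | l \<in> {..<k} \<and> v l = y. y)" by (rule sum.cong) auto
        then show "(\<Sum>l | l \<in> {..<k} \<and> v l = y. v l) = of_nat (card {l \<in> {..<k}. v l = y}) *\<^sub>C y"
          by (simp add: const)
      qed
      also have "\<dots> = (\<Sum>i<m. of_nat (card {l \<in> {..<k}. v l = h i}) *\<^sub>C h i)"
        by (rule sum.reindex_bij_betw[OF h, symmetric])
      also have "\<dots> = (\<Sum>i<m. of_nat (ns ! i) *\<^sub>C h i)" by (rule sum.cong) (auto simp: ns_def)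
      finally show ?thesis unfolding v(1) mean_def F_def by simp
    qed
    ultimately show "z \<in> F ` L" by blast
  qed
  then show ?thesis using finL cardL card_image_le[OF finL, of F] card_mono[of "F ` L" "means k W"]
    by (auto simp: m_def intro: finite_subset)
qed

section \<open>CCA approximations give small nets\<close>

lemma completely_isometric_norm:
  assumes "completely_isometric f" shows "clinear_on UNIV f" "norm (f x) = norm x"
proof -
  show lin: "clinear_on UNIV f" using assms by (simp add: completely_isometric_def)
  have "mat1 x \<in> mats 1 UNIV" by (simp add: mats_def mat1_def)
  then have "mnorm 1 (map_mat f (mat1 x)) = mnorm 1 (mat1 x)"
    using assms by (simp add: completely_isometric_def)
  moreover have "map_mat f (mat1 x) = mat1 (f x)"
    using clinear_on_0[OF lin] by (auto simp: map_mat_def mat1_def fun_eq_iff)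
  ultimately show "norm (f x) = norm x" by (simp only: mnorm_mat1)
qed

lemma CCA_contractions:
  fixes \<kappa> :: "'x::operator_space \<Rightarrow> 'z::operator_space"
  assumes "(\<phi>, \<psi>, B) \<in> CCA \<kappa> \<Omega> \<delta>"
  shows "fd_cstar B" "clinear_on UNIV \<phi>" "\<phi> x \<in> B_carrier B" "fd_cstar.nrm B (\<phi> x) \<le> norm x"
    "clinear_on (B_carrier B) \<psi>" "b \<in> B_carrier B \<Longrightarrow> norm (\<psi> b) \<le> fd_cstar.nrm B b"
    "y \<in> \<Omega> \<Longrightarrow> norm (\<psi> (\<phi> y) - \<kappa> y) < \<delta>"
proof -
  have *: "fd_cstar_algebra B" "\<And>x. \<phi> x \<in> B_carrier B" "clinear_on UNIV \<phi>" "clinear_on (B_carrier B) \<psi>"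
    "\<And>n a. 1 \<le> n \<Longrightarrow> a \<in> mats n UNIV \<Longrightarrow> B_mnorm B n (map_mat \<phi> a) \<le> mnorm n a"
    "\<And>n b. 1 \<le> n \<Longrightarrow> b \<in> mats n (B_carrier B) \<Longrightarrow> mnorm n (map_mat \<psi> b) \<le> B_mnorm B n b"
    "\<And>y. y \<in> \<Omega> \<Longrightarrow> norm (\<psi> (\<phi> y) - \<kappa> y) < \<delta>"
    using assms unfolding CCA_def by (auto simp: Pi_def)
  show B: "fd_cstar B" by (rule fd_cstar.intro[OF *(1)])
  interpret fd_cstar B by (rule B)
  show "clinear_on UNIV \<phi>" "\<phi> x \<in> B_carrier B" "clinear_on (B_carrier B) \<psi>" by (rule *)+
  show "y \<in> \<Omega> \<Longrightarrow> norm (\<psi> (\<phi> y) - \<kappa> y) < \<delta>" by (rule *(7))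
  have "mat1 x \<in> mats 1 UNIV" by (simp add: mats_def mat1_def)
  then have "B_mnorm B 1 (map_mat \<phi> (mat1 x)) \<le> mnorm 1 (mat1 x)" by (rule *(5)[OF order_refl])
  moreover have "map_mat \<phi> (mat1 x) = mat1 (\<phi> x)"
    unfolding map_mat_def mat1_def using clinear_on_0[OF *(3)] by (intro ext) (simp only: if_distrib[of \<phi>] UNIV_I)
  ultimately show "nrm (\<phi> x) \<le> norm x" unfolding nrm_def by (simp only: mnorm_mat1)
  assume b: "b \<in> B_carrier B"
  have "mat1 b \<in> mats 1 (B_carrier B)" unfolding mats_def mat1_def using b by auto
  then have "mnorm 1 (map_mat \<psi> (mat1 b)) \<le> B_mnorm B 1 (mat1 b)" by (rule *(6)[OF order_refl])
  moreover have "map_mat \<psi> (mat1 b) = mat1 (\<psi> b)"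
    unfolding map_mat_def mat1_def using clinear_on_0[OF *(4) V_0] by (intro ext) (simp only: if_distrib[of \<psi>])
  ultimately show "norm (\<psi> b) \<le> nrm b" unfolding nrm_def by (simp only: mnorm_mat1)
qed

text \<open>Approximate the combination by a long mean, transport it to \<open>B\<close>, and thin it out there. Both means consist of vectors from
  \<open>phases \<Omega>\<close>, on which \<open>\<psi> \<circ> \<phi>\<close> is \<open>2 \<delta>\<close>-close to \<open>\<kappa>\<close>; so the distance of the means
  in \<open>X\<close> exceeds their distance in \<open>B\<close> by at most \<open>4 \<delta>\<close>.\<close>
lemma means_net:
  fixes \<kappa> :: "'x::operator_space \<Rightarrow> 'z::operator_space"
  assumes \<kappa>: "completely_isometric \<kappa>" and CCA: "(\<phi>, \<psi>, B) \<in> CCA \<kappa> \<Omega> \<delta>"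
    and \<Omega>: "finite \<Omega>" "\<And>x. x \<in> \<Omega> \<Longrightarrow> norm x \<le> R" and R: "0 \<le> R" and \<delta>: "0 < \<delta>"
    and q: "q = 2 * 2 ^ j" and rank: "2 * real (B_rank B) ^ 4 \<le> exp (2 * real q)" and k: "2 * q \<le> k"
    and c: "(\<Sum>x\<in>\<Omega>. cmod (c x)) \<le> 1"
  shows "\<exists>z\<in>means k (phases \<Omega>). norm ((\<Sum>x\<in>\<Omega>. c x *\<^sub>C x) - z) \<le> 8 * exp 2 * sqrt 2 * R * sqrt (real q / real k) + 5 * \<delta>"
proof -
  note \<phi> = CCA_contractions[OF CCA] and \<kappa>' = completely_isometric_norm[OF \<kappa>]
  interpret fd_cstar B by (rule \<phi>(1))
  have "1 \<le> q" by (simp add: q)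
  then have k0: "0 < k" using k by linarith
  obtain s v where v: "\<And>l. l < 2 ^ s * k \<Longrightarrow> v l \<in> phases \<Omega>"
    "norm ((\<Sum>x\<in>\<Omega>. c x *\<^sub>C x) - mean (2 ^ s * k) v) \<le> \<delta>"
    by (rule l1_combination_near_mean[OF \<Omega>(1) _ c \<delta> k0]) (erule \<Omega>(2), rule that)
  have normW: "norm w \<le> 2 * R" if "w \<in> phases \<Omega>" for w
    using that by (rule phasesE) (use \<Omega>(2) R in \<open>auto simp: norm_scaleC norm_mult\<close>)
  have \<psi>\<phi>lin: "clinear_on UNIV (\<lambda>x. \<psi> (\<phi> x) - \<kappa> x)"
    unfolding clinear_on_def
    by (simp add: clinear_onD[OF \<phi>(2)] clinear_onD[OF \<phi>(5)] clinear_onD[OF \<kappa>'(1)] \<phi>(3)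
        complex_vector.scale_right_diff_distrib)
  have errW: "norm (\<psi> (\<phi> w) - \<kappa> w) \<le> 2 * \<delta>" if "w \<in> phases \<Omega>" for w
    using that
  proof (rule phasesE)
    assume "w = 0"
    then show ?thesis using clinear_on_0[OF \<psi>\<phi>lin] \<delta> by simp
  next
    fix x u assume x: "x \<in> \<Omega>" and u: "cmod u = 1" and w: "w = (2 * u) *\<^sub>C x"
    have "\<psi> (\<phi> w) - \<kappa> w = (2 * u) *\<^sub>C (\<psi> (\<phi> x) - \<kappa> x)"
      unfolding w using clinear_onD(2)[OF \<psi>\<phi>lin, of x "2 * u"] by simp
    then show ?thesis using \<phi>(7)[OF x] u by (simp add: norm_scaleC norm_mult)
  qed
  let ?c = "exp 2 * sqrt 2 * (2 * R) * sqrt (real q / real k)"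
  have "\<exists>g. (\<forall>l<k. g l < 2 ^ s * k) \<and> nrm (mean (2 ^ s * k) (\<lambda>l. \<phi> (v l)) - mean k (\<lambda>l. \<phi> (v (g l))))
    \<le> ?c * (4 - 4 * sqrt (1 / 2) ^ s)"
  proof (rule sparsification[OF _ _ _ q rank k])
    show "nrm (\<phi> (v l)) \<le> 2 * R" if "l < 2 ^ s * k" for l
      using \<phi>(4)[of "v l"] normW[OF v(1)[OF that]] by simp
  qed (use \<phi>(3) R in auto)
  then obtain g where g: "\<And>l. l < k \<Longrightarrow> g l < 2 ^ s * k"
    "nrm (mean (2 ^ s * k) (\<lambda>l. \<phi> (v l)) - mean k (\<lambda>l. \<phi> (v (g l)))) \<le> ?c * (4 - 4 * sqrt (1 / 2) ^ s)"
    by blast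
  define y where "y = mean (2 ^ s * k) v"
  define z where "z = mean k (\<lambda>l. v (g l))"
  have zW: "z \<in> means k (phases \<Omega>)" unfolding means_def z_def using v(1) g(1) by blast
  have c0: "0 \<le> ?c" using R by simp
  have "\<phi> (y - z) = mean (2 ^ s * k) (\<lambda>l. \<phi> (v l)) - mean k (\<lambda>l. \<phi> (v (g l)))"
    unfolding y_def z_def clinear_on_mean[OF \<phi>(2), symmetric]
    by (rule clinear_on_diff[OF \<phi>(2) complex_vector.subspace_UNIV]) auto
  then have "nrm (\<phi> (y - z)) \<le> ?c * (4 - 4 * sqrt (1 / 2) ^ s)" using g(2) by (simp only:)
  also have "\<dots> \<le> ?c * 4" using c0 by (intro mult_left_mono) auto
  finally have 1: "norm (\<psi> (\<phi> (y - z))) \<le> ?c * 4" using \<phi>(6)[OF \<phi>(3)[of "y - z"]] by linarith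
  have err: "norm (\<psi> (\<phi> (mean m u)) - \<kappa> (mean m u)) \<le> 2 * \<delta>" if "\<And>l. l < m \<Longrightarrow> u l \<in> phases \<Omega>" for m u
    unfolding clinear_on_mean[OF \<psi>\<phi>lin] using errW that \<delta> by (intro norm_mean_le) auto
  have "\<psi> (\<phi> (y - z)) - \<kappa> (y - z) = (\<psi> (\<phi> y) - \<kappa> y) - (\<psi> (\<phi> z) - \<kappa> z)"
    by (rule clinear_on_diff[OF \<psi>\<phi>lin complex_vector.subspace_UNIV]) auto
  then have "norm (\<psi> (\<phi> (y - z)) - \<kappa> (y - z)) \<le> norm (\<psi> (\<phi> y) - \<kappa> y) + norm (\<psi> (\<phi> z) - \<kappa> z)"
    by (metis norm_triangle_ineq4)
  also have "\<dots> \<le> 2 * \<delta> + 2 * \<delta>"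
    unfolding y_def z_def using v(1) g(1) by (intro add_mono err) auto
  finally have 2: "norm (\<psi> (\<phi> (y - z)) - \<kappa> (y - z)) \<le> 4 * \<delta>" by simp
  have "norm (y - z) = norm (\<kappa> (y - z))" by (simp add: \<kappa>'(2))
  also have "\<dots> \<le> norm (\<psi> (\<phi> (y - z))) + norm (\<psi> (\<phi> (y - z)) - \<kappa> (y - z))"
    using norm_triangle_sub[of "\<kappa> (y - z)" "\<psi> (\<phi> (y - z))"] by (simp add: norm_minus_commute)
  also have "\<dots> \<le> ?c * 4 + 4 * \<delta>" using 1 2 by (rule add_mono)
  finally have "norm (y - z) \<le> ?c * 4 + 4 * \<delta>" .
  moreover have "norm ((\<Sum>x\<in>\<Omega>. c x *\<^sub>C x) - z) \<le> norm ((\<Sum>x\<in>\<Omega>. c x *\<^sub>C x) - y) + norm (y - z)"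
    using norm_triangle_ineq[of "(\<Sum>x\<in>\<Omega>. c x *\<^sub>C x) - y" "y - z"] by simp
  ultimately have "norm ((\<Sum>x\<in>\<Omega>. c x *\<^sub>C x) - z) \<le> 8 * exp 2 * sqrt 2 * R * sqrt (real q / real k) + 5 * \<delta>"
    using v(2) unfolding y_def[symmetric] by simp
  then show ?thesis using zW by blast
qed

lemma rc_le_binomial:
  fixes \<kappa> :: "'x::operator_space \<Rightarrow> 'z::operator_space" and \<iota> :: "'x \<Rightarrow> 'y::complex_banach"
  assumes \<iota>: "CA_embedding \<iota>" and \<kappa>: "completely_isometric \<kappa>" and CCA: "(\<phi>, \<psi>, B) \<in> CCA \<kappa> \<Omega> (\<delta> / 10)"
    and \<Omega>: "finite \<Omega>" "\<And>x. x \<in> \<Omega> \<Longrightarrow> norm x \<le> R" and R: "0 \<le> R" and \<delta>: "0 < \<delta>"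
    and q: "q = 2 * 2 ^ j" and rank: "2 * real (B_rank B) ^ 4 \<le> exp (2 * real q)"
    and L: "2 \<le> L" "16 * exp 2 * sqrt 2 * R \<le> \<delta> * sqrt (real L)"
  shows "rc \<iota> \<Omega> (3 * \<delta>) \<le> (q * L + 4 * card \<Omega>) choose (q * L)"
proof -
  define W where "W = phases \<Omega>"
  define k where "k = q * L"
  have k: "2 * q \<le> k" using L by (simp add: k_def)
  have q0: "0 < q" by (simp add: q)
  have W: "finite W" "W \<noteq> {}" using finite_phases[OF \<Omega>(1)] by (auto simp: W_def phases_def)
  have cW: "0 < card W" using W by (simp add: card_gt_0_iff)
  have d: "0 < \<delta> / 10" using \<delta> by simp
  have "sqrt (real q / real k) = 1 / sqrt (real L)" using q0 by (simp add: k_def real_sqrt_divide real_sqrt_mult)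
  moreover have "8 * exp 2 * sqrt 2 * R * (1 / sqrt (real L)) \<le> \<delta> / 2"
    using L by (simp add: field_simps)
  ultimately have acc: "8 * exp 2 * sqrt 2 * R * sqrt (real q / real k) + 5 * (\<delta> / 10) \<le> \<delta>" by simp
  have "rc \<iota> \<Omega> (3 * \<delta>) \<le> card (means k W)"
  proof (rule rc_le_card_net[OF \<iota> \<Omega>(1) _ _ \<delta>])
    show "finite (means k W)" using means_finite_card[OF W] by blast
    have "mean k (\<lambda>_. 0) \<in> means k W" unfolding means_def by (auto simp: W_def phases_def)
    then show "means k W \<noteq> {}" by blast
    show "\<exists>z\<in>means k W. norm ((\<Sum>x\<in>\<Omega>. c x *\<^sub>C x) - z) \<le> \<delta>" if "(\<Sum>x\<in>\<Omega>. cmod (c x)) \<le> 1" for c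
      using means_net[OF \<kappa> CCA \<Omega> R d q rank k that] acc unfolding W_def by (meson order_trans)
  qed
  also have "\<dots> \<le> (k + card W - 1) choose k" using means_finite_card[OF W] by blast
  also have "\<dots> \<le> (k + 4 * card \<Omega>) choose k"
    using card_phases_le[OF \<Omega>(1)] by (intro binomial_right_mono) (simp add: W_def)
  finally show ?thesis by (simp add: k_def)
qed

section \<open>Subexponential growth\<close>

text \<open>From \<open>((k + m) choose k) * t ^ k \<le> (1 + t) ^ (k + m)\<close>. With \<open>t\<close> small and fixed this is subexponential in \<open>m\<close> when \<open>k = o(m)\<close>.\<close>
lemma ln_binomial_le:
  assumes t: "0 < t" "t \<le> 1"
  shows "ln (real ((k + m) choose k)) \<le> real k * (t + ln (1 / t)) + real m * t"
proof -
  have "real ((k + m) choose k) * t ^ k \<le> (t + 1) ^ (k + m)"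
  proof -
    have "(\<Sum>i\<in>{k}. real ((k + m) choose i) * t ^ i * 1 ^ (k + m - i)) \<le> (\<Sum>i\<le>k + m. real ((k + m) choose i) * t ^ i * 1 ^ (k + m - i))"
      using t by (intro sum_mono2) auto
    then show ?thesis by (simp add: binomial_ring)
  qed
  moreover have pos: "0 < real ((k + m) choose k)" by (simp add: zero_less_binomial_iff)
  ultimately have "ln (real ((k + m) choose k) * t ^ k) \<le> ln ((t + 1) ^ (k + m))"
    using t by (subst ln_le_cancel_iff) auto
  then have "ln (real ((k + m) choose k)) + real k * ln t \<le> real (k + m) * ln (t + 1)"
    using t pos by (simp add: ln_mult ln_realpow)
  also have "\<dots> \<le> real (k + m) * t"
    using ln_add_one_self_le_self[of t] t by (intro mult_left_mono) (auto simp: add.commute)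
  finally show ?thesis using t by (simp add: ln_div algebra_simps)
qed

lemma power_of_two_between:
  assumes "1 \<le> (y :: real)" obtains j where "y \<le> 2 * 2 ^ j" "2 * 2 ^ j \<le> 2 * y"
proof -
  have "1 \<le> nat \<lfloor>y\<rfloor>" using assms by linarith
  then obtain j where j: "2 ^ j \<le> nat \<lfloor>y\<rfloor>" "nat \<lfloor>y\<rfloor> < 2 ^ (j + 1)"
    using ex_power_ivl1[of 2 "nat \<lfloor>y\<rfloor>"] by auto
  have "real (2 ^ j) \<le> real (nat \<lfloor>y\<rfloor>)" using j(1) by (rule of_nat_mono)
  also have "\<dots> \<le> y" using assms by simp
  finally have 1: "2 ^ j \<le> y" by simp
  have "Suc (nat \<lfloor>y\<rfloor>) \<le> 2 ^ (j + 1)" using j(2) by simp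
  then have "real (Suc (nat \<lfloor>y\<rfloor>)) \<le> real (2 ^ (j + 1))" by (rule of_nat_mono)
  moreover have "y \<le> real (Suc (nat \<lfloor>y\<rfloor>))" using assms by linarith
  ultimately have "y \<le> 2 * 2 ^ j" by simp
  then show thesis using 1 that by simp
qed

lemma rcc_attained:
  assumes "nuclear_embedding \<kappa>" "finite \<Omega>" "0 < \<delta>"
  obtains \<phi> \<psi> B where "(\<phi>, \<psi>, B) \<in> CCA \<kappa> \<Omega> \<delta>" "B_rank B = rcc \<kappa> \<Omega> \<delta>"
proof -
  let ?S = "{r. \<exists>\<phi> \<psi> B. (\<phi>, \<psi>, B) \<in> CCA \<kappa> \<Omega> \<delta> \<and> r = B_rank B}"
  have "CCA \<kappa> \<Omega> \<delta> \<noteq> {}" using assms unfolding nuclear_embedding_def by blast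
  then obtain \<phi> \<psi> B where "(\<phi>, \<psi>, B) \<in> CCA \<kappa> \<Omega> \<delta>" by (metis ex_in_conv prod_cases3)
  then have "?S \<noteq> {}" by blast
  then have "Inf ?S \<in> ?S" by (rule Inf_nat_def1)
  then show thesis using that unfolding rcc_def by auto
qed

text \<open>The exponent \<open>q\<close> is a power of two between \<open>1 + 2 e\<close> and \<open>2 + 4 e\<close>, which makes \<open>exp (2 q)\<close> at least \<open>2 rank ^ 4\<close>.
  Rank zero causes no trouble, since \<open>exp e\<close> bounds it as well.\<close>
lemma ln_rc_le:
  fixes \<kappa> :: "'x::operator_space \<Rightarrow> 'z::operator_space" and \<iota> :: "'x \<Rightarrow> 'y::complex_banach"
  assumes \<iota>: "CA_embedding \<iota>" and \<kappa>: "nuclear_embedding \<kappa>"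
    and \<Omega>: "finite \<Omega>" "\<And>x. x \<in> \<Omega> \<Longrightarrow> norm x \<le> R" and R: "0 \<le> R" and \<delta>: "0 < \<delta>"
    and L: "2 \<le> L" "16 * exp 2 * sqrt 2 * R \<le> \<delta> * sqrt (real L)"
    and t: "0 < t" "t \<le> 1" and e: "ln (real (rcc \<kappa> \<Omega> (\<delta> / 10))) \<le> e" "0 \<le> e"
  shows "ln (real (rc \<iota> \<Omega> (3 * \<delta>))) \<le> (2 + 4 * e) * real L * (t + ln (1 / t)) + 4 * real (card \<Omega>) * t"
proof -
  have d: "0 < \<delta> / 10" using \<delta> by simp
  obtain \<phi> \<psi> B where CCA: "(\<phi>, \<psi>, B) \<in> CCA \<kappa> \<Omega> (\<delta> / 10)" and B: "B_rank B = rcc \<kappa> \<Omega> (\<delta> / 10)"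
    by (rule rcc_attained[OF \<kappa> \<Omega>(1) d])
  have "1 \<le> 1 + 2 * e" using e by simp
  then obtain j where j: "1 + 2 * e \<le> 2 * 2 ^ j" "2 * 2 ^ j \<le> 2 * (1 + 2 * e)" by (rule power_of_two_between)
  define q :: nat where "q = 2 * 2 ^ j"
  have q: "1 + 2 * e \<le> real q" "real q \<le> 2 + 4 * e" using j by (auto simp: q_def)
  have "real (B_rank B) \<le> exp e"
  proof (cases "B_rank B = 0")
    case False
    then have "real (B_rank B) = exp (ln (real (B_rank B)))" by simp
    also have "\<dots> \<le> exp e" using e B by simp
    finally show ?thesis .
  qed simp
  then have "real (B_rank B) ^ 4 \<le> exp e ^ 4" by (intro power_mono) auto
  also have "exp e ^ 4 = exp (4 * e)" by (simp add: exp_of_nat_mult[symmetric])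
  finally have "2 * real (B_rank B) ^ 4 \<le> exp 2 * exp (4 * e)"
    using exp_ge_add_one_self[of "2::real"] by (intro mult_mono) auto
  also have "\<dots> \<le> exp (2 * real q)" unfolding exp_add[symmetric] using q by simp
  finally have rank: "2 * real (B_rank B) ^ 4 \<le> exp (2 * real q)" .
  have \<kappa>': "completely_isometric \<kappa>" using \<kappa> by (simp add: nuclear_embedding_def)
  have "rc \<iota> \<Omega> (3 * \<delta>) \<le> (q * L + 4 * card \<Omega>) choose (q * L)"
    by (rule rc_le_binomial[OF \<iota> \<kappa>' CCA \<Omega> R \<delta> q_def rank L])
  then have rc: "real (rc \<iota> \<Omega> (3 * \<delta>)) \<le> real ((q * L + 4 * card \<Omega>) choose (q * L))" by simp
  have "ln (real (rc \<iota> \<Omega> (3 * \<delta>))) \<le> ln (real ((q * L + 4 * card \<Omega>) choose (q * L)))"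
  proof (cases "rc \<iota> \<Omega> (3 * \<delta>) = 0")
    case True
    have "1 \<le> real ((q * L + 4 * card \<Omega>) choose (q * L))" by (simp add: Suc_le_eq zero_less_binomial_iff)
    then show ?thesis using True by simp
  next
    case False
    then show ?thesis using rc by simp
  qed
  also have "\<dots> \<le> real (q * L) * (t + ln (1 / t)) + real (4 * card \<Omega>) * t" by (rule ln_binomial_le[OF t])
  also have "\<dots> \<le> (2 + 4 * e) * real L * (t + ln (1 / t)) + 4 * real (card \<Omega>) * t"
  proof -
    have "real q * real L \<le> (2 + 4 * e) * real L" using q by (intro mult_right_mono) auto
    moreover have "0 \<le> t + ln (1 / t)" using t by (simp add: add_nonneg_nonneg)
    ultimately show ?thesis by (simp add: mult_right_mono)
  qed
  finally show ?thesis .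
qed

lemma norm_orbit:
  fixes \<alpha> :: "'x::operator_space \<Rightarrow> 'x"
  assumes "completely_isometric \<alpha>" "x \<in> orbit \<alpha> \<Omega> n" "\<And>x. x \<in> \<Omega> \<Longrightarrow> norm x \<le> R"
  shows "norm x \<le> R"
proof -
  obtain i y where "y \<in> \<Omega>" "x = (\<alpha> ^^ i) y" using assms(2) by (auto simp: orbit_def)
  moreover have "norm ((\<alpha> ^^ i) y) = norm y" by (induction i) (auto simp: completely_isometric_norm(2)[OF assms(1)])
  ultimately show ?thesis using assms(3) by simp
qed

lemma card_orbit_le: "finite \<Omega> \<Longrightarrow> card (orbit \<alpha> \<Omega> n) \<le> n * card \<Omega>"
proof -
  assume \<Omega>: "finite \<Omega>"
  have "card (orbit \<alpha> \<Omega> n) \<le> (\<Sum>i<n. card ((\<alpha> ^^ i) ` \<Omega>))" unfolding orbit_def by (rule card_UN_le) simp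
  also have "\<dots> \<le> (\<Sum>i<n. card \<Omega>)" using \<Omega> by (intro sum_mono card_image_le)
  finally show ?thesis by simp
qed

theorem proposition4p2:
  fixes \<alpha> :: "'x::operator_space \<Rightarrow> 'x"
    and \<iota> :: "'x \<Rightarrow> 'y::complex_banach"
    and \<kappa> :: "'x \<Rightarrow> 'z::operator_space"
  assumes "completely_isometric_automorphism \<alpha>"
    and "CA_embedding \<iota>"
    and "nuclear_embedding \<kappa>"
    and "hc \<iota> \<alpha> > 0"
  shows "hcc \<kappa> \<alpha> > 0"
proof (rule ccontr)
  assume "\<not> hcc \<kappa> \<alpha> > 0"
  then have hcc0: "hcc \<kappa> \<alpha> \<le> 0" by simp
  have \<alpha>: "completely_isometric \<alpha>" using assms(1) by (simp add: completely_isometric_automorphism_def)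
  obtain \<Omega> \<delta>' where \<Omega>: "finite \<Omega>" and \<delta>': "0 < \<delta>'"
    and pos: "0 < limsup (\<lambda>n. ereal (1 / real n * ln (real (rc \<iota> (orbit \<alpha> \<Omega> n) \<delta>'))))"
    using assms(4) unfolding hc_def less_SUP_iff by auto
  define \<delta> where "\<delta> = \<delta>' / 3"
  have \<delta>: "0 < \<delta>" and \<delta>3: "\<delta>' = 3 * \<delta>" using \<delta>' by (auto simp: \<delta>_def)
  define R where "R = (\<Sum>x\<in>\<Omega>. norm x)"
  have R0: "0 \<le> R" by (simp add: R_def sum_nonneg)
  have R: "norm x \<le> R" if "x \<in> \<Omega>" for x unfolding R_def using \<Omega> that by (intro member_le_sum) auto
  define L where "L = 2 + nat \<lceil>(16 * exp 2 * sqrt 2 * R / \<delta>)\<^sup>2\<rceil>"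
  have L2: "2 \<le> L" by (simp add: L_def)
  have "(16 * exp 2 * sqrt 2 * R / \<delta>)\<^sup>2 \<le> real L" unfolding L_def by linarith
  then have "16 * exp 2 * sqrt 2 * R / \<delta> \<le> sqrt (real L)" by (rule real_le_rsqrt)
  then have LR: "16 * exp 2 * sqrt 2 * R \<le> \<delta> * sqrt (real L)" using \<delta> by (simp add: field_simps)
  define w where "w = real (card \<Omega>)"
  have w0: "0 \<le> w" by (simp add: w_def)
  have "limsup (\<lambda>n. ereal (1 / real n * ln (real (rc \<iota> (orbit \<alpha> \<Omega> n) \<delta>')))) \<le> 0 + ereal \<eta>" if \<eta>: "0 < \<eta>" for \<eta>
  proof -
    \<comment> \<open>First \<open>t\<close> makes the contribution of \<open>card (orbit \<alpha> \<Omega> n) \<le> w n\<close> small; then, with \<open>t\<close> fixed, the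
    growth rate \<open>e\<close> of the rank is taken small enough for the remaining term.\<close>
    define t where "t = min 1 (\<eta> / (16 * (w + 1)))"
    have t: "0 < t" "t \<le> 1" using \<eta> w0 by (auto simp: t_def)
    have "t \<le> \<eta> / (16 * (w + 1))" by (simp add: t_def)
    then have "t * (16 * (w + 1)) \<le> \<eta>" using w0 by (subst (asm) pos_le_divide_eq) auto
    then have tw: "4 * w * t \<le> \<eta> / 4" using t w0 by (simp add: algebra_simps)
    define C where "C = real L * (t + ln (1 / t))"
    have C0: "0 \<le> C" using t by (simp add: C_def add_nonneg_nonneg)
    define e where "e = \<eta> / (16 * (C + 1))"
    have e0: "0 < e" using \<eta> C0 by (simp add: e_def)
    have eC: "4 * e * C \<le> \<eta> / 4" using \<eta> C0 by (simp add: e_def field_simps)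
    have "limsup (\<lambda>n. ereal (1 / real n * ln (real (rcc \<kappa> (orbit \<alpha> \<Omega> n) (\<delta> / 10))))) \<le> hcc \<kappa> \<alpha>"
      unfolding hcc_def using \<Omega> \<delta> by (intro SUP_upper2[of \<Omega>] SUP_upper2[of "\<delta> / 10"]) auto
    also have "\<dots> < ereal e" using hcc0 e0 by (simp add: le_less_trans)
    finally have ev: "\<forall>\<^sub>F n in sequentially. ereal (1 / real n * ln (real (rcc \<kappa> (orbit \<alpha> \<Omega> n) (\<delta> / 10)))) < ereal e"
      by (rule Limsup_lessD)
    have "\<forall>\<^sub>F n in sequentially. nat \<lceil>8 * C / \<eta>\<rceil> + 1 \<le> n" by (rule eventually_ge_at_top)
    with ev have "\<forall>\<^sub>F n in sequentially. ereal (1 / real n * ln (real (rc \<iota> (orbit \<alpha> \<Omega> n) \<delta>'))) \<le> ereal \<eta>"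
    proof eventually_elim
      case (elim n)
      have n0: "0 < real n" using elim(2) by simp
      have "8 * C / \<eta> \<le> real n" using elim(2) by linarith
      then have nC: "2 * C \<le> real n * \<eta> / 4" using \<eta> by (simp add: field_simps)
      have fin: "finite (orbit \<alpha> \<Omega> n)" using \<Omega> by (simp add: orbit_def)
      have "ln (real (rcc \<kappa> (orbit \<alpha> \<Omega> n) (\<delta> / 10))) \<le> e * real n"
        using elim(1) n0 by (simp add: field_simps)
      then have "ln (real (rc \<iota> (orbit \<alpha> \<Omega> n) (3 * \<delta>)))
          \<le> (2 + 4 * (e * real n)) * real L * (t + ln (1 / t)) + 4 * real (card (orbit \<alpha> \<Omega> n)) * t"
        using e0 norm_orbit[OF \<alpha> _ R, where n = n]
        by (intro ln_rc_le[OF assms(2,3) fin _ R0 \<delta> L2 LR t]) auto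
      also have "\<dots> \<le> (2 * C + real n * (4 * e * C)) + real n * (4 * w * t)"
      proof (intro add_mono)
        show "(2 + 4 * (e * real n)) * real L * (t + ln (1 / t)) \<le> 2 * C + real n * (4 * e * C)"
          by (simp add: C_def algebra_simps)
        have "real (card (orbit \<alpha> \<Omega> n)) \<le> real n * w"
          using of_nat_mono[OF card_orbit_le[OF \<Omega>, of \<alpha> n]] by (simp add: w_def)
        then have "4 * real (card (orbit \<alpha> \<Omega> n)) * t \<le> 4 * (real n * w) * t"
          using t by (intro mult_right_mono) auto
        then show "4 * real (card (orbit \<alpha> \<Omega> n)) * t \<le> real n * (4 * w * t)" by (simp add: mult_ac)
      qed
      also have "\<dots> \<le> (real n * \<eta> / 4 + real n * (\<eta> / 4)) + real n * (\<eta> / 4)"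
        using eC tw nC n0 by (intro add_mono mult_left_mono) auto
      also have "\<dots> \<le> real n * \<eta>" using n0 \<eta> by simp
      finally show ?case using n0 by (simp add: \<delta>3 field_simps)
    qed
    then show ?thesis by (simp add: Limsup_bounded)
  qed
  then have "limsup (\<lambda>n. ereal (1 / real n * ln (real (rc \<iota> (orbit \<alpha> \<Omega> n) \<delta>')))) \<le> 0"
    by (rule ereal_le_epsilon2)
  then show False using pos by simp
qed

end
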